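(* Let $G$ be a finite simple graph of order $n$ with maximum degree $\Delta$. If $G$ is edge-$\Delta$-critical and $\Delta\geq \frac{2n}{3}+12$, then $G$ is Hamiltonian.
   Context: For a finite simple graph $G$ with maximum degree $\Delta$, the chromatic index $\chi'(G)$ is the least $k$ such that $G$ has a proper edge-coloring with $k$ colors. $G$ is called edge-$\Delta$-critical if $\chi'(G)=\Delta+1$ and $\chi'(H)\le \Delta$ for every proper subgraph $H$ of $G$. *)

theory Defs
  imports Complex_Main
begin

definition simple_graph :: "'a set \<Rightarrow> 'a set set \<Rightarrow> bool" where
  "simple_graph V E \<longleftrightarrow> finite V \<and> (\<forall>e\<in>E. e \<subseteq> V \<and> card e = 2)"

definition degree :: "'a set set \<Rightarrow> 'a \<Rightarrow> nat" where
  "degree E v = card {e\<in>E. v \<in> e}"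

definition max_degree :: "'a set \<Rightarrow> 'a set set \<Rightarrow> nat" where
  "max_degree V E = (if V = {} then 0 else Max (degree E ` V))"

definition proper_edge_coloring :: "'a set set \<Rightarrow> ('a set \<Rightarrow> nat) \<Rightarrow> nat \<Rightarrow> bool" where
  "proper_edge_coloring E c k \<longleftrightarrow>
     (\<forall>e\<in>E. c e < k) \<and>
     (\<forall>e\<in>E. \<forall>f\<in>E. e \<noteq> f \<and> e \<inter> f \<noteq> {} \<longrightarrow> c e \<noteq> c f)"

definition chromatic_index :: "'a set set \<Rightarrow> nat" where
  "chromatic_index E = (LEAST k. \<exists>c. proper_edge_coloring E c k)"

definition subgraph :: "'a set \<Rightarrow> 'a set set \<Rightarrow> 'a set \<Rightarrow> 'a set set \<Rightarrow> bool" where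
  "subgraph V' E' V E \<longleftrightarrow> V' \<subseteq> V \<and> E' \<subseteq> E \<and> (\<forall>e\<in>E'. e \<subseteq> V')"

definition edge_critical :: "'a set \<Rightarrow> 'a set set \<Rightarrow> bool" where
  "edge_critical V E \<longleftrightarrow>
     chromatic_index E = max_degree V E + 1 \<and>
     (\<forall>V' E'. subgraph V' E' V E \<and> (V', E') \<noteq> (V, E) \<longrightarrow>
        chromatic_index E' \<le> max_degree V E)"

definition hamiltonian :: "'a set \<Rightarrow> 'a set set \<Rightarrow> bool" where
  "hamiltonian V E \<longleftrightarrow>
     (\<exists>vs. distinct vs \<and> set vs = V \<and> length vs \<ge> 3 \<and>
        (\<forall>i < length vs. {vs ! i, vs ! ((i + 1) mod length vs)} \<in> E))"

end

theory Submission
  imports Defs "HOL-Combinatorics.Transposition" "HOL-Library.Transitive_Closure_Table"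
    "HOL-Library.Multiset"
begin

text \<open>
Write \<open>n\<close> for the order, \<open>k\<close> for the maximum degree, \<open>d\<close> for degrees, and call a vertex low if
\<open>2 d < k\<close>. Low vertices are independent by Vizing's adjacency lemma. A Woodall-type recolouring
argument shows that for a low vertex \<open>x\<close> the sum over its neighbours \<open>y\<close> of \<open>1 / l(y)\<close> is at least 2,
where \<open>l(y)\<close> counts the low neighbours of \<open>y\<close>; by Hall's argument every low vertex gets two
private neighbours, so low vertices can be inner vertices of disjoint paths of length two (cherries).

Pass to a Bondy--Chvatal closure. There the set \<open>Hub\<close> of non-low vertices adjacent to all other non-low
vertices contains all vertices of degree \<open>k\<close>, and together with the set \<open>Big\<close> of remaining vertices of
closure degree at least \<open>n/2\<close> it is a clique. A spanning linear forest without path ends at low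
vertices extends to a Hamilton cycle as soon as it has fewer path ends in the remaining set \<open>Small\<close>
than in \<open>Hub\<close>. Vizing's adjacency lemma gives that the sum over all vertices \<open>x\<close> outside \<open>Hub\<close> of the
proportion of the neighbours of \<open>x\<close> lying in \<open>Hub\<close> is less than \<open>|Hub|\<close>, and this bounds the number
of edges such a forest needs inside \<open>Small\<close> and between \<open>Small\<close> and \<open>Big\<close>. Vizing's theorem supplies
them: vertices of \<open>Small\<close> have few neighbours outside \<open>Hub\<close>, so one class of an edge colouring (after
splitting vertices that may be used twice) is heavy enough, even after breaking cycles.
\<close>

section \<open>Graphs and edge colourings\<close>

definition fin_graph :: "'a set set \<Rightarrow> bool" where
  "fin_graph E \<longleftrightarrow> finite E \<and> (\<forall>e\<in>E. card e = 2)"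

definition nbrs :: "'a set set \<Rightarrow> 'a \<Rightarrow> 'a set" where
  "nbrs E v = {w. {v, w} \<in> E}"

definition colorable :: "'a set set \<Rightarrow> nat \<Rightarrow> bool" where
  "colorable E k \<longleftrightarrow> (\<exists>c. proper_edge_coloring E c k)"

definition missing :: "'a set set \<Rightarrow> ('a set \<Rightarrow> nat) \<Rightarrow> nat \<Rightarrow> 'a \<Rightarrow> nat set" where
  "missing E c k v = {a. a < k \<and> (\<forall>e\<in>E. v \<in> e \<longrightarrow> c e \<noteq> a)}"

lemma fin_graph_finite: "fin_graph E \<Longrightarrow> finite E"
  unfolding fin_graph_def by simp

lemma fin_graph_card_edge: "fin_graph E \<Longrightarrow> e \<in> E \<Longrightarrow> card e = 2"
  unfolding fin_graph_def by simp

lemma fin_graph_subset: "fin_graph E \<Longrightarrow> F \<subseteq> E \<Longrightarrow> fin_graph F"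
  unfolding fin_graph_def by (meson finite_subset subsetD)

lemma fin_graph_edge_neq: "fin_graph E \<Longrightarrow> {x, y} \<in> E \<Longrightarrow> x \<noteq> y"
  using fin_graph_card_edge by fastforce

lemma fin_graph_edgeE:
  assumes "fin_graph E" "e \<in> E"
  obtains x y where "e = {x, y}" "x \<noteq> y"
  using fin_graph_card_edge[OF assms] by (meson card_2_iff)

lemma fin_graph_incident_edgeE:
  assumes "fin_graph E" "e \<in> E" "v \<in> e"
  obtains w where "e = {v, w}" "w \<noteq> v"
  using fin_graph_edgeE[OF assms(1,2)] assms(3) by (metis doubleton_eq_iff insertE singletonD)

lemma simple_graph_fin_graph: "simple_graph V E \<Longrightarrow> fin_graph E"
  unfolding simple_graph_def fin_graph_def by (meson PowI finite_Pow_iff finite_subset subsetI)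

lemma nbrs_iff: "w \<in> nbrs E v \<longleftrightarrow> {v, w} \<in> E"
  unfolding nbrs_def by simp

lemma nbrs_sym: "w \<in> nbrs E v \<longleftrightarrow> v \<in> nbrs E w"
  by (simp add: nbrs_iff insert_commute)

lemma nbrs_irrefl: "fin_graph E \<Longrightarrow> v \<notin> nbrs E v"
  using fin_graph_edge_neq by (metis nbrs_iff)

lemma nbrs_mono: "F \<subseteq> E \<Longrightarrow> nbrs F v \<subseteq> nbrs E v"
  unfolding nbrs_def by blast

lemma inj_incident_edge: "inj_on (\<lambda>w. {v, w}) A"
  by (auto simp: inj_on_def doubleton_eq_iff)

lemma incident_edges_eq_image_nbrs:
  assumes "fin_graph E"
  shows "{e\<in>E. v \<in> e} = (\<lambda>w. {v, w}) ` nbrs E v"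
  unfolding nbrs_def using fin_graph_incident_edgeE[OF assms] by blast

lemma degree_eq_card_nbrs: "fin_graph E \<Longrightarrow> degree E v = card (nbrs E v)"
  unfolding degree_def incident_edges_eq_image_nbrs by (rule card_image[OF inj_incident_edge])

lemma finite_nbrs: "fin_graph E \<Longrightarrow> finite (nbrs E v)"
  by (rule finite_imageD[OF _ inj_incident_edge, of v])
    (simp add: incident_edges_eq_image_nbrs[symmetric] fin_graph_finite)

lemma degree_mono: "finite F \<Longrightarrow> D \<subseteq> F \<Longrightarrow> degree D v \<le> degree F v"
  unfolding degree_def by (rule card_mono) auto

lemma degree_eq_0_iff: "finite F \<Longrightarrow> degree F v = 0 \<longleftrightarrow> v \<notin> \<Union>F"
  unfolding degree_def by auto

lemma degree_union_disjoint:
  assumes "finite F" "finite G" "F \<inter> G = {}"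
  shows "degree (F \<union> G) v = degree F v + degree G v"
proof -
  have "{e \<in> F \<union> G. v \<in> e} = {e\<in>F. v \<in> e} \<union> {e\<in>G. v \<in> e}" by blast
  moreover have "{e\<in>F. v \<in> e} \<inter> {e\<in>G. v \<in> e} = {}" using assms(3) by blast
  ultimately show ?thesis unfolding degree_def using assms by (simp add: card_Un_disjoint)
qed

lemma degree_insert_edge:
  assumes "finite F" "e \<notin> F"
  shows "degree (insert e F) v = degree F v + of_bool (v \<in> e)"
proof -
  have "{f \<in> insert e F. v \<in> f} = (if v \<in> e then insert e {f\<in>F. v \<in> f} else {f\<in>F. v \<in> f})" by auto
  then show ?thesis unfolding degree_def using assms by simp
qed

lemma degree_remove_edge:
  "finite E \<Longrightarrow> e \<in> E \<Longrightarrow> degree E v = degree (E - {e}) v + of_bool (v \<in> e)"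
  using degree_insert_edge[of "E - {e}" e v] by (simp add: insert_absorb)

lemma sum_degree_eq_sum_card_Int:
  assumes "finite F" "finite X"
  shows "(\<Sum>v\<in>X. degree F v) = (\<Sum>e\<in>F. card (e \<inter> X))"
proof -
  have "(\<Sum>v\<in>X. degree F v) = (\<Sum>v\<in>X. \<Sum>e | e \<in> F \<and> v \<in> e. 1)"
    unfolding degree_def by simp
  also have "\<dots> = (\<Sum>e\<in>F. \<Sum>v | v \<in> X \<and> v \<in> e. 1)"
    by (rule sum.swap_restrict[OF assms(2,1)])
  also have "\<dots> = (\<Sum>e\<in>F. card (e \<inter> X))"
    by (rule sum.cong[OF refl]) (simp add: Int_def conj_commute)
  finally show ?thesis .
qed

lemma sum_degree_eq_twice_card:
  assumes "fin_graph F" "finite X" "\<Union>F \<subseteq> X"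
  shows "(\<Sum>v\<in>X. degree F v) = 2 * card F"
proof -
  have "card (e \<inter> X) = 2" if "e \<in> F" for e
  proof -
    have "e \<inter> X = e" using assms(3) that by blast
    then show ?thesis using fin_graph_card_edge[OF assms(1) that] by simp
  qed
  then show ?thesis
    using sum_degree_eq_sum_card_Int[OF fin_graph_finite[OF assms(1)] assms(2)] by simp
qed

lemma proper_edge_coloringI:
  assumes "\<And>e. e \<in> E \<Longrightarrow> c e < k"
    and "\<And>v e f. e \<in> E \<Longrightarrow> f \<in> E \<Longrightarrow> v \<in> e \<Longrightarrow> v \<in> f \<Longrightarrow> c e = c f \<Longrightarrow> e = f"
  shows "proper_edge_coloring E c k"
  using assms unfolding proper_edge_coloring_def by blast

lemma proper_less: "proper_edge_coloring E c k \<Longrightarrow> e \<in> E \<Longrightarrow> c e < k"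
  unfolding proper_edge_coloring_def by blast

lemma proper_eqD:
  assumes "proper_edge_coloring E c k" "e \<in> E" "f \<in> E" "v \<in> e" "v \<in> f" "c e = c f"
  shows "e = f"
  using assms unfolding proper_edge_coloring_def by blast

lemma proper_subset: "proper_edge_coloring E c k \<Longrightarrow> F \<subseteq> E \<Longrightarrow> proper_edge_coloring F c k"
  unfolding proper_edge_coloring_def by blast

lemma proper_inj_on_incident: "proper_edge_coloring E c k \<Longrightarrow> inj_on c {e\<in>E. v \<in> e}"
  by (rule inj_onI) (auto dest: proper_eqD)

lemma colorable_mono: "colorable E j \<Longrightarrow> j \<le> k \<Longrightarrow> colorable E k"
  unfolding colorable_def proper_edge_coloring_def by (blast intro: order_less_le_trans)

lemma missing_eq_Diff: "missing E c k v = {..<k} - c ` {e\<in>E. v \<in> e}"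
  unfolding missing_def by auto

lemma finite_missing [simp]: "finite (missing E c k v)"
  unfolding missing_def by simp

lemma missing_less: "a \<in> missing E c k v \<Longrightarrow> a < k"
  unfolding missing_def by simp

lemma missing_subset: "missing E c k v \<subseteq> {..<k}"
  unfolding missing_def by blast

lemma missingD: "a \<in> missing E c k v \<Longrightarrow> e \<in> E \<Longrightarrow> v \<in> e \<Longrightarrow> c e \<noteq> a"
  unfolding missing_def by simp

lemma missing_cong:
  assumes "\<And>e. e \<in> E \<Longrightarrow> v \<in> e \<Longrightarrow> c e = d e"
  shows "missing E c k v = missing E d k v"
  using assms unfolding missing_def by auto

lemma card_missing:
  assumes "fin_graph E" "proper_edge_coloring E c k"
  shows "card (missing E c k v) + degree E v = k"
proof -
  have used: "c ` {e\<in>E. v \<in> e} \<subseteq> {..<k}" using proper_less[OF assms(2)] by blast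
  have "card (c ` {e\<in>E. v \<in> e}) = degree E v"
    unfolding degree_def by (rule card_image[OF proper_inj_on_incident[OF assms(2)]])
  moreover have "card (c ` {e\<in>E. v \<in> e}) \<le> k" using card_mono[OF _ used] by simp
  ultimately show ?thesis
    unfolding missing_eq_Diff using card_Diff_subset[OF _ used] finite_subset[OF used] by simp
qed

lemma bij_betw_color_nbrs:
  assumes graph: "fin_graph F" and proper: "proper_edge_coloring F c k"
    and T: "T \<subseteq> {..<k}" "T \<inter> missing F c k v = {}"
  shows "bij_betw (\<lambda>w. c {v, w}) {w \<in> nbrs F v. c {v, w} \<in> T} T"
  unfolding bij_betw_def
proof
  have "{v, w} = {v, w'}" if "w \<in> nbrs F v" "w' \<in> nbrs F v" "c {v, w} = c {v, w'}" for w w'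
    using proper_eqD[OF proper, of "{v, w}" "{v, w'}" v] that by (simp add: nbrs_iff)
  then show "inj_on (\<lambda>w. c {v, w}) {w \<in> nbrs F v. c {v, w} \<in> T}"
    using inj_incident_edge[of v] by (auto simp: inj_on_def)
  have "\<exists>w\<in>nbrs F v. c {v, w} = a" if "a \<in> T" for a
  proof -
    have "a < k" "a \<notin> missing F c k v" using T that by auto
    then obtain e where "e \<in> F" "v \<in> e" "c e = a" unfolding missing_def by auto
    moreover from this obtain w where "e = {v, w}" using fin_graph_incident_edgeE[OF graph] by metis
    ultimately show ?thesis by (auto simp: nbrs_iff)
  qed
  then show "(\<lambda>w. c {v, w}) ` {w \<in> nbrs F v. c {v, w} \<in> T} = T" by blast
qed

text \<open>
Colouring an uncoloured edge, recolouring an edge and moving a colour from one edge of a fan to the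
next are all instances of the following lemma, combined with \<open>missing_remove_edge\<close>.
\<close>

lemma proper_insert_edge:
  assumes proper: "proper_edge_coloring F c k" and "e \<noteq> {}"
    and free: "\<And>v. v \<in> e \<Longrightarrow> a \<in> missing F c k v"
  shows "proper_edge_coloring (insert e F) (c(e := a)) k"
proof (rule proper_edge_coloringI)
  show "(c(e := a)) f < k" if "f \<in> insert e F" for f
    using that proper_less[OF proper] missing_less[OF free] \<open>e \<noteq> {}\<close> by auto
next
  fix v f h assume fh: "f \<in> insert e F" "h \<in> insert e F" "v \<in> f" "v \<in> h" "(c(e := a)) f = (c(e := a)) h"
  have "c g \<noteq> a" if "g \<in> F" "v \<in> g" "v \<in> e" for g using missingD[OF free that(1,2)] that(3) by blast
  then show "f = h" using fh proper_eqD[OF proper, of f h v] by (auto split: if_splits)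
qed

lemma missing_insert_edge_in:
  assumes "v \<in> e"
  shows "missing (insert e F) (c(e := a)) k v = missing (F - {e}) c k v - {a}"
  using assms unfolding missing_def by auto

lemma missing_insert_edge_out:
  assumes "v \<notin> e"
  shows "missing (insert e F) (c(e := a)) k v = missing F c k v"
  using assms unfolding missing_def by auto

lemma missing_remove_edge:
  assumes "proper_edge_coloring F c k" "e \<in> F"
  shows "missing (F - {e}) c k v = (if v \<in> e then insert (c e) (missing F c k v) else missing F c k v)"
proof (cases "v \<in> e")
  case True
  then have "c f \<noteq> c e" if "f \<in> F - {e}" "v \<in> f" for f
    using proper_eqD[OF assms(1) _ assms(2), of f v] that by blast
  then show ?thesis using True proper_less[OF assms] unfolding missing_def by auto
next
  case False
  then show ?thesis unfolding missing_def by auto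
qed

lemma proper_recolor_edge:
  assumes "proper_edge_coloring F c k" "e \<in> F" "e \<noteq> {}"
    and "\<And>v. v \<in> e \<Longrightarrow> a \<in> missing F c k v"
  shows "proper_edge_coloring F (c(e := a)) k"
  using proper_insert_edge[OF assms(1,3,4)] assms(2) by (simp add: insert_absorb)

lemma missing_recolor_edge_in:
  assumes "proper_edge_coloring F c k" "e \<in> F" "v \<in> e"
  shows "missing F (c(e := a)) k v = insert (c e) (missing F c k v) - {a}"
  using missing_insert_edge_in[OF assms(3), of F c a k] missing_remove_edge[OF assms(1,2), of v]
    assms(2,3)
  by (simp add: insert_absorb)

lemma missing_recolor_edge_out:
  assumes "v \<notin> e"
  shows "missing F (c(e := a)) k v = missing F c k v"
  using assms by (intro missing_cong) auto

section \<open>Components and Kempe chains\<close>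

abbreviation adj :: "'a set set \<Rightarrow> 'a \<Rightarrow> 'a \<Rightarrow> bool" where
  "adj E a b \<equiv> {a, b} \<in> E"

definition component :: "'a set set \<Rightarrow> 'a \<Rightarrow> 'a set" where
  "component H v = {w. (adj H)\<^sup>*\<^sup>* v w}"

lemma component_self: "v \<in> component H v"
  unfolding component_def by simp

lemma component_step: "p \<in> component H v \<Longrightarrow> adj H p q \<Longrightarrow> q \<in> component H v"
  unfolding component_def by (auto intro: rtranclp.rtrancl_into_rtrancl)

lemma component_eq:
  assumes "w \<in> component H v"
  shows "component H w = component H v"
proof -
  have "symp (adj H)" by (simp add: symp_def insert_commute)
  then have "(adj H)\<^sup>*\<^sup>* w v" using assms unfolding component_def by (simp add: symp_rtranclp sympD)
  then show ?thesis using assms unfolding component_def by (auto intro: rtranclp_trans)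
qed

lemma component_crossing_edge:
  assumes "v \<in> S" "S \<subset> component H v"
  obtains p q where "p \<in> S" "q \<in> component H v - S" "adj H p q"
proof -
  have "\<exists>p q. p \<in> S \<and> q \<notin> S \<and> adj H p q"
  proof (rule ccontr)
    assume no_crossing: "\<nexists>p q. p \<in> S \<and> q \<notin> S \<and> adj H p q"
    have "w \<in> S" if "(adj H)\<^sup>*\<^sup>* v w" for w
      using that by (induction rule: rtranclp_induct) (use assms(1) no_crossing in blast)+
    then show False using assms(2) unfolding component_def by blast
  qed
  then show thesis using that component_step assms(2) by (metis DiffI psubsetD)
qed

lemma finite_component:
  assumes "fin_graph H"
  shows "finite (component H v)"
proof -
  have "w \<in> insert v (\<Union>H)" if "(adj H)\<^sup>*\<^sup>* v w" for w
    using that by (induction rule: rtranclp_induct) auto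
  then have "component H v \<subseteq> insert v (\<Union>H)" unfolding component_def by blast
  moreover have "finite (\<Union>H)"
    using assms unfolding fin_graph_def by (metis card.infinite finite_Union zero_neq_numeral)
  ultimately show ?thesis by (meson finite_insert finite_subset)
qed

lemma component_spanning_growth:
  assumes "fin_graph H" "n < card (component H v)"
  shows "\<exists>S\<subseteq>component H v. v \<in> S \<and> card S = Suc n \<and> n \<le> card {e\<in>H. e \<subseteq> S}"
  using assms(2)
proof (induction n)
  case 0
  show ?case by (rule exI[of _ "{v}"]) (auto simp: component_self)
next
  case (Suc n)
  let ?edges = "\<lambda>S. {e\<in>H. e \<subseteq> S}"
  obtain S where S: "S \<subseteq> component H v" "v \<in> S" "card S = Suc n" "n \<le> card (?edges S)"
    using Suc by auto
  moreover have "S \<noteq> component H v" using S(3) Suc.prems by auto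
  ultimately have "S \<subset> component H v" by blast
  then obtain p q where pq: "p \<in> S" "q \<in> component H v - S" "adj H p q"
    using component_crossing_edge S(2) by metis
  have fin: "finite S" "finite (?edges T)" for T
    using finite_subset[OF S(1) finite_component] assms(1) fin_graph_finite[OF assms(1)] by simp_all
  have "Suc (card (?edges S)) = card (insert {p, q} (?edges S))" using pq fin(2) by simp
  also have "\<dots> \<le> card (?edges (insert q S))" by (rule card_mono[OF fin(2)]) (use pq in auto)
  finally have "Suc n \<le> card (?edges (insert q S))" using S(4) by simp
  moreover have "card (insert q S) = Suc (Suc n)" using S(3) pq(2) fin(1) by simp
  moreover have "insert q S \<subseteq> component H v" "v \<in> insert q S" using S(1,2) pq(2) by auto
  ultimately show ?case by blast
qed

lemma card_component_le:
  assumes "fin_graph H"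
  shows "card (component H v) \<le> card {e\<in>H. e \<subseteq> component H v} + 1"
proof -
  have fin: "finite (component H v)" by (rule finite_component[OF assms])
  then have pos: "card (component H v) > 0" using component_self[of v H] by (auto simp: card_gt_0_iff)
  then have "card (component H v) - 1 < card (component H v)" by simp
  from component_spanning_growth[OF assms this] obtain S where S: "S \<subseteq> component H v"
      "card S = Suc (card (component H v) - 1)" "card (component H v) - 1 \<le> card {e\<in>H. e \<subseteq> S}"
    by blast
  have "S = component H v" by (rule card_subset_eq[OF fin S(1)]) (use S(2) pos in simp)
  then show ?thesis using S(3) by simp
qed

lemma card_component_leaves_le:
  assumes "fin_graph H" "\<And>w. degree H w \<le> 2"
    and "T \<subseteq> component H v" "\<And>t. t \<in> T \<Longrightarrow> degree H t \<le> 1"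
  shows "card T \<le> 2"
proof -
  define C where "C = component H v"
  define HC where "HC = {e\<in>H. e \<subseteq> C}"
  have finC: "finite C" unfolding C_def by (rule finite_component[OF assms(1)])
  have HC: "fin_graph HC" "\<Union>HC \<subseteq> C" unfolding HC_def using fin_graph_subset[OF assms(1)] by auto
  have "degree HC w + of_bool (w \<in> T) \<le> 2" for w
    using degree_mono[OF fin_graph_finite[OF assms(1)], of HC w] assms(2)[of w] assms(4)[of w]
    unfolding HC_def by auto
  then have "(\<Sum>w\<in>C. degree HC w + of_bool (w \<in> T)) \<le> (\<Sum>w\<in>C. 2)" by (intro sum_mono)
  moreover have "(\<Sum>w\<in>C. of_bool (w \<in> T)) = card T"
    using finC assms(3) unfolding C_def by (simp add: Int_absorb1)
  ultimately have "2 * card HC + card T \<le> 2 * card C"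
    using sum_degree_eq_twice_card[OF HC(1) finC HC(2)] by (simp add: sum.distrib)
  then show ?thesis using card_component_le[OF assms(1), of v] unfolding C_def HC_def by linarith
qed

definition kempe_chain :: "'a set set \<Rightarrow> ('a set \<Rightarrow> nat) \<Rightarrow> nat \<Rightarrow> nat \<Rightarrow> 'a \<Rightarrow> 'a set" where
  "kempe_chain F c a b v = component {e\<in>F. c e \<in> {a, b}} v"

definition kempe_closed :: "'a set set \<Rightarrow> ('a set \<Rightarrow> nat) \<Rightarrow> nat \<Rightarrow> nat \<Rightarrow> 'a set \<Rightarrow> bool" where
  "kempe_closed F c a b C \<longleftrightarrow> (\<forall>e\<in>F. c e \<in> {a, b} \<longrightarrow> e \<subseteq> C \<or> e \<inter> C = {})"

definition kempe_swap :: "('a set \<Rightarrow> nat) \<Rightarrow> nat \<Rightarrow> nat \<Rightarrow> 'a set \<Rightarrow> 'a set \<Rightarrow> nat" where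
  "kempe_swap c a b C e = (if e \<inter> C \<noteq> {} then transpose a b (c e) else c e)"

lemma transpose_less_iff: "a < k \<Longrightarrow> b < k \<Longrightarrow> transpose a b i < k \<longleftrightarrow> i < (k::nat)"
  unfolding transpose_def by auto

lemma kempe_swap_in: "v \<in> C \<Longrightarrow> v \<in> e \<Longrightarrow> kempe_swap c a b C e = transpose a b (c e)"
  unfolding kempe_swap_def by auto

lemma kempe_swap_out:
  assumes "kempe_closed F c a b C" "e \<in> F" "v \<notin> C" "v \<in> e"
  shows "kempe_swap c a b C e = c e"
  using assms unfolding kempe_swap_def kempe_closed_def by (auto simp: transpose_def)

lemma proper_kempe_swap:
  assumes proper: "proper_edge_coloring F c k" and closed: "kempe_closed F c a b C"
    and ab: "a < k" "b < k"
  shows "proper_edge_coloring F (kempe_swap c a b C) k"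
proof (rule proper_edge_coloringI)
  show "kempe_swap c a b C e < k" if "e \<in> F" for e
    using proper_less[OF proper that] transpose_less_iff[OF ab] unfolding kempe_swap_def by auto
next
  fix v e f assume ef: "e \<in> F" "f \<in> F" "v \<in> e" "v \<in> f" "kempe_swap c a b C e = kempe_swap c a b C f"
  have "c e = c f"
  proof (cases "v \<in> C")
    case True
    then show ?thesis using ef(3-5) kempe_swap_in by (metis transpose_involutory)
  next
    case False
    then show ?thesis using ef kempe_swap_out[OF closed] by metis
  qed
  then show "e = f" using proper_eqD[OF proper ef(1-4)] by simp
qed

lemma missing_kempe_swap_out:
  assumes "kempe_closed F c a b C" "v \<notin> C"
  shows "missing F (kempe_swap c a b C) k v = missing F c k v"
  by (rule missing_cong) (use kempe_swap_out[OF assms(1) _ assms(2)] in simp)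

lemma missing_kempe_swap_in:
  assumes "v \<in> C" "a < k" "b < k"
  shows "i \<in> missing F (kempe_swap c a b C) k v \<longleftrightarrow> transpose a b i \<in> missing F c k v"
  unfolding missing_def using kempe_swap_in[OF assms(1)] transpose_less_iff[OF assms(2,3)]
  by (auto simp: transpose_eq_iff)

lemma kempe_chain_self: "v \<in> kempe_chain F c a b v"
  unfolding kempe_chain_def by (rule component_self)

lemma kempe_chain_eq: "w \<in> kempe_chain F c a b v \<Longrightarrow> kempe_chain F c a b w = kempe_chain F c a b v"
  unfolding kempe_chain_def by (rule component_eq)

lemma kempe_closed_chain:
  assumes "fin_graph F"
  shows "kempe_closed F c a b (kempe_chain F c a b v)"
  unfolding kempe_closed_def
proof (intro ballI impI)
  fix e assume e: "e \<in> F" "c e \<in> {a, b}"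
  obtain p q where pq: "e = {p, q}" using fin_graph_edgeE[OF assms e(1)] .
  let ?H = "{e\<in>F. c e \<in> {a, b}}"
  have "adj ?H p q" "adj ?H q p" using e pq by (simp_all add: insert_commute)
  then have "p \<in> kempe_chain F c a b v \<longleftrightarrow> q \<in> kempe_chain F c a b v"
    unfolding kempe_chain_def using component_step[of p ?H v q] component_step[of q ?H v p] by blast
  then show "e \<subseteq> kempe_chain F c a b v \<or> e \<inter> kempe_chain F c a b v = {}" using pq by auto
qed

lemma degree_color_class_le:
  assumes "proper_edge_coloring F c k" "finite S"
  shows "degree {e\<in>F. c e \<in> S} v \<le> card (S - missing F c k v)"
  unfolding degree_def
proof (rule card_inj_on_le[where f = c])
  show "inj_on c {e \<in> {e\<in>F. c e \<in> S}. v \<in> e}"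
    by (rule inj_on_subset[OF proper_inj_on_incident[OF assms(1), of v]]) auto
  show "c ` {e \<in> {e\<in>F. c e \<in> S}. v \<in> e} \<subseteq> S - missing F c k v" by (auto dest: missingD)
qed (use assms(2) in simp)

text \<open>A Kempe chain is a path or a cycle, so it has at most two ends.\<close>

lemma kempe_chain_third_end:
  assumes graph: "fin_graph F" and proper: "proper_edge_coloring F c k"
    and ends: "distinct [x, y, z]" "\<And>t. t \<in> {x, y, z} \<Longrightarrow> a \<in> missing F c k t \<or> b \<in> missing F c k t"
    and chain: "x \<in> kempe_chain F c a b v" "y \<in> kempe_chain F c a b v"
  shows "z \<notin> kempe_chain F c a b v"
proof
  assume "z \<in> kempe_chain F c a b v"
  let ?H = "{e\<in>F. c e \<in> {a, b}}"
  have degree_le: "degree ?H w \<le> card ({a, b} - missing F c k w)" for w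
    by (rule degree_color_class_le[OF proper]) simp
  have "card {x, y, z} \<le> 2"
  proof (rule card_component_leaves_le[of ?H _ v])
    show "fin_graph ?H" by (rule fin_graph_subset[OF graph]) simp
    show "degree ?H w \<le> 2" for w
    proof -
      have "card ({a, b} - missing F c k w) \<le> card {a, b}" by (rule card_mono) auto
      also have "\<dots> \<le> 2" by (simp add: card_insert_if)
      finally show ?thesis using degree_le[of w] by simp
    qed
    show "{x, y, z} \<subseteq> component ?H v"
      using chain \<open>z \<in> kempe_chain F c a b v\<close> unfolding kempe_chain_def by simp
    show "degree ?H t \<le> 1" if "t \<in> {x, y, z}" for t
    proof -
      have "{a, b} - missing F c k t \<subseteq> {b} \<or> {a, b} - missing F c k t \<subseteq> {a}"
        using ends(2)[OF that] by auto
      then have "card ({a, b} - missing F c k t) \<le> 1"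
        using card_mono[of "{b}"] card_mono[of "{a}"] by fastforce
      then show ?thesis using degree_le[of t] by simp
    qed
  qed
  then show False using ends(1) by simp
qed

section \<open>Vizing fans\<close>

text \<open>A fan at \<open>y\<close> is a walk along \<open>fan_step F c k y\<close>.\<close>

definition fan_step :: "'a set set \<Rightarrow> ('a set \<Rightarrow> nat) \<Rightarrow> nat \<Rightarrow> 'a \<Rightarrow> 'a \<Rightarrow> 'a \<Rightarrow> bool" where
  "fan_step F c k y v w \<longleftrightarrow> {y, w} \<in> F \<and> c {y, w} \<in> missing F c k v"

lemma rtranclp_first:
  assumes "R\<^sup>*\<^sup>* x w" "P w"
  obtains v where "P v" "(\<lambda>p q. R p q \<and> \<not> P p)\<^sup>*\<^sup>* x v"
proof -
  let ?R' = "\<lambda>p q. R p q \<and> \<not> P p"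
  have "(\<exists>v. P v \<and> ?R'\<^sup>*\<^sup>* x v) \<or> ?R'\<^sup>*\<^sup>* x w"
    using assms(1)
  proof (induction rule: rtranclp_induct)
    case (step p q)
    then show ?case by (metis (mono_tags, lifting) rtranclp.rtrancl_into_rtrancl)
  qed simp
  then show ?thesis using that assms(2) by blast
qed

lemma rtrancl_path_mono_on:
  assumes "rtrancl_path R x xs y"
    and "\<And>p q. p \<in> set (x # xs) \<Longrightarrow> q \<in> set xs \<Longrightarrow> R p q \<Longrightarrow> R' p q"
  shows "rtrancl_path R' x xs y"
  using assms
proof (induction rule: rtrancl_path.induct)
  case (step x y ys z)
  then show ?case by (auto intro!: rtrancl_path.step)
qed (rule rtrancl_path.base)

lemma rtrancl_path_end: "rtrancl_path R x xs y \<Longrightarrow> y \<in> set (x # xs)"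
  by (induction rule: rtrancl_path.induct) auto

lemma fan_shift:
  assumes graph: "fin_graph E" and edge: "{x, y} \<in> E"
    and proper: "proper_edge_coloring (E - {{x, y}}) c k"
    and step: "fan_step (E - {{x, y}}) c k y x w"
  defines "c' \<equiv> c({x, y} := c {y, w})"
  shows "proper_edge_coloring (E - {{w, y}}) c' k" (is ?proper)
    and "missing (E - {{w, y}}) c' k v =
      (if v = x then missing (E - {{x, y}}) c k x - {c {y, w}}
       else if v = w then insert (c {y, w}) (missing (E - {{x, y}}) c k w)
       else missing (E - {{x, y}}) c k v)" (is ?missing)
proof -
  define F where "F = E - {{x, y}}"
  define a where "a = c {y, w}"
  have w: "{y, w} \<in> F" "a \<in> missing F c k x" using step unfolding fan_step_def F_def a_def by auto
  have neq: "x \<noteq> y" "w \<noteq> x" "w \<noteq> y"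
    using fin_graph_edge_neq[OF graph] edge w(1) unfolding F_def by (auto simp: insert_commute)
  then have shift: "E - {{w, y}} = insert {x, y} (F - {{y, w}})"
    using edge unfolding F_def by (auto simp: doubleton_eq_iff insert_commute)
  have removed: "missing (F - {{y, w}}) c k u =
    (if u \<in> {y, w} then insert a (missing F c k u) else missing F c k u)" for u
    using missing_remove_edge[OF _ w(1)] proper unfolding F_def a_def by simp
  have a_y: "a \<notin> missing F c k y" using w(1) unfolding a_def by (auto dest: missingD)
  show ?proper
    unfolding shift c'_def a_def[symmetric]
    by (rule proper_insert_edge) (use proper_subset[OF proper] removed w(2) neq in \<open>auto simp: F_def\<close>)
  have "F - {{y, w}} - {{x, y}} = F - {{y, w}}" unfolding F_def by blast
  then have "missing (E - {{w, y}}) c' k v =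
    missing (F - {{y, w}}) c k v - (if v \<in> {x, y} then {a} else {})"
    unfolding shift c'_def a_def[symmetric]
    using missing_insert_edge_in[of v "{x, y}" "F - {{y, w}}"]
      missing_insert_edge_out[of v "{x, y}" "F - {{y, w}}"]
    by simp
  then show ?missing unfolding a_def[symmetric] F_def[symmetric] using removed[of v] neq a_y by auto
qed

lemma colorable_if_common_missing:
  assumes "{x, y} \<in> E" "proper_edge_coloring (E - {{x, y}}) c k"
    and "a \<in> missing (E - {{x, y}}) c k x" "a \<in> missing (E - {{x, y}}) c k y"
  shows "colorable E k"
  using proper_insert_edge[OF assms(2), of "{x, y}" a] assms unfolding colorable_def
  by (auto simp: insert_absorb)

lemma distinct_fan_disjoint:
  assumes graph: "fin_graph E" and not_colorable: "\<not> colorable E k"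
    and "{x, y} \<in> E" "proper_edge_coloring (E - {{x, y}}) c k"
    and "rtrancl_path (fan_step (E - {{x, y}}) c k y) x xs w" "distinct (x # xs)"
  shows "missing (E - {{x, y}}) c k w \<inter> missing (E - {{x, y}}) c k y = {}"
  using assms(3-6)
proof (induction xs arbitrary: x c)
  case Nil
  then have "w = x" by (auto elim: rtrancl_path.cases)
  then show ?case using colorable_if_common_missing[OF Nil(1,2)] not_colorable by blast
next
  case (Cons z zs)
  let ?F = "E - {{x, y}}" and ?F' = "E - {{z, y}}"
  define c' where "c' = c({x, y} := c {y, z})"
  have first: "fan_step ?F c k y x z" and rest: "rtrancl_path (fan_step ?F c k y) z zs w"
    using Cons.prems(3) by (auto elim: rtrancl_path.cases)
  note shift = fan_shift[OF graph Cons.prems(1,2) first, folded c'_def]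
  have "x \<noteq> y" using fin_graph_edge_neq[OF graph Cons.prems(1)] .
  have missing_mono: "missing ?F c k u \<subseteq> missing ?F' c' k u" if "u \<noteq> x" for u
    using that shift(2)[of u] by auto
  have "rtrancl_path (fan_step ?F' c' k y) z zs w"
  proof (rule rtrancl_path_mono_on[OF rest])
    fix p q assume pq: "p \<in> set (z # zs)" "q \<in> set zs" "fan_step ?F c k y p q"
    then have "p \<noteq> x" "q \<noteq> x" "q \<noteq> z" using Cons.prems(4) by auto
    then show "fan_step ?F' c' k y p q"
      using pq(3) missing_mono[of p] \<open>x \<noteq> y\<close> unfolding fan_step_def c'_def
      by (auto simp: doubleton_eq_iff)
  qed
  moreover have "{z, y} \<in> E" using first unfolding fan_step_def by (simp add: insert_commute)
  ultimately have "missing ?F' c' k w \<inter> missing ?F' c' k y = {}"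
    using Cons.IH shift(1) Cons.prems(4) by simp
  moreover have "w \<noteq> x" using rtrancl_path_end[OF rest] Cons.prems(4) by auto
  ultimately show ?case using missing_mono[of w] missing_mono[of y] \<open>x \<noteq> y\<close> by blast
qed

locale class_two_graph =
  fixes E :: "'a set set" and k :: nat
  assumes graph: "fin_graph E"
    and degree_le: "degree E v \<le> k"
    and not_colorable: "\<not> colorable E k"

locale uncolored_edge = class_two_graph +
  fixes x y :: 'a
  assumes edge: "{x, y} \<in> E"
begin

definition F :: "'a set set" where
  "F = E - {{x, y}}"

definition fan :: "('a set \<Rightarrow> nat) \<Rightarrow> 'a set" where
  "fan c = {w. (fan_step F c k y)\<^sup>*\<^sup>* x w}"

lemma graph_F: "fin_graph F"
  unfolding F_def using graph fin_graph_subset by blast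

lemma x_neq_y: "x \<noteq> y"
  using fin_graph_edge_neq[OF graph edge] .

lemma card_missing_F:
  assumes "proper_edge_coloring F c k"
  shows "card (missing F c k v) + degree E v = k + of_bool (v \<in> {x, y})"
  using card_missing[OF graph_F assms, of v]
    degree_remove_edge[OF fin_graph_finite[OF graph] edge, of v]
  unfolding F_def by simp

lemma missing_y_nonempty:
  assumes "proper_edge_coloring F c k"
  shows "missing F c k y \<noteq> {}"
  using card_missing_F[OF assms, of y] degree_le[of y] by auto

lemma x_in_fan: "x \<in> fan c"
  unfolding fan_def by simp

lemma fan_closed: "v \<in> fan c \<Longrightarrow> fan_step F c k y v w \<Longrightarrow> w \<in> fan c"
  unfolding fan_def by (auto intro: rtranclp.rtrancl_into_rtrancl)

lemma fan_center_disjoint: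
  assumes "proper_edge_coloring F c k" "w \<in> fan c"
  shows "missing F c k w \<inter> missing F c k y = {}"
proof -
  obtain xs where "rtrancl_path (fan_step F c k y) x xs w"
    using assms(2) unfolding fan_def rtranclp_eq_rtrancl_path by blast
  then obtain xs' where "rtrancl_path (fan_step F c k y) x xs' w" "distinct (x # xs')"
    by (rule rtrancl_path_distinct)
  then show ?thesis using distinct_fan_disjoint[OF graph not_colorable edge] assms(1) unfolding F_def
    by blast
qed

lemma fan_avoiding_chain:
  assumes proper: "proper_edge_coloring F c k"
    and a: "a \<in> missing F c k w" and d: "d \<in> missing F c k y"
    and y: "y \<notin> kempe_chain F c a d w"
    and walk: "(\<lambda>u v. fan_step F c k y u v \<and> (u \<in> kempe_chain F c a d w \<longrightarrow> a \<notin> missing F c k u))\<^sup>*\<^sup>* x w"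
  shows False
proof -
  define C where "C = kempe_chain F c a d w"
  define c' where "c' = kempe_swap c a d C"
  have closed: "kempe_closed F c a d C" unfolding C_def by (rule kempe_closed_chain[OF graph_F])
  have less: "a < k" "d < k" using a d by (auto dest: missing_less)
  have proper': "proper_edge_coloring F c' k"
    unfolding c'_def by (rule proper_kempe_swap[OF proper closed less])
  have yC: "y \<notin> C" using y unfolding C_def .
  have fan_step_swap: "fan_step F c' k y u v"
    if u: "u \<in> fan c" "u \<in> C \<longrightarrow> a \<notin> missing F c k u" "fan_step F c k y u v" for u v
  proof -
    have v: "{y, v} \<in> F" "c {y, v} \<in> missing F c k u" using u(3) unfolding fan_step_def by auto
    have "d \<notin> missing F c k u" using fan_center_disjoint[OF proper u(1)] d by blast
    then have "c {y, v} \<in> missing F c' k u"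
      using u(2) v(2) missing_kempe_swap_in[OF _ less, of u C] missing_kempe_swap_out[OF closed, of u k]
      unfolding c'_def by (cases "u \<in> C") (auto simp: transpose_def)
    then show ?thesis using v(1) kempe_swap_out[OF closed v(1) yC] unfolding fan_step_def c'_def by simp
  qed
  have "w \<in> fan c \<and> w \<in> fan c'"
    using walk[folded C_def]
  proof (induction rule: rtranclp_induct)
    case (step u v)
    then show ?case using fan_closed fan_step_swap by blast
  qed (simp add: x_in_fan)
  moreover have "d \<in> missing F c' k w" "d \<in> missing F c' k y"
    unfolding c'_def
    using missing_kempe_swap_in[OF _ less, of w C d] missing_kempe_swap_out[OF closed yC] a d
    by (simp_all add: C_def kempe_chain_self)
  ultimately show False using fan_center_disjoint[OF proper'] by blast
qed

lemma fan_elementary: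
  assumes proper: "proper_edge_coloring F c k"
    and w: "w \<in> fan c" "w' \<in> fan c" "w \<noteq> w'"
  shows "missing F c k w \<inter> missing F c k w' = {}"
proof (rule ccontr)
  assume "\<not> ?thesis"
  then obtain a where a: "a \<in> missing F c k w" "a \<in> missing F c k w'" by blast
  obtain d where d: "d \<in> missing F c k y" using missing_y_nonempty[OF proper] by blast
  have walks: "(fan_step F c k y)\<^sup>*\<^sup>* x w" "(fan_step F c k y)\<^sup>*\<^sup>* x w'"
    using w(1,2) unfolding fan_def by auto
  obtain w1 where w1: "a \<in> missing F c k w1"
    "(\<lambda>u v. fan_step F c k y u v \<and> a \<notin> missing F c k u)\<^sup>*\<^sup>* x w1"
    using rtranclp_first[OF walks(1), of "\<lambda>u. a \<in> missing F c k u"] a(1) by blast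
  have y_chain: "y \<in> kempe_chain F c a d w1"
  proof (rule ccontr)
    assume "y \<notin> kempe_chain F c a d w1"
    moreover have "(\<lambda>u v. fan_step F c k y u v \<and>
        (u \<in> kempe_chain F c a d w1 \<longrightarrow> a \<notin> missing F c k u))\<^sup>*\<^sup>* x w1"
      by (rule mono_rtranclp[rule_format, OF _ w1(2)]) simp
    ultimately show False by (rule fan_avoiding_chain[OF proper w1(1) d])
  qed
  define P where "P u \<longleftrightarrow> a \<in> missing F c k u \<and> u \<noteq> w1" for u
  have "\<exists>u. (fan_step F c k y)\<^sup>*\<^sup>* x u \<and> P u"
    using walks a w(3) unfolding P_def by (cases "w = w1") auto
  then obtain w2 where w2: "P w2" "(\<lambda>u v. fan_step F c k y u v \<and> \<not> P u)\<^sup>*\<^sup>* x w2"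
    using rtranclp_first[of "fan_step F c k y" x _ P] by blast
  have "w1 \<in> fan c" "w2 \<in> fan c"
    unfolding fan_def mem_Collect_eq
    by (rule mono_rtranclp[rule_format, OF _ w1(2)], simp)
      (rule mono_rtranclp[rule_format, OF _ w2(2)], simp)
  then have "y \<noteq> w1" "y \<noteq> w2" using fan_center_disjoint[OF proper] w1(1) w2(1) unfolding P_def by blast+
  then have "w2 \<notin> kempe_chain F c a d w1"
    using w1(1) w2(1) d unfolding P_def
    by (intro kempe_chain_third_end[OF graph_F proper _ _ kempe_chain_self y_chain]) auto
  then have disjoint: "u \<notin> kempe_chain F c a d w2" if "u \<in> kempe_chain F c a d w1" for u
    using that kempe_chain_eq kempe_chain_self by metis
  have "a \<notin> missing F c k u" if "\<not> P u" "u \<in> kempe_chain F c a d w2" for u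
    using that disjoint[OF kempe_chain_self] unfolding P_def by blast
  then have "(\<lambda>u v. fan_step F c k y u v \<and> (u \<in> kempe_chain F c a d w2 \<longrightarrow> a \<notin> missing F c k u))\<^sup>*\<^sup>* x w2"
    by (intro mono_rtranclp[rule_format, OF _ w2(2)]) blast
  then show False using fan_avoiding_chain[OF proper _ d] disjoint y_chain w2(1) unfolding P_def
    by blast
qed

lemma fan_minus_x_eq:
  "fan c - {x} = {v \<in> nbrs F y. c {y, v} \<in> (\<Union>w\<in>fan c. missing F c k w)}"
proof (intro equalityI subsetI)
  fix v assume "v \<in> fan c - {x}"
  then obtain w where "w \<in> fan c" "fan_step F c k y w v"
    unfolding fan_def by (auto elim: rtranclp.cases)
  then show "v \<in> {v \<in> nbrs F y. c {y, v} \<in> (\<Union>w\<in>fan c. missing F c k w)}"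
    unfolding fan_step_def nbrs_iff by blast
next
  fix v assume v: "v \<in> {v \<in> nbrs F y. c {y, v} \<in> (\<Union>w\<in>fan c. missing F c k w)}"
  then have "v \<in> fan c" using fan_closed unfolding fan_step_def nbrs_iff by blast
  moreover have "v \<noteq> x" using v unfolding nbrs_iff F_def by (auto simp: insert_commute)
  ultimately show "v \<in> fan c - {x}" by simp
qed

lemma card_fan:
  assumes proper: "proper_edge_coloring F c k"
  shows "finite (fan c)"
    and "card (fan c) = Suc (\<Sum>w\<in>fan c. card (missing F c k w))"
proof -
  let ?colors = "\<Union>w\<in>fan c. missing F c k w"
  have "finite (fan c - {x})" unfolding fan_minus_x_eq using finite_nbrs[OF graph_F] by simp
  then show fin: "finite (fan c)" by simp
  have "?colors \<subseteq> {..<k}" "?colors \<inter> missing F c k y = {}"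
    using missing_subset fan_center_disjoint[OF proper] by fast+
  then have "card (fan c - {x}) = card ?colors"
    unfolding fan_minus_x_eq by (rule bij_betw_same_card[OF bij_betw_color_nbrs[OF graph_F proper]])
  also have "\<dots> = (\<Sum>w\<in>fan c. card (missing F c k w))"
    by (rule card_UN_disjoint[OF fin]) (use fan_elementary[OF proper] in auto)
  finally show "card (fan c) = Suc (\<Sum>w\<in>fan c. card (missing F c k w))"
    using card.remove[OF fin x_in_fan] by simp
qed

theorem vizing_fan_inequality:
  assumes proper: "proper_edge_coloring F c k"
  shows "k + 1 \<le> degree E x + card {v \<in> nbrs E y. v \<noteq> x \<and> degree E v = k}"
proof -
  define full where "full = {w \<in> fan c - {x}. degree E w = k}"
  note fin = card_fan(1)[OF proper]
  have nbr: "w \<in> nbrs E y" if "w \<in> fan c - {x}" for w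
    using that nbrs_mono[of F E y] unfolding fan_minus_x_eq F_def by auto
  have "1 \<le> card (missing F c k w) + of_bool (w \<in> full)" if w: "w \<in> fan c - {x}" for w
    using card_missing_F[OF proper, of w] degree_le[of w] nbr[OF w] nbrs_irrefl[OF graph, of y] w
    unfolding full_def by (cases "degree E w = k") auto
  then have "(\<Sum>w\<in>fan c - {x}. 1) \<le> (\<Sum>w\<in>fan c - {x}. card (missing F c k w) + of_bool (w \<in> full))"
    by (rule sum_mono)
  then have "card (fan c - {x}) \<le> (\<Sum>w\<in>fan c - {x}. card (missing F c k w)) + card full"
    using fin unfolding full_def by (simp add: sum.distrib Int_def conj_commute)
  moreover have "card (fan c - {x}) = card (missing F c k x) + (\<Sum>w\<in>fan c - {x}. card (missing F c k w))"
    using card_fan(2)[OF proper] card.remove[OF fin x_in_fan]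
      sum.remove[OF fin x_in_fan, of "\<lambda>w. card (missing F c k w)"]
    by simp
  ultimately have "card (missing F c k x) \<le> card full" by simp
  also have "\<dots> \<le> card {v \<in> nbrs E y. v \<noteq> x \<and> degree E v = k}"
    by (rule card_mono) (use finite_nbrs[OF graph] nbr in \<open>auto simp: full_def\<close>)
  finally show ?thesis using card_missing_F[OF proper, of x] by simp
qed

end

theorem vizing:
  assumes "fin_graph E" "\<And>v. degree E v < k"
  shows "colorable E k"
  using fin_graph_finite[OF assms(1)] assms
proof (induction E rule: finite_induct)
  case empty
  then show ?case unfolding colorable_def proper_edge_coloring_def by simp
next
  case (insert e E)
  have "degree E v < k" for v
    using insert.prems(2)[of v] degree_insert_edge[OF insert.hyps, of v] by simp
  then obtain c where c: "proper_edge_coloring E c k"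
    using insert.IH fin_graph_subset[OF insert.prems(1)] unfolding colorable_def by blast
  obtain x y where e: "e = {x, y}" using fin_graph_edgeE[OF insert.prems(1)] by blast
  show ?case
  proof (rule ccontr)
    assume "\<not> colorable (insert e E) k"
    then interpret uncolored_edge "insert e E" k x y
      by unfold_locales (use insert.prems e in \<open>simp_all add: less_imp_le\<close>)
    have "F = E" unfolding F_def using insert.hyps(2) e by simp
    then have "k + 1 \<le> degree (insert e E) x
      + card {v \<in> nbrs (insert e E) y. v \<noteq> x \<and> degree (insert e E) v = k}"
      using vizing_fan_inequality c by simp
    moreover have "{v \<in> nbrs (insert e E) y. v \<noteq> x \<and> degree (insert e E) v = k} = {}"
      using insert.prems(2) by (metis (mono_tags, lifting) Collect_empty_eq less_irrefl)
    ultimately show False using insert.prems(2)[of x] by simp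
  qed
qed

section \<open>Woodall's recolouring lemma for low vertices\<close>

locale critical_graph = class_two_graph +
  assumes critical: "e \<in> E \<Longrightarrow> colorable (E - {e}) k"
begin

definition low :: "'a \<Rightarrow> bool" where
  "low v \<longleftrightarrow> 2 * degree E v < k"

definition low_nbrs :: "'a \<Rightarrow> 'a set" where
  "low_nbrs v = {w \<in> nbrs E v. low w}"

lemma finite_low_nbrs: "finite (low_nbrs v)"
  unfolding low_nbrs_def using finite_nbrs[OF graph] by simp

theorem vizing_adjacency:
  assumes "{x, y} \<in> E"
  shows "k + 1 \<le> degree E x + card {v \<in> nbrs E y. v \<noteq> x \<and> degree E v = k}"
proof -
  interpret uncolored_edge E k x y by unfold_locales (rule assms)
  obtain c where "proper_edge_coloring F c k"
    using critical[OF assms] unfolding colorable_def F_def by blast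
  then show ?thesis by (rule vizing_fan_inequality)
qed

lemma adjacent_degree_sum:
  assumes "{x, y} \<in> E"
  shows "k + 2 \<le> degree E x + degree E y"
proof -
  have "x \<in> nbrs E y" using assms by (simp add: nbrs_iff insert_commute)
  then have "{v \<in> nbrs E y. v \<noteq> x \<and> degree E v = k} \<subset> nbrs E y" by blast
  then have "card {v \<in> nbrs E y. v \<noteq> x \<and> degree E v = k} < degree E y"
    unfolding degree_eq_card_nbrs[OF graph] by (rule psubset_card_mono[OF finite_nbrs[OF graph]])
  then show ?thesis using vizing_adjacency[OF assms] by simp
qed

lemma low_independent: "{x, y} \<in> E \<Longrightarrow> low x \<Longrightarrow> \<not> low y"
  using adjacent_degree_sum[of x y] unfolding low_def by auto

end

locale uncolored_low_edge = critical_graph + uncolored_edge +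
  assumes low_x: "low x"
begin

lemma y_not_low: "\<not> low y"
  using low_independent[OF edge low_x] .

lemma edge_in_F: "{v, w} \<in> E \<Longrightarrow> v \<noteq> x \<Longrightarrow> w \<noteq> x \<Longrightarrow> {v, w} \<in> F"
  unfolding F_def by auto

lemma missing_xy_disjoint:
  "proper_edge_coloring F c k \<Longrightarrow> missing F c k x \<inter> missing F c k y = {}"
  by (rule fan_center_disjoint[OF _ x_in_fan])

lemma kempe_chain_links:
  assumes "proper_edge_coloring F c k" "a \<in> missing F c k x" "b \<in> missing F c k y"
  shows "y \<in> kempe_chain F c a b x"
  using fan_avoiding_chain[OF assms] by blast

lemma low_vertex_common_missing:
  assumes proper: "proper_edge_coloring F c k" and u: "low u" "u \<noteq> x"
  obtains a where "a \<in> missing F c k x" "a \<in> missing F c k u" "a \<noteq> b"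
proof -
  let ?X = "missing F c k x" and ?U = "missing F c k u"
  have "card ?X + degree E x = k + 1" "card ?U + degree E u = k"
    using card_missing_F[OF proper] u y_not_low by auto
  then have "card ?X + card ?U > k + 1" using u(1) low_x unfolding low_def by linarith
  moreover have "card (?X \<union> ?U) \<le> card {..<k}" by (rule card_mono) (auto dest: missing_less)
  ultimately have "card (?X \<inter> ?U) > 1" using card_Un_Int[of ?X ?U] by simp
  then have "\<not> (?X \<inter> ?U \<subseteq> {b})" using card_mono[of "{b}" "?X \<inter> ?U"] by auto
  then show ?thesis using that by blast
qed

definition same_at_ends :: "('a set \<Rightarrow> nat) \<Rightarrow> ('a set \<Rightarrow> nat) \<Rightarrow> bool" where
  "same_at_ends c c' \<longleftrightarrow> (\<forall>e\<in>F. x \<in> e \<or> y \<in> e \<longrightarrow> c' e = c e)"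

lemma same_at_ends_refl: "same_at_ends c c"
  unfolding same_at_ends_def by simp

lemma same_at_endsD: "same_at_ends c c' \<Longrightarrow> e \<in> F \<Longrightarrow> x \<in> e \<or> y \<in> e \<Longrightarrow> c' e = c e"
  unfolding same_at_ends_def by blast

lemma same_at_ends_missing:
  assumes "same_at_ends c c'"
  shows "missing F c' k x = missing F c k x" "missing F c' k y = missing F c k y"
  using assms unfolding same_at_ends_def by (auto intro!: missing_cong)

text \<open>The chain through \<open>x\<close> already ends at \<open>x\<close> and \<open>y\<close>, so a chain ending at \<open>v\<close> avoids both.\<close>

lemma kempe_swap_away:
  assumes proper: "proper_edge_coloring F c k"
    and a: "a \<in> missing F c k x" and b: "b \<in> missing F c k y"
    and v: "v \<noteq> x" "v \<noteq> y" "a \<in> missing F c k v \<or> b \<in> missing F c k v"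
  obtains c' where "proper_edge_coloring F c' k" "same_at_ends c c'"
    "\<And>e. c' e \<in> {c e, transpose a b (c e)}"
    "\<And>e. v \<in> e \<Longrightarrow> c' e = transpose a b (c e)"
    "\<And>i. i \<in> missing F c' k v \<longleftrightarrow> transpose a b i \<in> missing F c k v"
proof -
  define C where "C = kempe_chain F c a b v"
  have less: "a < k" "b < k" using a b by (auto dest: missing_less)
  have link: "y \<in> kempe_chain F c a b x" using kempe_chain_links[OF proper a b] .
  have "v \<notin> kempe_chain F c a b x"
    using x_neq_y v a b
    by (intro kempe_chain_third_end[OF graph_F proper _ _ kempe_chain_self link]) auto
  then have "w \<notin> C" if "w \<in> kempe_chain F c a b x" for w
    using that kempe_chain_eq kempe_chain_self unfolding C_def by metis
  then have xy: "x \<notin> C" "y \<notin> C" using link kempe_chain_self by metis+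
  have closed: "kempe_closed F c a b C" and vC: "v \<in> C"
    unfolding C_def by (rule kempe_closed_chain[OF graph_F], rule kempe_chain_self)
  show ?thesis
  proof (rule that[of "kempe_swap c a b C"])
    show "proper_edge_coloring F (kempe_swap c a b C) k"
      using proper_kempe_swap[OF proper closed less] .
    show "same_at_ends c (kempe_swap c a b C)"
      unfolding same_at_ends_def using kempe_swap_out[OF closed] xy by blast
    show "kempe_swap c a b C e \<in> {c e, transpose a b (c e)}" for e unfolding kempe_swap_def by simp
    show "kempe_swap c a b C e = transpose a b (c e)" if "v \<in> e" for e using kempe_swap_in[OF vC that] .
    show "i \<in> missing F (kempe_swap c a b C) k v \<longleftrightarrow> transpose a b i \<in> missing F c k v" for i
      using missing_kempe_swap_in[OF vC less] .
  qed
qed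

lemma recolor_to_miss:
  assumes proper: "proper_edge_coloring F c k" and u: "low u" "u \<noteq> x" and b: "b \<in> missing F c k y"
  obtains c' a where "proper_edge_coloring F c' k" "same_at_ends c c'" "b \<in> missing F c' k u"
    "a \<in> missing F c k x" "a \<noteq> d" "\<And>e. c' e \<in> {c e, transpose a b (c e)}"
proof -
  have uy: "u \<noteq> y" using u(1) y_not_low by blast
  obtain a where a: "a \<in> missing F c k x" "a \<in> missing F c k u" "a \<noteq> d"
    using low_vertex_common_missing[OF proper u] .
  show ?thesis
  proof (cases "b \<in> missing F c k u")
    case True
    then show ?thesis using that[of c a] proper same_at_ends_refl a by simp
  next
    case False
    then show ?thesis
      using kempe_swap_away[OF proper a(1) b u(2) uy] a that by (metis transpose_apply_second)
  qed
qed

lemma recolor_low_neighbour: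
  assumes proper: "proper_edge_coloring F c k"
    and u: "{y, u} \<in> F" "low u" and b: "b \<in> missing F c k y"
  obtains c' a where "proper_edge_coloring F c' k" "c' {y, u} = b"
    "missing F c' k x = missing F c k x" "missing F c' k y = insert (c {y, u}) (missing F c k y) - {b}"
    "\<And>e. e \<in> F \<Longrightarrow> x \<in> e \<or> y \<in> e \<Longrightarrow> e \<noteq> {y, u} \<Longrightarrow> c' e = c e"
    "a \<in> missing F c k x" "a \<noteq> d" "\<And>e. e \<noteq> {y, u} \<Longrightarrow> c' e \<in> {c e, transpose a b (c e)}"
proof -
  have ux: "u \<noteq> x" using u unfolding F_def by (auto simp: insert_commute)
  obtain c1 a where c1: "proper_edge_coloring F c1 k" "same_at_ends c c1" "b \<in> missing F c1 k u"
    and a: "a \<in> missing F c k x" "a \<noteq> d" "\<And>e. c1 e \<in> {c e, transpose a b (c e)}"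
    by (rule recolor_to_miss[OF proper u(2) ux b]) (rule that; assumption)
  define c2 where "c2 = c1({y, u} := b)"
  have "b \<in> missing F c1 k w" if "w \<in> {y, u}" for w
    using that c1(3) b same_at_ends_missing[OF c1(2)] by auto
  then have "proper_edge_coloring F c2 k"
    unfolding c2_def by (intro proper_recolor_edge[OF c1(1) u(1)]) auto
  moreover have "missing F c2 k x = missing F c k x"
    unfolding c2_def using missing_recolor_edge_out[of x "{y, u}"] ux x_neq_y
      same_at_ends_missing[OF c1(2)] by auto
  moreover have "missing F c2 k y = insert (c {y, u}) (missing F c k y) - {b}"
    unfolding c2_def using missing_recolor_edge_in[OF c1(1) u(1), of y b] same_at_ends_missing[OF c1(2)]
      same_at_endsD[OF c1(2) u(1)] by simp
  ultimately show ?thesis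
    using that[of c2 a] a same_at_endsD[OF c1(2)] unfolding c2_def by simp
qed

lemma recolor_to_missing_x:
  assumes proper: "proper_edge_coloring F c k"
    and v: "low v" "v \<noteq> x" and color: "c {z, v} \<in> missing F c k y"
  obtains c' where "proper_edge_coloring F c' k" "same_at_ends c c'" "c' {z, v} \<in> missing F c k x"
proof -
  have vy: "v \<noteq> y" using v(1) y_not_low by blast
  obtain a where a: "a \<in> missing F c k x" "a \<in> missing F c k v"
    using low_vertex_common_missing[OF proper v] .
  obtain c' where c': "proper_edge_coloring F c' k" "same_at_ends c c'"
      "\<And>e. v \<in> e \<Longrightarrow> c' e = transpose a (c {z, v}) (c e)"
    using kempe_swap_away[OF proper a(1) color v(2) vy] a(2) by metis
  have "c' {z, v} = a" using c'(3)[of "{z, v}"] by simp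
  then show ?thesis using that c'(1,2) a(1) by simp
qed

lemma low_color_not_missing_x:
  assumes proper: "proper_edge_coloring F c k"
    and z: "{x, z} \<in> F" "c {x, z} \<in> missing F c k y"
    and v: "{z, v} \<in> E" "low v" "v \<noteq> x"
  shows "c {z, v} \<notin> missing F c k x"
proof
  assume missing_x: "c {z, v} \<in> missing F c k x"
  have commute: "{y, x} = {x, y}" "{z, x} = {x, z}" by (simp_all add: insert_commute)
  have zE: "{x, z} \<in> E" "z \<noteq> y" using z(1) unfolding F_def by auto
  have zx: "z \<noteq> x" using fin_graph_edge_neq[OF graph zE(1)] by simp
  define c' where "c' = c({y, x} := c {x, z})"
  interpret z: uncolored_low_edge E k x z
    by unfold_locales (use zE low_x in simp_all)
  have "fan_step (E - {{y, x}}) c k x y z" using z unfolding fan_step_def F_def commute by simp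
  then have proper': "proper_edge_coloring z.F c' k" and same: "missing z.F c' k x = missing F c k x"
    using fan_shift[OF graph, of y x c k z] edge proper x_neq_y zx
    unfolding c'_def z.F_def F_def commute by auto
  have "{z, v} \<in> z.F" "c' {z, v} = c {z, v}"
    using v(1,3) zE(2) zx unfolding z.F_def c'_def by (auto simp: doubleton_eq_iff)
  then have "v \<in> z.fan c'"
    using z.fan_closed[OF z.x_in_fan] missing_x same unfolding fan_step_def by simp
  then show False
    using z.fan_elementary[OF proper' z.x_in_fan] z.low_vertex_common_missing[OF proper' v(2,3)] v(3)
    by blast
qed

lemma low_color_not_missing_y:
  assumes proper: "proper_edge_coloring F c k"
    and z: "{x, z} \<in> F" "c {x, z} \<in> missing F c k y"
    and v: "{z, v} \<in> E" "low v" "v \<noteq> x"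
  shows "c {z, v} \<notin> missing F c k y"
proof
  assume "c {z, v} \<in> missing F c k y"
  then obtain c' where c': "proper_edge_coloring F c' k" "same_at_ends c c'"
    "c' {z, v} \<in> missing F c k x"
    by (rule recolor_to_missing_x[OF proper v(2,3)])
  then have "c' {x, z} \<in> missing F c' k y" "c' {z, v} \<in> missing F c' k x"
    using same_at_endsD[OF c'(2) z(1)] same_at_ends_missing[OF c'(2)] z(2) by simp_all
  then show False using low_color_not_missing_x[OF c'(1) z(1) _ v] by blast
qed

text \<open>
Recolouring \<open>yu\<close> with the colour of \<open>xz\<close> frees the common colour at \<open>y\<close>. A Kempe change at \<open>v\<close> then
gives \<open>zv\<close> a colour missing at \<open>x\<close>, and \<open>yu\<close> can take its old colour back.
\<close>

lemma low_colors_distinct: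
  assumes proper: "proper_edge_coloring F c k"
    and z: "{x, z} \<in> F" "c {x, z} \<in> missing F c k y"
    and v: "{z, v} \<in> E" "low v" "v \<noteq> x"
    and u: "{y, u} \<in> F" "low u"
  shows "c {y, u} \<noteq> c {z, v}"
proof
  define a0 where "a0 = c {x, z}"
  define a1 where "a1 = c {z, v}"
  assume "c {y, u} = c {z, v}"
  then have cyu: "c {y, u} = a1" unfolding a1_def .
  have zE: "{x, z} \<in> E" "z \<noteq> y" using z(1) unfolding F_def by auto
  have "u \<noteq> x" "u \<noteq> z"
    using u low_independent[OF zE(1) low_x] unfolding F_def by (auto simp: insert_commute)
  then have other: "{x, z} \<noteq> {y, u}" "{z, v} \<noteq> {y, u}" using zE(2) by (metis doubleton_eq_iff)+
  have a0_y: "a0 \<in> missing F c k y" using z(2) unfolding a0_def .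
  have a1_y: "a1 \<notin> missing F c k y" using missingD[OF _ u(1)] cyu by blast
  have a1_x: "a1 \<notin> missing F c k x" using low_color_not_missing_x[OF proper z v] unfolding a1_def .
  obtain c1 b1 where c1: "proper_edge_coloring F c1 k" "c1 {y, u} = a0"
    "missing F c1 k x = missing F c k x" "missing F c1 k y = insert (c {y, u}) (missing F c k y) - {a0}"
    "\<And>e. e \<in> F \<Longrightarrow> x \<in> e \<or> y \<in> e \<Longrightarrow> e \<noteq> {y, u} \<Longrightarrow> c1 e = c e"
    "b1 \<in> missing F c k x" "b1 \<noteq> a1" "\<And>e. e \<noteq> {y, u} \<Longrightarrow> c1 e \<in> {c e, transpose b1 a0 (c e)}"
    by (rule recolor_low_neighbour[OF proper u a0_y, where d = a1]) (rule that; assumption)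
  have "a1 \<noteq> a0" using a0_y a1_y by blast
  then have c1zv: "c1 {z, v} = a1" using c1(7) c1(8)[OF other(2)] by (auto simp: a1_def)
  have a1_y1: "a1 \<in> missing F c1 k y" unfolding c1(4) using cyu \<open>a1 \<noteq> a0\<close> by simp
  have "c1 {z, v} \<in> missing F c1 k y" using c1zv a1_y1 by simp
  then obtain c2 where c2: "proper_edge_coloring F c2 k" "same_at_ends c1 c2"
    "c2 {z, v} \<in> missing F c1 k x"
    by (rule recolor_to_missing_x[OF c1(1) v(2,3)])
  have a1_y2: "a1 \<in> missing F c2 k y" using a1_y1 same_at_ends_missing[OF c2(2)] by simp
  obtain c3 b3 where c3: "proper_edge_coloring F c3 k"
    "missing F c3 k x = missing F c2 k x"
    "missing F c3 k y = insert (c2 {y, u}) (missing F c2 k y) - {a1}"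
    "\<And>e. e \<in> F \<Longrightarrow> x \<in> e \<or> y \<in> e \<Longrightarrow> e \<noteq> {y, u} \<Longrightarrow> c3 e = c2 e"
    "b3 \<noteq> c2 {z, v}" "\<And>e. e \<noteq> {y, u} \<Longrightarrow> c3 e \<in> {c2 e, transpose b3 a1 (c2 e)}"
    by (rule recolor_low_neighbour[OF c2(1) u a1_y2, where d = "c2 {z, v}"]) (rule that; assumption)
  have "c2 {z, v} \<noteq> a1" using c2(3) c1(3) a1_x by metis
  then have c3zv: "c3 {z, v} = c2 {z, v}" using c3(5) c3(6)[OF other(2)] by auto
  have "c3 {x, z} = a0"
    using c3(4)[OF z(1)] same_at_endsD[OF c2(2) z(1)] c1(5)[OF z(1)] other(1) unfolding a0_def by simp
  moreover have "c2 {y, u} = a0" using same_at_endsD[OF c2(2) u(1)] c1(2) by simp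
  ultimately have "c3 {x, z} \<in> missing F c3 k y" using c3(3) \<open>a1 \<noteq> a0\<close> by simp
  then have "c3 {z, v} \<notin> missing F c3 k x" by (rule low_color_not_missing_x[OF c3(1) z(1) _ v])
  then show False using c3zv c3(2) same_at_ends_missing[OF c2(2)] c2(3) by simp
qed

definition low_colors :: "('a set \<Rightarrow> nat) \<Rightarrow> 'a \<Rightarrow> nat set" where
  "low_colors c w = (\<lambda>v. c {w, v}) ` (low_nbrs w - {x})"

definition palette :: "('a set \<Rightarrow> nat) \<Rightarrow> nat set" where
  "palette c = missing F c k y \<union> low_colors c y"

lemma low_colors_y_eq: "low_colors c y = {c {y, u} | u. {y, u} \<in> F \<and> low u}"
proof -
  have "u \<in> low_nbrs y - {x} \<longleftrightarrow> {y, u} \<in> F \<and> low u" for u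
    using x_neq_y unfolding low_nbrs_def nbrs_iff F_def by (auto simp: doubleton_eq_iff insert_commute)
  then show ?thesis unfolding low_colors_def by blast
qed

lemma woodall_missing:
  assumes proper: "proper_edge_coloring F c k"
    and z: "{x, z} \<in> F" "c {x, z} \<in> missing F c k y"
    and v: "v \<in> low_nbrs z - {x}"
  shows "c {z, v} \<notin> missing F c k x \<union> palette c"
  using v low_color_not_missing_x[OF proper z] low_color_not_missing_y[OF proper z]
    low_colors_distinct[OF proper z]
  unfolding palette_def low_colors_y_eq low_nbrs_def nbrs_iff by fastforce

lemma palette_subset_recolor:
  assumes u: "{y, u} \<in> F" "low u" and b: "c' {y, u} = b" "c {y, u} \<noteq> b"
    and missing_y: "missing F c' k y = insert (c {y, u}) (missing F c k y) - {b}"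
    and same: "\<And>e. e \<in> F \<Longrightarrow> y \<in> e \<Longrightarrow> e \<noteq> {y, u} \<Longrightarrow> c' e = c e"
  shows "palette c \<subseteq> palette c'"
proof
  fix i assume "i \<in> palette c"
  then consider "i = b" | "i \<in> missing F c k y" "i \<noteq> b"
    | w where "{y, w} \<in> F" "low w" "c {y, w} = i" "w \<noteq> u" | "i = c {y, u}"
    unfolding palette_def low_colors_y_eq by blast
  then show "i \<in> palette c'"
  proof cases
    case 1
    then show ?thesis unfolding palette_def low_colors_y_eq using u b(1) by blast
  next
    case (3 w)
    then have "c' {y, w} = i" using same[of "{y, w}"] by (auto simp: doubleton_eq_iff)
    then show ?thesis using 3 unfolding palette_def low_colors_y_eq by blast
  qed (use b(2) missing_y in \<open>auto simp: palette_def\<close>)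
qed

lemma woodall:
  assumes proper: "proper_edge_coloring F c k"
    and z: "{x, z} \<in> F" "c {x, z} \<in> palette c"
    and v: "v \<in> low_nbrs z - {x}"
  shows "c {z, v} \<notin> missing F c k x \<union> palette c"
proof (cases "c {x, z} \<in> missing F c k y")
  case True
  then show ?thesis using woodall_missing[OF proper z(1) _ v] by blast
next
  case False
  then have "c {x, z} \<in> low_colors c y" using z(2) unfolding palette_def by blast
  then obtain u where u: "{y, u} \<in> F" "low u" "c {y, u} = c {x, z}" by (auto simp: low_colors_y_eq)
  have zE: "{x, z} \<in> E" "z \<noteq> y" using z(1) unfolding F_def by auto
  have "{y, u} \<noteq> {x, y}" using u(1) unfolding F_def by simp
  then have "u \<noteq> x" by blast
  moreover have "u \<noteq> z" "v \<noteq> y"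
    using u(2) v low_independent[OF zE(1) low_x] y_not_low unfolding low_nbrs_def by auto
  ultimately have other: "{x, z} \<noteq> {y, u}" "{z, v} \<noteq> {y, u}" using zE(2) by (metis doubleton_eq_iff)+
  obtain b where b: "b \<in> missing F c k y" using missing_y_nonempty[OF proper] by blast
  obtain c' a where c': "proper_edge_coloring F c' k" "c' {y, u} = b"
    "missing F c' k x = missing F c k x" "missing F c' k y = insert (c {y, u}) (missing F c k y) - {b}"
    "\<And>e. e \<in> F \<Longrightarrow> x \<in> e \<or> y \<in> e \<Longrightarrow> e \<noteq> {y, u} \<Longrightarrow> c' e = c e"
    "a \<in> missing F c k x" "\<And>e. e \<noteq> {y, u} \<Longrightarrow> c' e \<in> {c e, transpose a b (c e)}"
    by (rule recolor_low_neighbour[OF proper u(1,2) b]) (rule that; assumption)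
  have "c {x, z} \<noteq> b" using missingD[OF b u(1)] u(3) by simp
  then have z': "c' {x, z} \<in> missing F c' k y" using c'(4) c'(5)[OF z(1)] other(1) u(3) by simp
  have b': "b \<in> palette c'" unfolding palette_def low_colors_y_eq using u(1,2) c'(2) by blast
  have "palette c \<subseteq> palette c'"
    using palette_subset_recolor[OF u(1,2) c'(2) _ c'(4)] c'(5) u(3) \<open>c {x, z} \<noteq> b\<close> by simp
  then have blocked: "missing F c k x \<union> palette c \<subseteq> missing F c' k x \<union> palette c'" using c'(3) by blast
  show ?thesis
  proof
    assume "c {z, v} \<in> missing F c k x \<union> palette c"
    then have "{c {z, v}, a, b} \<subseteq> missing F c' k x \<union> palette c'" using blocked c'(6) b' by blast
    moreover have "c' {z, v} \<in> {c {z, v}, a, b}"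
      using c'(7)[OF other(2)] by (auto simp: transpose_def split: if_splits)
    ultimately show False using woodall_missing[OF c'(1) z(1) z' v] by blast
  qed
qed

lemma low_colors_missing_x_disjoint:
  assumes proper: "proper_edge_coloring F c k"
  shows "low_colors c y \<inter> missing F c k x = {}"
proof (rule ccontr)
  assume "\<not> ?thesis"
  then obtain u where u: "{y, u} \<in> F" "low u" "c {y, u} \<in> missing F c k x"
    unfolding low_colors_y_eq by blast
  have ux: "u \<noteq> x" using u(1) unfolding F_def by (auto simp: insert_commute)
  have "u \<in> fan c" using fan_closed[OF x_in_fan] u unfolding fan_step_def by blast
  then show False
    using fan_elementary[OF proper x_in_fan] low_vertex_common_missing[OF proper u(2) ux] ux by blast
qed

lemma card_low_colors:
  assumes proper: "proper_edge_coloring F c k" and w: "{x, w} \<in> E"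
  shows "card (low_colors c w) + 1 = card (low_nbrs w)"
proof -
  have wx: "w \<noteq> x" using fin_graph_edge_neq[OF graph w] by simp
  have "{w, v} = {w, v'}" if "v \<in> low_nbrs w - {x}" "v' \<in> low_nbrs w - {x}" "c {w, v} = c {w, v'}"
    for v v'
    using proper_eqD[OF proper, of "{w, v}" "{w, v'}" w] edge_in_F[of w] wx that
    unfolding low_nbrs_def nbrs_iff by simp
  then have "inj_on (\<lambda>v. c {w, v}) (low_nbrs w - {x})"
    using inj_incident_edge[of w] by (auto simp: inj_on_def)
  then have "card (low_colors c w) = card (low_nbrs w - {x})"
    unfolding low_colors_def by (rule card_image)
  moreover have "x \<in> low_nbrs w"
    unfolding low_nbrs_def nbrs_iff using low_x w by (simp add: insert_commute)
  then have "card (low_nbrs w) = Suc (card (low_nbrs w - {x}))"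
    by (rule card.remove[OF finite_low_nbrs])
  ultimately show ?thesis by linarith
qed

lemma low_colors_less:
  assumes "proper_edge_coloring F c k" "w \<noteq> x"
  shows "low_colors c w \<subseteq> {..<k}"
proof -
  have "c {w, v} < k" if "v \<in> low_nbrs w - {x}" for v
    using proper_less[OF assms(1) edge_in_F] assms(2) that unfolding low_nbrs_def nbrs_iff by simp
  then show ?thesis unfolding low_colors_def by blast
qed

lemma palette_less:
  assumes proper: "proper_edge_coloring F c k"
  shows "palette c \<subseteq> {..<k}"
  unfolding palette_def using missing_subset[of F c k y] low_colors_less[OF proper, of y] x_neq_y
  by blast

lemma palette_missing_x_disjoint:
  assumes proper: "proper_edge_coloring F c k"
  shows "palette c \<inter> missing F c k x = {}"
  unfolding palette_def using low_colors_missing_x_disjoint[OF proper] missing_xy_disjoint[OF proper]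
  by blast

lemma card_palette_ge:
  assumes proper: "proper_edge_coloring F c k"
  shows "card (low_nbrs y) \<le> card (palette c)"
proof -
  have "missing F c k y \<inter> low_colors c y = {}" unfolding low_colors_y_eq by (auto dest: missingD)
  moreover have "finite (low_colors c y)" unfolding low_colors_def using finite_low_nbrs by simp
  moreover have "card (missing F c k y) \<ge> 1"
    using missing_y_nonempty[OF proper] by (simp add: Suc_le_eq card_gt_0_iff)
  ultimately show ?thesis
    unfolding palette_def using card_low_colors[OF proper edge] by (simp add: card_Un_disjoint)
qed

lemma card_low_nbrs_le:
  assumes proper: "proper_edge_coloring F c k" and z: "{x, z} \<in> F" "c {x, z} \<in> palette c"
  shows "card (low_nbrs z) + card (palette c) \<le> degree E x"
proof -
  let ?blocked = "missing F c k x \<union> palette c"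
  have zE: "{x, z} \<in> E" "z \<noteq> x" using z(1) fin_graph_edge_neq[OF graph, of x z] unfolding F_def by auto
  have less: "low_colors c z \<union> ?blocked \<subseteq> {..<k}"
    using low_colors_less[OF proper zE(2)] palette_less[OF proper] missing_subset[of F c k x]
    by blast
  have "low_colors c z \<inter> ?blocked = {}" using woodall[OF proper z] unfolding low_colors_def by blast
  moreover have "finite (low_colors c z)" "finite ?blocked" using finite_subset[OF less] by simp_all
  ultimately have "card (low_colors c z) + card ?blocked = card (low_colors c z \<union> ?blocked)"
    by (simp only: card_Un_disjoint)
  moreover have "card ?blocked = card (missing F c k x) + card (palette c)"
    using palette_missing_x_disjoint[OF proper] finite_subset[OF palette_less[OF proper]]
    by (intro card_Un_disjoint) auto
  moreover have "card (low_colors c z \<union> ?blocked) \<le> k" using card_mono[OF _ less] by simp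
  ultimately show ?thesis using card_missing_F[OF proper, of x] card_low_colors[OF proper zE(1)] by simp
qed

lemma many_nbrs_with_few_low_nbrs:
  obtains Z where "Z \<subseteq> nbrs E x" "card Z = card (low_nbrs y)"
    "\<And>z. z \<in> Z \<Longrightarrow> card (low_nbrs z) + card (low_nbrs y) \<le> degree E x"
proof -
  obtain c where proper: "proper_edge_coloring F c k"
    using critical[OF edge] unfolding colorable_def F_def by blast
  let ?Z = "{z \<in> nbrs F x. c {x, z} \<in> palette c}"
  have "card ?Z = card (palette c)"
    using bij_betw_color_nbrs[OF graph_F proper palette_less[OF proper]
        palette_missing_x_disjoint[OF proper]]
    by (rule bij_betw_same_card)
  then obtain Z where Z: "Z \<subseteq> ?Z" "card Z = card (low_nbrs y)"
    using obtain_subset_with_card_n[of "card (low_nbrs y)" ?Z] card_palette_ge[OF proper] by auto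
  have "card (low_nbrs z) + card (low_nbrs y) \<le> degree E x" if "z \<in> Z" for z
    using card_low_nbrs_le[OF proper, of z] card_palette_ge[OF proper] that Z(1) unfolding nbrs_iff
    by force
  moreover have "Z \<subseteq> nbrs E x" using Z(1) nbrs_mono[of F E x] unfolding F_def by auto
  ultimately show ?thesis using that Z(2) by blast
qed

end

lemma ratio_plus_inverse_ge_2:
  fixes p q :: real
  assumes "p > 0" "q > 0"
  shows "p / q + q / p \<ge> 2"
proof -
  have "p / q + q / p - 2 = (p - q)\<^sup>2 / (p * q)" using assms by (simp add: field_simps power2_eq_square)
  also have "\<dots> \<ge> 0" using assms by simp
  finally show ?thesis by simp
qed

lemma card_divide_le_sum_inverse:
  fixes l :: "'a \<Rightarrow> nat"
  assumes "\<And>z. z \<in> Z \<Longrightarrow> 1 \<le> l z \<and> l z \<le> m"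
  shows "real (card Z) / real m \<le> (\<Sum>z\<in>Z. 1 / real (l z))"
proof -
  have "real (card Z) / real m = (\<Sum>z\<in>Z. 1 / real m)" by simp
  also have "\<dots> \<le> (\<Sum>z\<in>Z. 1 / real (l z))" using assms by (intro sum_mono frac_le) (auto dest: assms)
  finally show ?thesis .
qed

lemma sum_inverse_ge_2:
  fixes l :: "'a \<Rightarrow> nat"
  assumes N: "finite N" "y \<in> N" "\<And>z. z \<in> N \<Longrightarrow> 1 \<le> l z \<and> l z \<le> l y"
    and Z: "Z \<subseteq> N" "card Z = l y" "\<And>z. z \<in> Z \<Longrightarrow> l z + l y \<le> card N"
  shows "2 \<le> (\<Sum>z\<in>N. 1 / real (l z))"
proof -
  define q where "q = card N - l y"
  have "Z \<noteq> {}" using N(2,3) Z(2) by fastforce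
  then obtain z where "z \<in> Z" by blast
  then have "z \<in> N" "l z + l y \<le> card N" using Z(1,3) by auto
  then have q: "card N = l y + q" "q \<ge> 1" using N(3)[of z] unfolding q_def by auto
  have "card (N - Z) = q" using Z(1,2) N(1) q(1) by (simp add: card_Diff_subset finite_subset)
  then have "real q / real (l y) \<le> (\<Sum>z\<in>N - Z. 1 / real (l z))"
    using card_divide_le_sum_inverse[of "N - Z" l "l y"] N(3) by simp
  moreover have "real (l y) / real q \<le> (\<Sum>z\<in>Z. 1 / real (l z))"
    using card_divide_le_sum_inverse[of Z l q] N(3) Z q(1) by fastforce
  moreover have "real (l y) / real q + real q / real (l y) \<ge> 2"
    using ratio_plus_inverse_ge_2[of "real (l y)" "real q"] N(2,3) q(2) by fastforce
  ultimately show ?thesis using sum.subset_diff[OF Z(1) N(1), of "\<lambda>z. 1 / real (l z)"] by linarith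
qed

theorem (in critical_graph) sum_inverse_low_nbrs_ge_2:
  assumes x: "low x" and pos: "degree E x > 0"
  shows "2 \<le> (\<Sum>y\<in>nbrs E x. 1 / real (card (low_nbrs y)))"
proof -
  let ?l = "\<lambda>y. card (low_nbrs y)"
  have fin: "finite (nbrs E x)" by (rule finite_nbrs[OF graph])
  have ne: "nbrs E x \<noteq> {}" using pos degree_eq_card_nbrs[OF graph, of x] by auto
  have "Max (?l ` nbrs E x) \<in> ?l ` nbrs E x" using fin ne by simp
  then obtain y where y: "y \<in> nbrs E x" "?l y = Max (?l ` nbrs E x)" by auto
  have l_bounds: "1 \<le> ?l z \<and> ?l z \<le> ?l y" if "z \<in> nbrs E x" for z
  proof -
    have "x \<in> low_nbrs z" unfolding low_nbrs_def using x that nbrs_sym[of z E x] by simp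
    then have "?l z > 0" using finite_low_nbrs by (auto simp: card_gt_0_iff)
    then show ?thesis using y(2) fin that by (simp add: Suc_le_eq)
  qed
  interpret uncolored_low_edge E k x y
    by unfold_locales (use y x in \<open>simp_all add: nbrs_iff\<close>)
  obtain Z where "Z \<subseteq> nbrs E x" "card Z = ?l y" "\<And>z. z \<in> Z \<Longrightarrow> ?l z + ?l y \<le> degree E x"
    using many_nbrs_with_few_low_nbrs by metis
  then show ?thesis
    using sum_inverse_ge_2[of "nbrs E x" y ?l] fin y(1) l_bounds degree_eq_card_nbrs[OF graph, of x]
    by simp
qed

section \<open>Assignments with prescribed multiplicity\<close>

definition owned :: "('h \<rightharpoonup> 'l) \<Rightarrow> 'l \<Rightarrow> 'h set" where
  "owned m x = {y. m y = Some x}"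

lemma owned_subset_dom: "owned m x \<subseteq> dom m"
  unfolding owned_def by blast

lemma owned_upd: "owned (m(y \<mapsto> x)) v = (if v = x then insert y (owned m v) else owned m v - {y})"
  unfolding owned_def by auto

lemma card_owned_upd_free:
  assumes "finite (dom m)" "m y = None"
  shows "card (owned (m(y \<mapsto> x)) v) = card (owned m v) + of_bool (v = x)"
proof -
  have "finite (owned m v)" using finite_subset[OF owned_subset_dom assms(1)] .
  moreover have "y \<notin> owned m v" using assms(2) unfolding owned_def by simp
  ultimately show ?thesis unfolding owned_upd by auto
qed

lemma card_owned_upd_taken:
  assumes "finite (dom m)" "m y = Some q" "x \<noteq> q"
  shows "card (owned (m(y \<mapsto> x)) v) + of_bool (v = q) = card (owned m v) + of_bool (v = x)"
proof -
  have "finite (owned m v)" using finite_subset[OF owned_subset_dom assms(1)] .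
  moreover have "y \<in> owned m v \<longleftrightarrow> v = q" using assms(2) unfolding owned_def by auto
  ultimately show ?thesis
    unfolding owned_upd using assms(3) card_Suc_Diff1[of "owned m v" y] by (auto simp: card_insert_if)
qed

lemma sum_inverse_le_1:
  assumes "card A \<le> n"
  shows "(\<Sum>a\<in>A. 1 / real n) \<le> 1"
  using assms by (cases "n = 0") (simp_all add: divide_le_eq)

locale bipartite =
  fixes L :: "'l set" and Adj :: "'l \<Rightarrow> 'h set"
  assumes finite_L: "finite L"
    and finite_Adj: "x \<in> L \<Longrightarrow> finite (Adj x)"
    and Adj_outside: "x \<notin> L \<Longrightarrow> Adj x = {}"
begin

definition assignment :: "('h \<rightharpoonup> 'l) \<Rightarrow> bool" where
  "assignment m \<longleftrightarrow> (\<forall>y x. m y = Some x \<longrightarrow> y \<in> Adj x)"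

definition r_fold :: "nat \<Rightarrow> ('h \<rightharpoonup> 'l) \<Rightarrow> bool" where
  "r_fold r m \<longleftrightarrow> assignment m \<and> (\<forall>x\<in>L. card (owned m x) = r)"

definition exchange :: "'h set \<Rightarrow> ('h \<rightharpoonup> 'l) \<Rightarrow> 'l \<Rightarrow> 'l \<Rightarrow> bool" where
  "exchange Y m p q \<longleftrightarrow> (\<exists>y\<in>Adj p \<inter> Y. m y = Some q)"

lemma assignmentD: "assignment m \<Longrightarrow> m y = Some x \<Longrightarrow> x \<in> L \<and> y \<in> Adj x"
  unfolding assignment_def using Adj_outside by (metis empty_iff)

lemma assignment_upd: "assignment m \<Longrightarrow> y \<in> Adj x \<Longrightarrow> assignment (m(y \<mapsto> x))"
  unfolding assignment_def by simp

lemma dom_assignment: "assignment m \<Longrightarrow> dom m \<subseteq> (\<Union>x\<in>L. Adj x)"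
  using assignmentD by blast

lemma finite_assigned: "finite (\<Union>x\<in>L. Adj x)"
  using finite_L finite_Adj by blast

lemma finite_dom: "assignment m \<Longrightarrow> finite (dom m)"
  using dom_assignment finite_assigned finite_subset by blast

lemma finite_owned: "assignment m \<Longrightarrow> finite (owned m x)"
  using finite_subset[OF owned_subset_dom finite_dom] .

lemma exchange_reachable_subset:
  assumes "assignment m" "x \<in> L" "(exchange Y m)\<^sup>*\<^sup>* x p"
  shows "p \<in> L"
  using assms(3,2)
  by (induction rule: rtranclp_induct) (use assignmentD[OF assms(1)] in \<open>auto simp: exchange_def\<close>)

lemma augment_along_path:
  assumes "rtrancl_path (exchange Y m) x xs p" "distinct (x # xs)"
    and "y \<in> Adj p \<inter> Y" "m y = None" "assignment m"
  shows "\<exists>m' u. assignment m' \<and> (\<forall>v. v \<notin> Y \<longrightarrow> m' v = m v) \<and> u \<in> Y - dom m \<and> dom m' = insert u (dom m) \<and>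
    (\<forall>v. card (owned m' v) = card (owned m v) + of_bool (v = x))"
  using assms
proof (induction xs arbitrary: x m)
  case Nil
  then have "p = x" by (auto elim: rtrancl_path.cases)
  then have "assignment (m(y \<mapsto> x))" using Nil.prems(3,5) assignment_upd by simp
  moreover have "card (owned (m(y \<mapsto> x)) v) = card (owned m v) + of_bool (v = x)" for v
    using card_owned_upd_free[of m y] Nil.prems(4,5) finite_dom by blast
  moreover have "dom (m(y \<mapsto> x)) = insert y (dom m)" by simp
  moreover have "y \<in> Y - dom m" "\<forall>v. v \<notin> Y \<longrightarrow> (m(y \<mapsto> x)) v = m v" using Nil.prems(3,4) by auto
  ultimately show ?case by blast
next
  case (Cons q xs)
  have "exchange Y m x q" and path: "rtrancl_path (exchange Y m) q xs p"
    using Cons.prems(1) by (auto elim: rtrancl_path.cases)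
  then obtain z where z: "z \<in> Adj x \<inter> Y" "m z = Some q" unfolding exchange_def by blast
  define m1 where "m1 = m(z \<mapsto> x)"
  have m1: "assignment m1" "dom m1 = dom m" "m1 y = None"
    using assignment_upd[OF Cons.prems(5)] z Cons.prems(4) unfolding m1_def by auto
  have "rtrancl_path (exchange Y m1) q xs p"
  proof (rule rtrancl_path_mono_on[OF path])
    fix u v assume v: "v \<in> set xs" "exchange Y m u v"
    then obtain w where w: "w \<in> Adj u \<inter> Y" "m w = Some v" unfolding exchange_def by blast
    have "w \<noteq> z" using v(1) w(2) z(2) Cons.prems(2) by auto
    then show "exchange Y m1 u v" using w unfolding exchange_def m1_def by auto
  qed
  then obtain m' u where m': "assignment m'" "\<forall>v. v \<notin> Y \<longrightarrow> m' v = m1 v" "u \<in> Y - dom m1"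
    "dom m' = insert u (dom m1)"
      "\<forall>v. card (owned m' v) = card (owned m1 v) + of_bool (v = q)"
    using Cons.IH[of m1 q] Cons.prems(2,3) m1 by auto
  have "card (owned m' v) = card (owned m v) + of_bool (v = x)" for v
    using m'(5) card_owned_upd_taken[OF finite_dom[OF Cons.prems(5)] z(2), of x v] Cons.prems(2)
    unfolding m1_def by auto
  moreover have "\<forall>v. v \<notin> Y \<longrightarrow> m' v = m v" using m'(2) z(1) unfolding m1_def by auto
  ultimately show ?case using m'(1,3,4) unfolding m1(2) by blast
qed

lemma augment:
  assumes "(exchange Y m)\<^sup>*\<^sup>* x p" "y \<in> Adj p \<inter> Y" "m y = None" "assignment m"
  obtains m' u where "assignment m'" "\<And>v. v \<notin> Y \<Longrightarrow> m' v = m v" "u \<in> Y - dom m"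
    "dom m' = insert u (dom m)"
    "\<And>v. card (owned m' v) = card (owned m v) + of_bool (v = x)"
proof -
  obtain xs where "rtrancl_path (exchange Y m) x xs p"
    using assms(1) unfolding rtranclp_eq_rtrancl_path by blast
  then obtain xs' where "rtrancl_path (exchange Y m) x xs' p" "distinct (x # xs')"
    by (rule rtrancl_path_distinct)
  then show ?thesis using augment_along_path[OF _ _ assms(2-4)] that by blast
qed

lemma maximal_assignment_closed:
  assumes m: "assignment m" "\<And>v. card (owned m v) \<le> r"
    and maximal: "\<And>m'. assignment m' \<Longrightarrow> (\<And>v. card (owned m' v) \<le> r) \<Longrightarrow> card (dom m') \<le> card (dom m)"
    and deficient: "card (owned m x) < r" and p: "(exchange UNIV m)\<^sup>*\<^sup>* x p" "y \<in> Adj p"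
  shows "\<exists>q. (exchange UNIV m)\<^sup>*\<^sup>* x q \<and> m y = Some q"
proof (cases "m y")
  case None
  then obtain m' u where m': "assignment m'" "u \<notin> dom m" "dom m' = insert u (dom m)"
      "\<And>v. card (owned m' v) = card (owned m v) + of_bool (v = x)"
    using augment[OF p(1) _ _ m(1), of y] p(2) by auto
  have "card (owned m' v) \<le> r" for v using m'(4)[of v] m(2)[of v] deficient by auto
  then have "card (dom m') \<le> card (dom m)" by (rule maximal[OF m'(1)])
  then show ?thesis using m'(2,3) finite_dom[OF m(1)] by simp
next
  case (Some q)
  then have "exchange UNIV m p q" using p(2) unfolding exchange_def by blast
  then show ?thesis using p(1) Some by (auto intro: rtranclp.rtrancl_into_rtrancl)
qed

theorem hall_r_fold:
  assumes hall: "\<And>A. A \<subseteq> L \<Longrightarrow> r * card A \<le> card (\<Union>x\<in>A. Adj x)"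
  obtains m where "r_fold r m"
proof -
  define ok where "ok m \<longleftrightarrow> assignment m \<and> (\<forall>v. card (owned m v) \<le> r)" for m
  have "ok Map.empty" unfolding ok_def assignment_def owned_def by simp
  moreover have "card (dom m) \<le> card (\<Union>x\<in>L. Adj x)" if "ok m" for m
    using that card_mono[OF finite_assigned dom_assignment] unfolding ok_def by blast
  ultimately obtain m where ok: "ok m" and maximal: "\<And>m'. ok m' \<Longrightarrow> card (dom m') \<le> card (dom m)"
    using ex_has_greatest_nat[of ok Map.empty "\<lambda>m. card (dom m)"] by (metis le_imp_less_Suc)
  have m: "assignment m" "\<And>v. card (owned m v) \<le> r" using ok unfolding ok_def by auto
  have "card (owned m x) = r" if x: "x \<in> L" for x
  proof (rule ccontr)
    assume "card (owned m x) \<noteq> r"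
    then have deficient: "card (owned m x) < r" using m(2)[of x] by simp
    define A where "A = {q. (exchange UNIV m)\<^sup>*\<^sup>* x q}"
    have A: "A \<subseteq> L" "x \<in> A" unfolding A_def using exchange_reachable_subset[OF m(1) x] by auto
    have finA: "finite A" using A(1) finite_L finite_subset by blast
    have "(\<Union>q\<in>A. Adj q) \<subseteq> (\<Union>q\<in>A. owned m q)"
      using maximal_assignment_closed[OF m _ deficient] maximal unfolding A_def ok_def owned_def
      by blast
    then have "card (\<Union>q\<in>A. Adj q) \<le> card (\<Union>q\<in>A. owned m q)"
      using finA finite_owned[OF m(1)] by (intro card_mono) auto
    also have "\<dots> \<le> (\<Sum>q\<in>A. card (owned m q))" by (rule card_UN_le[OF finA])
    also have "\<dots> < (\<Sum>q\<in>A. r)"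
      by (rule sum_strict_mono_ex1[OF finA]) (use m(2) deficient A(2) in auto)
    finally show False using hall[OF A(1)] by (simp add: mult.commute)
  qed
  then show ?thesis using that m(1) unfolding r_fold_def by blast
qed

lemma hall_condition_of_weights:
  assumes weight: "\<And>x. x \<in> L \<Longrightarrow> real r \<le> (\<Sum>y\<in>Adj x. 1 / real (card {x'\<in>L. y \<in> Adj x'}))"
    and A: "A \<subseteq> L"
  shows "r * card A \<le> card (\<Union>x\<in>A. Adj x)"
proof -
  let ?w = "\<lambda>y. 1 / real (card {x'\<in>L. y \<in> Adj x'})" and ?N = "\<Union>x\<in>A. Adj x"
  have fin: "finite A" "finite ?N" using finite_subset[OF A finite_L] A finite_Adj by auto
  have "real r * real (card A) = (\<Sum>x\<in>A. real r)" by simp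
  also have "\<dots> \<le> (\<Sum>x\<in>A. \<Sum>y\<in>Adj x. ?w y)"
    by (rule sum_mono) (use weight A in blast)
  also have "\<dots> = (\<Sum>x\<in>A. \<Sum>y | y \<in> ?N \<and> y \<in> Adj x. ?w y)"
    by (intro sum.cong refl) auto
  also have "\<dots> = (\<Sum>y\<in>?N. \<Sum>x | x \<in> A \<and> y \<in> Adj x. ?w y)"
    by (rule sum.swap_restrict[OF fin])
  also have "\<dots> \<le> (\<Sum>y\<in>?N. 1)"
    by (intro sum_mono sum_inverse_le_1 card_mono) (use A finite_L in auto)
  finally have "real (r * card A) \<le> real (card ?N)" by simp
  then show ?thesis by (simp only: of_nat_le_iff)
qed

lemma swap_into_subset:
  assumes m: "r_fold r m" and x: "x \<in> L" "\<not> owned m x \<subseteq> Y"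
    and p: "(exchange Y m)\<^sup>*\<^sup>* x p" "y \<in> Adj p \<inter> Y" "m y = None"
  obtains m' where "r_fold r m'" "card (dom m \<inter> Y) < card (dom m' \<inter> Y)"
proof -
  have assign: "assignment m" using m unfolding r_fold_def by blast
  obtain m1 u where m1: "assignment m1" "\<And>v. v \<notin> Y \<Longrightarrow> m1 v = m v" "u \<in> Y - dom m"
    "dom m1 = insert u (dom m)"
      "\<And>v. card (owned m1 v) = card (owned m v) + of_bool (v = x)"
    using augment[OF p assign] by metis
  obtain t where t: "m t = Some x" "t \<notin> Y" using x(2) unfolding owned_def by blast
  define m' where "m' = m1(t := None)"
  have "m1 t = Some x" using m1(2) t by simp
  then have "owned m' v = owned m1 v - (if v = x then {t} else {})" for v
    unfolding owned_def m'_def by auto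
  then have "card (owned m' v) = card (owned m v)" for v
    using m1(5)[of v] \<open>m1 t = Some x\<close> by (auto simp: owned_def)
  moreover have "assignment m'" using m1(1) unfolding assignment_def m'_def by simp
  ultimately have "r_fold r m'" using m unfolding r_fold_def by simp
  moreover have "dom m' \<inter> Y = insert u (dom m \<inter> Y)" using m1(3,4) t(2) unfolding m'_def by auto
  then have "card (dom m \<inter> Y) < card (dom m' \<inter> Y)" using m1(3) finite_dom[OF assign] by simp
  ultimately show ?thesis by (rule that)
qed

text \<open>
Among all \<open>r\<close>-fold assignments take one using as many elements of \<open>Y\<close> as possible; \<open>A\<close> consists of the
vertices reachable by exchanges in \<open>Y\<close> from an owner of an element outside \<open>Y\<close>.
\<close>

theorem r_fold_saturating:
  assumes ex: "r_fold r m0"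
  obtains m A where "r_fold r m" "A \<subseteq> L"
    "\<And>x y. x \<in> A \<Longrightarrow> y \<in> Adj x \<inter> Y \<Longrightarrow> \<exists>x'\<in>A. m y = Some x'"
    "\<And>x. x \<in> L - A \<Longrightarrow> owned m x \<subseteq> Y"
proof -
  have "card (dom m \<inter> Y) \<le> card (\<Union>x\<in>L. Adj x)" if "r_fold r m" for m
    using that dom_assignment[of m] unfolding r_fold_def by (intro card_mono[OF finite_assigned]) blast
  then obtain m where m: "r_fold r m"
    and maximal: "\<And>m'. r_fold r m' \<Longrightarrow> card (dom m' \<inter> Y) \<le> card (dom m \<inter> Y)"
    using ex_has_greatest_nat[of "r_fold r" m0 "\<lambda>m. card (dom m \<inter> Y)"] ex by (metis le_imp_less_Suc)
  define A where "A = {q. \<exists>x\<in>L. \<not> owned m x \<subseteq> Y \<and> (exchange Y m)\<^sup>*\<^sup>* x q}"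
  have "A \<subseteq> L" unfolding A_def using exchange_reachable_subset m unfolding r_fold_def by blast
  moreover have "\<exists>x'\<in>A. m y = Some x'" if p: "p \<in> A" "y \<in> Adj p \<inter> Y" for p y
  proof -
    obtain x where x: "x \<in> L" "\<not> owned m x \<subseteq> Y" "(exchange Y m)\<^sup>*\<^sup>* x p"
      using p(1) unfolding A_def by blast
    have "m y \<noteq> None" using swap_into_subset[OF m x p(2)] maximal by (metis leD)
    then obtain q where q: "m y = Some q" by blast
    then have "exchange Y m p q" using p(2) unfolding exchange_def by blast
    then have "q \<in> A" using x unfolding A_def by (auto intro: rtranclp.rtrancl_into_rtrancl)
    then show ?thesis using q by blast
  qed
  moreover have "owned m x \<subseteq> Y" if "x \<in> L - A" for x
    using that unfolding A_def by blast
  ultimately show ?thesis using that m by blast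
qed

end

section \<open>The Bondy--Chvatal closure\<close>

lemma successively_adj_rev: "successively (adj E) (rev p) \<longleftrightarrow> successively (adj E) p"
  by (simp add: insert_commute)

definition hamilton_cycle :: "'a set \<Rightarrow> 'a set set \<Rightarrow> 'a list \<Rightarrow> bool" where
  "hamilton_cycle V E p \<longleftrightarrow>
    distinct p \<and> set p = V \<and> length p \<ge> 3 \<and> successively (adj E) p \<and> adj E (last p) (hd p)"

lemma cyclic_adj_iff:
  assumes "p \<noteq> []"
  shows "(\<forall>i < length p. {p ! i, p ! ((i + 1) mod length p)} \<in> E) \<longleftrightarrow>
    successively (adj E) p \<and> adj E (last p) (hd p)"
proof -
  obtain n where n: "length p = Suc n" using assms by (cases p) auto
  have "(\<forall>i < Suc n. {p ! i, p ! ((i + 1) mod Suc n)} \<in> E) \<longleftrightarrow>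
    (\<forall>i < n. {p ! i, p ! Suc i} \<in> E) \<and> {p ! n, p ! 0} \<in> E"
    unfolding All_less_Suc by auto
  then show ?thesis
    using assms n by (simp add: successively_conv_nth last_conv_nth hd_conv_nth)
qed

lemma hamiltonian_iff: "hamiltonian V E \<longleftrightarrow> (\<exists>p. hamilton_cycle V E p)"
proof -
  have "p \<noteq> []" if "length p \<ge> 3" for p :: "'a list" using that by auto
  then show ?thesis unfolding hamiltonian_def hamilton_cycle_def using cyclic_adj_iff[of _ E] by blast
qed

lemma hamilton_cycle_rotate: "hamilton_cycle V E (r @ s) \<Longrightarrow> hamilton_cycle V E (s @ r)"
  unfolding hamilton_cycle_def by (cases "r = []"; cases "s = []") (auto simp: successively_append_iff)

lemma simple_graph_nbrs_subset: "simple_graph V E \<Longrightarrow> nbrs E v \<subseteq> V"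
  unfolding simple_graph_def nbrs_def by auto

lemma degree_le_card_positions:
  assumes "fin_graph E" "finite S" "nbrs E v \<subseteq> f ` S"
  shows "degree E v \<le> card S"
  unfolding degree_eq_card_nbrs[OF assms(1)] by (rule surj_card_le[OF assms(2,3)])

lemma crossing_adjacencies:
  assumes simple: "simple_graph V E" and p: "distinct p" "set p = V" "p \<noteq> []"
    and degrees: "card V \<le> degree E (hd p) + degree E (last p)"
  obtains i where "Suc i < length p" "adj E (hd p) (p ! Suc i)" "adj E (p ! i) (last p)"
proof -
  define S where "S = {i. Suc i < length p \<and> adj E (hd p) (p ! Suc i)}"
  define T where "T = {i. Suc i < length p \<and> adj E (p ! i) (last p)}"
  have ST: "S \<union> T \<subseteq> {..<length p - 1}" unfolding S_def T_def by auto
  then have fin: "finite S" "finite T" using finite_subset by blast+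
  have graph: "fin_graph E" using simple_graph_fin_graph[OF simple] .
  have position: "\<exists>i<length p. p ! i = w" if "w \<in> nbrs E v" for v w
    using that simple_graph_nbrs_subset[OF simple] p(2) by (metis in_set_conv_nth subsetD)
  have "nbrs E (hd p) \<subseteq> (\<lambda>i. p ! Suc i) ` S"
  proof
    fix w assume w: "w \<in> nbrs E (hd p)"
    then obtain i where i: "i < length p" "p ! i = w" using position by blast
    have "i \<noteq> 0" using i(2) w nbrs_irrefl[OF graph] p(3) by (metis hd_conv_nth)
    then obtain j where "i = Suc j" by (cases i) auto
    then have "j \<in> S" "w = p ! Suc j" using i w unfolding S_def nbrs_iff by simp_all
    then show "w \<in> (\<lambda>i. p ! Suc i) ` S" by blast
  qed
  then have "degree E (hd p) \<le> card S" by (rule degree_le_card_positions[OF graph fin(1)])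
  moreover have "nbrs E (last p) \<subseteq> (\<lambda>i. p ! i) ` T"
  proof
    fix w assume w: "w \<in> nbrs E (last p)"
    then obtain i where i: "i < length p" "p ! i = w" using position by blast
    have "i \<noteq> length p - 1" using i(2) w nbrs_irrefl[OF graph] p(3) by (metis last_conv_nth)
    then have "i \<in> T" using i w unfolding T_def nbrs_iff by (simp add: insert_commute)
    then show "w \<in> (\<lambda>i. p ! i) ` T" using i(2) by blast
  qed
  then have "degree E (last p) \<le> card T" by (rule degree_le_card_positions[OF graph fin(2)])
  moreover have "card V = length p" "length p > 0" using p by (auto simp: distinct_card)
  ultimately have "card S + card T > length p - 1" using degrees by linarith
  moreover have "card (S \<union> T) \<le> length p - 1" using card_mono[OF _ ST] by simp
  ultimately have "card (S \<inter> T) \<noteq> 0" using card_Un_Int[OF fin] by linarith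
  then have "S \<inter> T \<noteq> {}" by (metis card.empty)
  then show ?thesis using that unfolding S_def T_def by blast
qed

lemma hamiltonian_if_path_ends_heavy:
  assumes simple: "simple_graph V E"
    and p: "distinct p" "set p = V" "length p \<ge> 3" "successively (adj E) p"
    and degrees: "card V \<le> degree E (hd p) + degree E (last p)"
  shows "hamiltonian V E"
proof -
  have "p \<noteq> []" using p(3) by auto
  then obtain i where i: "Suc i < length p" "adj E (hd p) (p ! Suc i)" "adj E (p ! i) (last p)"
    using crossing_adjacencies[OF simple p(1,2) _ degrees] by blast
  define r where "r = take (Suc i) p"
  define s where "s = drop (Suc i) p"
  have rs: "p = r @ s" "r \<noteq> []" "s \<noteq> []" unfolding r_def s_def using i(1) by auto
  have ends: "last r = p ! i" "hd s = p ! Suc i"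
    unfolding r_def s_def using i(1) by (simp_all add: take_Suc_conv_app_nth hd_drop_conv_nth)
  have "successively (adj E) r" "successively (adj E) s"
    using p(4) rs by (simp_all add: successively_append_iff)
  then have "successively (adj E) (r @ rev s)"
    using i(3) ends rs successively_adj_rev[of E s] by (simp add: successively_append_iff hd_rev)
  moreover have "adj E (last (r @ rev s)) (hd (r @ rev s))"
    using i(2) ends rs by (simp add: last_rev insert_commute)
  moreover have "distinct (r @ rev s)" "set (r @ rev s) = V" "length (r @ rev s) \<ge> 3"
    using p(1-3) rs by auto
  ultimately show ?thesis unfolding hamiltonian_iff hamilton_cycle_def by blast
qed

lemma closing_edge_unique:
  assumes "distinct q" "length q \<ge> 3" "Suc i < length q"
  shows "{q ! i, q ! Suc i} \<noteq> {last q, hd q}"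
proof
  assume "{q ! i, q ! Suc i} = {last q, hd q}"
  moreover have "q \<noteq> []" using assms(2) by auto
  ultimately have "i = length q - 1 \<and> Suc i = 0 \<or> i = 0 \<and> Suc i = length q - 1"
    using assms(1,3) by (auto simp: doubleton_eq_iff last_conv_nth hd_conv_nth nth_eq_iff_index_eq)
  then show False using assms(2,3) by auto
qed

lemma closing_new_edge:
  assumes q: "hamilton_cycle V (insert {u, v} E) q" "\<not> adj E (last q) (hd q)"
  shows "successively (adj E) q" "{last q, hd q} = {u, v}"
proof -
  show closing: "{last q, hd q} = {u, v}" using q unfolding hamilton_cycle_def by blast
  have "adj E (q ! i) (q ! Suc i)" if "Suc i < length q" for i
    using q(1) closing_edge_unique[of q i] that closing
    unfolding hamilton_cycle_def successively_conv_nth by auto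
  then show "successively (adj E) q" by (simp add: successively_conv_nth)
qed

lemma hamilton_cycle_rotate_to_new_edge:
  assumes p: "hamilton_cycle V (insert {u, v} E) p" "\<not> hamilton_cycle V E p"
  obtains q where "hamilton_cycle V (insert {u, v} E) q" "\<not> adj E (last q) (hd q)"
proof (cases "successively (adj E) p")
  case True
  then show ?thesis using that p unfolding hamilton_cycle_def by blast
next
  case False
  then obtain i where i: "Suc i < length p" "\<not> adj E (p ! i) (p ! Suc i)"
    by (auto simp: successively_conv_nth)
  have "hamilton_cycle V (insert {u, v} E) (drop (Suc i) p @ take (Suc i) p)"
    by (rule hamilton_cycle_rotate) (simp add: p(1))
  moreover have "last (drop (Suc i) p @ take (Suc i) p) = p ! i"
    "hd (drop (Suc i) p @ take (Suc i) p) = p ! Suc i"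
    using i(1) by (simp_all add: take_Suc_conv_app_nth hd_drop_conv_nth)
  ultimately show ?thesis using that i(2) by metis
qed

lemma bondy_chvatal_step:
  assumes simple: "simple_graph V E" and degrees: "card V \<le> degree E u + degree E v"
    and ham: "hamiltonian V (insert {u, v} E)"
  shows "hamiltonian V E"
proof (rule ccontr)
  assume non_ham: "\<not> hamiltonian V E"
  obtain p where "hamilton_cycle V (insert {u, v} E) p" using ham unfolding hamiltonian_iff by blast
  then obtain q where q: "hamilton_cycle V (insert {u, v} E) q" "\<not> adj E (last q) (hd q)"
    using hamilton_cycle_rotate_to_new_edge non_ham unfolding hamiltonian_iff by metis
  note closing = closing_new_edge[OF q]
  have "card V \<le> degree E (hd q) + degree E (last q)"
    using degrees closing(2) by (metis add.commute doubleton_eq_iff)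
  then have "hamiltonian V E"
    using hamiltonian_if_path_ends_heavy[OF simple] q(1) closing(1) unfolding hamilton_cycle_def
    by blast
  then show False using non_ham by blast
qed

theorem bondy_chvatal_closure:
  assumes simple: "simple_graph V E"
  obtains E' where "E \<subseteq> E'" "simple_graph V E'" "hamiltonian V E' \<Longrightarrow> hamiltonian V E"
    "\<And>u v. u \<in> V \<Longrightarrow> v \<in> V \<Longrightarrow> u \<noteq> v \<Longrightarrow> card V \<le> degree E' u + degree E' v \<Longrightarrow> {u, v} \<in> E'"
proof -
  define extension where
    "extension F \<longleftrightarrow> E \<subseteq> F \<and> simple_graph V F \<and> (hamiltonian V F \<longrightarrow> hamiltonian V E)" for F
  have finV: "finite V" using simple unfolding simple_graph_def by blast
  have sub: "F \<subseteq> Pow V" if "extension F" for F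
    using that unfolding extension_def simple_graph_def by blast
  have "extension E" using simple unfolding extension_def by blast
  moreover have "card F < Suc (card (Pow V))" if "extension F" for F
    using card_mono[OF _ sub[OF that]] finV by simp
  ultimately obtain F where F: "extension F" and maximal: "\<And>F'. extension F' \<Longrightarrow> card F' \<le> card F"
    using ex_has_greatest_nat[of extension E card] by blast
  have "{u, v} \<in> F" if uv: "u \<in> V" "v \<in> V" "u \<noteq> v" "card V \<le> degree F u + degree F v" for u v
  proof (rule ccontr)
    assume new: "{u, v} \<notin> F"
    have "simple_graph V (insert {u, v} F)" using F uv unfolding extension_def simple_graph_def by auto
    moreover have "hamiltonian V (insert {u, v} F) \<longrightarrow> hamiltonian V E"
      using bondy_chvatal_step[OF _ uv(4)] F unfolding extension_def by blast
    ultimately have "extension (insert {u, v} F)" using F unfolding extension_def by blast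
    moreover have "finite F" using sub[OF F] finV finite_subset by blast
    ultimately show False using maximal[of "insert {u, v} F"] new by simp
  qed
  then show ?thesis using that[of F] F unfolding extension_def by blast
qed

section \<open>Path systems\<close>

definition path_system :: "'a set set \<Rightarrow> 'a set \<Rightarrow> 'a list list \<Rightarrow> bool" where
  "path_system E V Ps \<longleftrightarrow> distinct (concat Ps) \<and> set (concat Ps) = V \<and>
     (\<forall>p\<in>set Ps. p \<noteq> [] \<and> successively (adj E) p)"

definition path_ends :: "'a set \<Rightarrow> 'a list \<Rightarrow> nat" where
  "path_ends X p = of_bool (hd p \<in> X) + of_bool (last p \<in> X)"

definition ends :: "'a set \<Rightarrow> 'a list list \<Rightarrow> nat" where
  "ends X Ps = (\<Sum>p\<leftarrow>Ps. path_ends X p)"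

lemma ends_Cons [simp]: "ends X (p # Ps) = path_ends X p + ends X Ps"
  unfolding ends_def by simp

lemma ends_Nil [simp]: "ends X [] = 0"
  unfolding ends_def by simp

lemma ends_eq_0_iff: "ends X Ps = 0 \<longleftrightarrow> (\<forall>p\<in>set Ps. path_ends X p = 0)"
  by (induction Ps) auto

lemma path_system_perm:
  assumes "mset Ps = mset Qs"
  shows "path_system E V Ps \<longleftrightarrow> path_system E V Qs"
proof -
  have "mset (concat Ps) = mset (concat Qs)"
    unfolding mset_concat using assms by (metis mset_map sum_mset_sum_list)
  then show ?thesis
    unfolding path_system_def
    by (metis mset_eq_setD[OF assms] mset_eq_setD mset_eq_imp_distinct_iff)
qed

lemma ends_perm: "mset Ps = mset Qs \<Longrightarrow> ends X Ps = ends X Qs"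
  unfolding ends_def by (metis mset_map sum_mset_sum_list)

lemma ends_sum: "finite X \<Longrightarrow> ends X Ps = (\<Sum>v\<in>X. ends {v} Ps)"
proof (induction Ps)
  case (Cons p Ps)
  have "(\<Sum>v\<in>X. of_bool (w = v)) = (of_bool (w \<in> X) :: nat)" for w
    using Cons.prems by (simp add: of_bool_def)
  then show ?case using Cons by (simp add: path_ends_def sum.distrib)
qed simp

lemma ends_pos_ex: "ends X Ps > 0 \<Longrightarrow> \<exists>p\<in>set Ps. \<exists>a\<in>{hd p, last p}. a \<in> X"
  by (induction Ps) (auto simp: path_ends_def of_bool_def split: if_splits)

lemma mset_to_front: "p \<in> set Ps \<Longrightarrow> mset Ps = mset (p # remove1 p Ps)"
  by simp

lemma ends_cong_on:
  assumes "path_system E V Ps" "X \<inter> V = Y \<inter> V"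
  shows "ends X Ps = ends Y Ps"
proof -
  have "hd p \<in> V" "last p \<in> V" if "p \<in> set Ps" for p
    using assms(1) that unfolding path_system_def by auto
  moreover have "v \<in> X \<longleftrightarrow> v \<in> Y" if "v \<in> V" for v using assms(2) that by blast
  ultimately have "path_ends X p = path_ends Y p" if "p \<in> set Ps" for p
    using that unfolding path_ends_def by simp
  then show ?thesis unfolding ends_def by (simp cong: map_cong)
qed

lemma path_system_singletons:
  assumes "distinct vs"
  shows "path_system E (set vs) (map (\<lambda>v. [v]) vs)" "v \<in> set vs \<Longrightarrow> ends {v} (map (\<lambda>v. [v]) vs) = 2"
proof -
  have "concat (map (\<lambda>v. [v]) vs) = vs" by (induction vs) auto
  then show "path_system E (set vs) (map (\<lambda>v. [v]) vs)" unfolding path_system_def using assms by auto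
  show "ends {v} (map (\<lambda>v. [v]) vs) = 2" if "v \<in> set vs"
    using assms that
  proof (induction vs)
    case (Cons w vs)
    have "ends {v} (map (\<lambda>v. [v]) vs) = 0" if "v \<notin> set vs" for v
      unfolding ends_eq_0_iff path_ends_def using that by auto
    then show ?case using Cons by (auto simp: path_ends_def)
  qed simp
qed

lemma merge_paths:
  assumes system: "path_system E V (p # q # Ps)"
    and ends: "a \<in> {hd p, last p}" "b \<in> {hd q, last q}" "adj E a b"
  obtains r where "path_system E V (r # Ps)" "set r = set p \<union> set q"
    "\<And>X. ends X (r # Ps) + of_bool (a \<in> X) + of_bool (b \<in> X) = ends X (p # q # Ps)"
proof -
  have ne: "p \<noteq> []" "q \<noteq> []" using system unfolding path_system_def by auto
  have "last p = a \<or> last (rev p) = a" "hd q = b \<or> hd (rev q) = b"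
    using ends(1,2) ne by (auto simp: last_rev hd_rev)
  then obtain p' q' where p': "p' \<in> {p, rev p}" "last p' = a" and q': "q' \<in> {q, rev q}" "hd q' = b"
    by blast
  have ne': "p' \<noteq> []" "q' \<noteq> []" using p'(1) q'(1) ne by auto
  have path': "successively (adj E) p'" "successively (adj E) q'"
    using p'(1) q'(1) system successively_adj_rev[of E] unfolding path_system_def by auto
  have same: "set p' = set p" "set q' = set q" "distinct p' \<longleftrightarrow> distinct p" "distinct q' \<longleftrightarrow> distinct q"
    "path_ends X p' = path_ends X p" "path_ends X q' = path_ends X q" for X
    using p'(1) q'(1) ne unfolding path_ends_def by (auto simp: hd_rev last_rev)
  have "successively (adj E) (p' @ q')"
    using path' p'(2) q'(2) ends(3) by (simp add: successively_append_iff)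
  then have "path_system E V ((p' @ q') # Ps)"
    using system ne' same(1-4) unfolding path_system_def by auto
  moreover have "ends X ((p' @ q') # Ps) + of_bool (a \<in> X) + of_bool (b \<in> X) = ends X (p # q # Ps)"
    for X
    using same(5,6)[of X] p'(2) q'(2) ne' by (simp add: path_ends_def)
  ultimately show ?thesis using that same(1,2) by simp
qed

definition two_regular :: "'a set set \<Rightarrow> bool" where
  "two_regular C \<longleftrightarrow> C \<noteq> {} \<and> (\<forall>v. degree C v = 0 \<or> degree C v = 2)"

definition acyclic_edges :: "'a set set \<Rightarrow> bool" where
  "acyclic_edges F \<longleftrightarrow> \<not> (\<exists>C\<subseteq>F. two_regular C)"

lemma acyclic_subset: "acyclic_edges F \<Longrightarrow> G \<subseteq> F \<Longrightarrow> acyclic_edges G"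
  unfolding acyclic_edges_def by blast

text \<open>\<open>Ps\<close> is the system of components of the linear forest \<open>F\<close>.\<close>

definition components_of :: "'a set set \<Rightarrow> 'a set \<Rightarrow> 'a set set \<Rightarrow> 'a list list \<Rightarrow> bool" where
  "components_of E V F Ps \<longleftrightarrow> path_system E V Ps \<and> (\<forall>v\<in>V. ends {v} Ps + degree F v = 2) \<and>
     (\<forall>e\<in>F. \<exists>p\<in>set Ps. e \<subseteq> set p)"

lemma components_of_perm:
  "mset Ps = mset Qs \<Longrightarrow> components_of E V F Ps \<longleftrightarrow> components_of E V F Qs"
  unfolding components_of_def using path_system_perm ends_perm mset_eq_setD by metis

lemma components_of_ends_sum:
  assumes "components_of E V F Ps" "X \<subseteq> V" "finite X"
  shows "ends X Ps + (\<Sum>v\<in>X. degree F v) = 2 * card X"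
proof -
  have "ends X Ps + (\<Sum>v\<in>X. degree F v) = (\<Sum>v\<in>X. ends {v} Ps + degree F v)"
    using ends_sum[OF assms(3), of Ps] by (simp add: sum.distrib)
  also have "\<dots> = (\<Sum>v\<in>X. 2)"
    by (rule sum.cong[OF refl]) (use assms(1,2) in \<open>auto simp: components_of_def\<close>)
  finally show ?thesis by simp
qed

lemma ends_singleton_eq_path_ends:
  assumes "path_system E V (p # Ps)" "v \<in> set p"
  shows "ends {v} (p # Ps) = path_ends {v} p"
proof -
  have "path_ends {v} q = 0" if q: "q \<in> set Ps" for q
  proof -
    have "hd q \<in> set q" "last q \<in> set q" using assms(1) q unfolding path_system_def by auto
    moreover have "v \<notin> set q" using assms q unfolding path_system_def by auto
    ultimately show ?thesis unfolding path_ends_def by auto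
  qed
  then show ?thesis using ends_eq_0_iff[of "{v}" Ps] by simp
qed

lemma joining_own_ends_not_acyclic:
  assumes comp: "components_of E V F (p # Ps)" and fin: "finite F"
    and ab: "{hd p, last p} = {a, b}" "a \<noteq> b" "{a, b} \<notin> F"
  shows "\<not> acyclic_edges (insert {a, b} F)"
proof -
  have system: "path_system E V (p # Ps)" using comp unfolding components_of_def by blast
  define C where "C = {f\<in>F. f \<subseteq> set p}"
  have C: "finite C" "{a, b} \<notin> C" "insert {a, b} C \<subseteq> insert {a, b} F"
    unfolding C_def using fin ab(3) by auto
  have "degree (insert {a, b} C) v = 0 \<or> degree (insert {a, b} C) v = 2" for v
  proof (cases "v \<in> set p")
    case True
    have "f \<subseteq> set p" if f: "f \<in> F" "v \<in> f" for f
    proof -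
      obtain q where q: "q \<in> set (p # Ps)" "f \<subseteq> set q"
        using comp f(1) unfolding components_of_def by blast
      then have "q = p" using system True f(2) unfolding path_system_def by auto
      then show ?thesis using q(2) by simp
    qed
    then have "degree C v = degree F v" unfolding degree_def C_def by (metis (lifting) mem_Collect_eq)
    moreover have "path_ends {v} p = of_bool (v \<in> {a, b})"
      using ab(1,2) unfolding path_ends_def by (auto simp: doubleton_eq_iff)
    moreover have "v \<in> V" using system True unfolding path_system_def by auto
    then have "ends {v} (p # Ps) + degree F v = 2" using comp unfolding components_of_def by blast
    ultimately show ?thesis
      using degree_insert_edge[OF C(1,2)] ends_singleton_eq_path_ends[OF system True] by simp
  next
    case False
    have "p \<noteq> []" using system unfolding path_system_def by simp
    then have "{a, b} \<subseteq> set p" unfolding ab(1)[symmetric] by simp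
    then have "v \<notin> {a, b}" using False by blast
    moreover have "degree C v = 0" using degree_eq_0_iff[OF C(1)] False unfolding C_def by blast
    ultimately show ?thesis using degree_insert_edge[OF C(1,2)] by simp
  qed
  then show ?thesis using C(3) unfolding acyclic_edges_def two_regular_def by blast
qed

lemma components_of_insert_edge:
  assumes comp: "components_of E V F (p # q # Ps)" and fin: "finite F"
    and ab: "a \<in> {hd p, last p}" "b \<in> {hd q, last q}" "{a, b} \<in> E" "{a, b} \<notin> F"
  obtains Qs where "components_of E V (insert {a, b} F) Qs"
proof -
  have system: "path_system E V (p # q # Ps)" using comp unfolding components_of_def by blast
  then obtain r where r: "path_system E V (r # Ps)" "set r = set p \<union> set q"
      "\<And>X. ends X (r # Ps) + of_bool (a \<in> X) + of_bool (b \<in> X) = ends X (p # q # Ps)"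
    using merge_paths[OF _ ab(1-3)] by blast
  have "p \<noteq> []" "q \<noteq> []" "set p \<inter> set q = {}" using system unfolding path_system_def by auto
  moreover from this have "a \<in> set p" "b \<in> set q" using ab(1,2) by auto
  ultimately have in_r: "{a, b} \<subseteq> set r" "a \<noteq> b" using r(2) by auto
  have "ends {v} (r # Ps) + degree (insert {a, b} F) v = 2" if "v \<in> V" for v
  proof -
    have "ends {v} (p # q # Ps) + degree F v = 2" using comp that unfolding components_of_def by blast
    then show ?thesis using r(3)[of "{v}"] degree_insert_edge[OF fin ab(4), of v] in_r(2)
      by (auto simp: of_bool_def split: if_splits)
  qed
  moreover have "\<exists>s\<in>set (r # Ps). f \<subseteq> set s" if f: "f \<in> insert {a, b} F" for f
  proof (cases "f = {a, b}")
    case False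
    then obtain s where "s \<in> set (p # q # Ps)" "f \<subseteq> set s"
      using comp f unfolding components_of_def by blast
    then show ?thesis using r(2) by auto
  qed (use in_r in simp)
  ultimately have "components_of E V (insert {a, b} F) (r # Ps)"
    using r(1) unfolding components_of_def by blast
  then show ?thesis by (rule that)
qed

lemma components_of_ends_pos:
  assumes Ps: "components_of E V F Ps" and simple: "simple_graph V E" and e: "e \<in> E" "v \<in> e"
    and deg: "degree F v < 2"
  shows "ends {v} Ps > 0"
proof -
  have "v \<in> V" using e simple unfolding simple_graph_def by blast
  then have "ends {v} Ps + degree F v = 2" using Ps unfolding components_of_def by blast
  then show ?thesis using deg by simp
qed

theorem linear_forest_components:
  assumes simple: "simple_graph V E" and "finite F" "F \<subseteq> E" "acyclic_edges F" "\<And>v. degree F v \<le> 2"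
  shows "\<exists>Ps. components_of E V F Ps"
  using assms(2-5)
proof (induction F rule: finite_induct)
  case empty
  obtain vs where "set vs = V" "distinct vs"
    using simple finite_distinct_list[of V] unfolding simple_graph_def by blast
  moreover have "degree {} v = 0" for v :: 'a unfolding degree_def by simp
  ultimately show ?case unfolding components_of_def using path_system_singletons[of vs] by auto
next
  case (insert e F)
  have deg: "degree (insert e F) v = degree F v + of_bool (v \<in> e)" for v
    using degree_insert_edge[OF insert.hyps] .
  have "degree F v \<le> 2" for v using insert.prems(3)[of v] deg[of v] by simp
  then obtain Ps where Ps: "components_of E V F Ps"
    using insert.IH insert.prems(1) acyclic_subset[OF insert.prems(2)] by blast
  obtain a b where e: "e = {a, b}" "a \<noteq> b"
    using fin_graph_edgeE[OF simple_graph_fin_graph[OF simple]] insert.prems(1) by blast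
  have ends_pos: "ends {v} Ps > 0" if "v \<in> e" for v
    using components_of_ends_pos[OF Ps simple _ that] insert.prems(1) insert.prems(3)[of v] deg[of v]
      that by simp
  obtain p where p: "p \<in> set Ps" "a \<in> {hd p, last p}" using ends_pos_ex[OF ends_pos[of a]] e(1) by blast
  obtain q where q: "q \<in> set Ps" "b \<in> {hd q, last q}" using ends_pos_ex[OF ends_pos[of b]] e(1) by blast
  have front: "mset Ps = mset (p # remove1 p Ps)" by (rule mset_to_front[OF p(1)])
  have "p \<noteq> q"
  proof
    assume "p = q"
    then have "{hd p, last p} = {a, b}" using p(2) q(2) e(2) by auto
    then show False
      using joining_own_ends_not_acyclic[OF _ insert.hyps(1)] Ps components_of_perm[OF front] e
        insert.hyps(2) insert.prems(2)
      by blast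
  qed
  then have "mset (remove1 p Ps) = mset (q # remove1 q (remove1 p Ps))"
    using q(1) by (intro mset_to_front) simp
  then have "mset Ps = mset (p # q # remove1 q (remove1 p Ps))" using front by (metis mset.simps(2))
  then have "components_of E V F (p # q # remove1 q (remove1 p Ps))"
    using Ps components_of_perm by blast
  then show ?case
    using components_of_insert_edge[OF _ insert.hyps(1) p(2) q(2)] insert.prems(1) insert.hyps(2)
    unfolding e(1) by (metis insert_subset)
qed

text \<open>
Joining path ends in \<open>Q\<close> to ends in \<open>U\<close> until none is left in \<open>Q\<close>, and then the remaining ends,
which all lie in the clique \<open>K\<close>, among each other, yields a Hamilton cycle.
\<close>

locale clique_with_hubs =
  fixes E :: "'a set set" and V K U Q :: "'a set"
  assumes simple_E: "simple_graph V E"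
    and card_V: "card V \<ge> 3"
    and clique_K: "u \<in> K \<Longrightarrow> v \<in> K \<Longrightarrow> u \<noteq> v \<Longrightarrow> adj E u v"
    and U_Q_adj: "u \<in> U \<Longrightarrow> v \<in> Q \<Longrightarrow> adj E u v"
    and U_subset_K: "U \<subseteq> K"
    and Q_K_disjoint: "Q \<inter> K = {}"
begin

definition joinable :: "'a list list \<Rightarrow> bool" where
  "joinable Ps \<longleftrightarrow> path_system E V Ps \<and> ends (- (Q \<union> K)) Ps = 0 \<and> (ends Q Ps = 0 \<or> ends Q Ps < ends U Ps)"

lemma joinable_perm: "mset Ps = mset Qs \<Longrightarrow> joinable Ps \<longleftrightarrow> joinable Qs"
  unfolding joinable_def using path_system_perm ends_perm by metis

lemma path_ends_Q_U_le: "path_ends Q p + path_ends U p \<le> 2"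
  unfolding path_ends_def using U_subset_K Q_K_disjoint by (auto simp: of_bool_def)

lemma joinable_ends_in_K:
  assumes "joinable Ps" "p \<in> set Ps" "path_ends Q p = 0"
  shows "hd p \<in> K" "last p \<in> K"
proof -
  have "path_ends (- (Q \<union> K)) p = 0" using assms(1,2) ends_eq_0_iff unfolding joinable_def by blast
  then show "hd p \<in> K" "last p \<in> K"
    using assms(3) unfolding path_ends_def by (simp_all split: if_splits)
qed

lemma joinable_single_path:
  assumes "joinable [p]"
  shows "hamiltonian V E"
proof -
  have p: "distinct p" "set p = V" "successively (adj E) p"
    using assms unfolding joinable_def path_system_def by auto
  have len: "length p \<ge> 3" using distinct_card[OF p(1)] p(2) card_V by simp
  have "path_ends Q p = 0" using assms path_ends_Q_U_le[of p] unfolding joinable_def by auto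
  then have "hd p \<in> K" "last p \<in> K" using joinable_ends_in_K[OF assms] by auto
  moreover have "p \<noteq> []" using len by auto
  then have "hd p \<noteq> last p"
    using len nth_eq_iff_index_eq[OF p(1), of 0 "length p - 1"]
    by (auto simp: hd_conv_nth last_conv_nth)
  ultimately have "adj E (last p) (hd p)" using clique_K by metis
  then show ?thesis unfolding hamiltonian_iff hamilton_cycle_def using p len by blast
qed

lemma joinable_ends:
  assumes join: "joinable Ps" and long: "length Ps \<ge> 2"
  obtains p q Rs a b where "mset Ps = mset (p # q # Rs)" "a \<in> {hd p, last p}" "b \<in> {hd q, last q}"
    "adj E a b"
    "ends Q Ps = 0 \<or> a \<in> Q \<and> b \<in> U"
proof (cases "ends Q Ps = 0")
  case True
  obtain p q Rs where Ps: "Ps = p # q # Rs" using long by (cases Ps rule: remdups_adj.cases) auto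
  have "hd p \<in> K" "hd q \<in> K" using joinable_ends_in_K(1)[OF join] True
    unfolding ends_eq_0_iff Ps by auto
  moreover have "hd p \<in> set p" "hd q \<in> set q" "set p \<inter> set q = {}"
    using join unfolding joinable_def path_system_def Ps by auto
  then have "hd p \<noteq> hd q" by auto
  ultimately show ?thesis using that[of p q Rs "hd p" "hd q"] clique_K True Ps by simp
next
  case False
  then have few: "ends Q Ps < ends U Ps" using join unfolding joinable_def by simp
  obtain p a where p: "p \<in> set Ps" "a \<in> {hd p, last p}" "a \<in> Q"
    using False ends_pos_ex[of Q Ps] by blast
  have front: "mset Ps = mset (p # remove1 p Ps)" by (rule mset_to_front[OF p(1)])
  have "path_ends Q p \<ge> 1" using p(2,3) unfolding path_ends_def by auto
  then have "ends U (remove1 p Ps) > 0"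
    using few False path_ends_Q_U_le[of p] ends_perm[OF front, of U] by simp
  then obtain q b where q: "q \<in> set (remove1 p Ps)" "b \<in> {hd q, last q}" "b \<in> U"
    using ends_pos_ex by blast
  then have "mset Ps = mset (p # q # remove1 q (remove1 p Ps))"
    using front mset_to_front[OF q(1)] by (metis mset.simps(2))
  moreover have "adj E a b" using U_Q_adj[OF q(3) p(3)] by (simp add: insert_commute)
  ultimately show ?thesis using that p q by blast
qed

theorem hamiltonian_if_joinable:
  assumes "joinable Ps"
  shows "hamiltonian V E"
  using assms
proof (induction "length Ps" arbitrary: Ps rule: less_induct)
  case less
  consider "Ps = []" | p where "Ps = [p]" | "length Ps \<ge> 2" by (cases Ps rule: remdups_adj.cases) auto
  then show ?case
  proof cases
    case 1
    then show ?thesis using less.prems card_V unfolding joinable_def path_system_def by auto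
  next
    case 2
    then show ?thesis using joinable_single_path less.prems by simp
  next
    case 3
    obtain p q Rs a b where pq: "mset Ps = mset (p # q # Rs)" "a \<in> {hd p, last p}" "b \<in> {hd q, last q}"
      "adj E a b"
        "ends Q Ps = 0 \<or> a \<in> Q \<and> b \<in> U"
      using joinable_ends[OF less.prems 3] .
    have join: "joinable (p # q # Rs)" using less.prems joinable_perm[OF pq(1)] by simp
    then obtain r where r: "path_system E V (r # Rs)"
        "\<And>X. ends X (r # Rs) + of_bool (a \<in> X) + of_bool (b \<in> X) = ends X (p # q # Rs)"
      using merge_paths[OF _ pq(2-4)] unfolding joinable_def by blast
    have "ends Q (r # Rs) = 0 \<or> ends Q (r # Rs) < ends U (r # Rs)"
    proof (cases "ends Q Ps = 0")
      case True
      then show ?thesis using r(2)[of Q] ends_perm[OF pq(1), of Q] by simp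
    next
      case False
      then have "a \<in> Q" "b \<in> U" "b \<notin> Q" "a \<notin> U" using pq(5) U_subset_K Q_K_disjoint by auto
      then show ?thesis using join r(2)[of Q] r(2)[of U] unfolding joinable_def by auto
    qed
    moreover have "ends (- (Q \<union> K)) (r # Rs) = 0"
      using join r(2)[of "- (Q \<union> K)"] unfolding joinable_def by simp
    ultimately have "joinable (r # Rs)" using r(1) unfolding joinable_def by blast
    moreover have "length (r # Rs) < length Ps" using mset_eq_length[OF pq(1)] by simp
    ultimately show ?thesis by (rule less.hyps[rotated])
  qed
qed

end

section \<open>Breaking cycles and heavy colour classes\<close>

lemma degree_Int_two_regular:
  assumes fin: "finite F" and deg: "degree F v \<le> 2" and C: "C \<subseteq> F" "two_regular C"
    and D: "D \<subseteq> F" "two_regular D"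
  shows "degree (D \<inter> C) v \<in> {0, 2}"
proof (cases "degree C v = 0")
  case True
  have "degree (D \<inter> C) v \<le> degree C v" by (rule degree_mono) (use fin C(1) finite_subset in auto)
  then show ?thesis using True by simp
next
  case False
  then have "degree C v = 2" using C(2) unfolding two_regular_def by metis
  then have "card {e\<in>F. v \<in> e} \<le> card {e\<in>C. v \<in> e}" using deg unfolding degree_def by simp
  then have "{e\<in>C. v \<in> e} = {e\<in>F. v \<in> e}"
    by (intro card_seteq) (use fin C(1) in auto)
  then have "{e\<in>D \<inter> C. v \<in> e} = {e\<in>D. v \<in> e}" using D(1) by blast
  then have "degree (D \<inter> C) v = degree D v" unfolding degree_def by simp
  then show ?thesis using D(2) unfolding two_regular_def by auto
qed

lemma two_regular_other_edge:
  assumes D: "two_regular D" "finite D" and e: "e \<in> D" "v \<in> e" and X: "finite X" "degree X v \<le> 1"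
  obtains f where "f \<in> D" "v \<in> f" "f \<notin> X"
proof -
  have "degree D v \<noteq> 0" using degree_eq_0_iff[OF D(2)] e by blast
  then have "degree D v = 2" using D(1) unfolding two_regular_def by metis
  then have "\<not> {f\<in>D. v \<in> f} \<subseteq> {f\<in>X. v \<in> f}"
    using X card_mono[of "{f\<in>X. v \<in> f}" "{f\<in>D. v \<in> f}"] unfolding degree_def by auto
  then show ?thesis using that by blast
qed

lemma two_regular_adjacent_edges:
  assumes D: "two_regular D" "fin_graph D" and xy: "{x, y} \<in> D"
  obtains f h where "f \<in> D" "x \<in> f" "f \<noteq> {x, y}" "h \<in> D" "y \<in> h" "h \<noteq> {x, y}" "f \<noteq> h"
proof -
  have fin: "finite D" by (rule fin_graph_finite[OF D(2)])
  have "degree {{x, y}} v \<le> 1" for v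
    using degree_insert_edge[of "{}" "{x, y}" v] by (simp add: degree_def)
  then obtain f h where fh: "f \<in> D" "x \<in> f" "f \<notin> {{x, y}}" "h \<in> D" "y \<in> h" "h \<notin> {{x, y}}"
    using two_regular_other_edge[OF D(1) fin xy, of x "{{x, y}}"]
      two_regular_other_edge[OF D(1) fin xy, of y "{{x, y}}"]
    by (metis finite.emptyI finite.insertI insertI1 insertI2)
  have "f \<noteq> h"
  proof
    assume "f = h"
    obtain z where "f = {x, z}" using fin_graph_incident_edgeE[OF D(2) fh(1,2)] by blast
    then have "f = {x, y}" using fh(5) \<open>f = h\<close> fin_graph_edge_neq[OF D(2) xy] by blast
    then show False using fh(3) by simp
  qed
  then show ?thesis using that fh by simp
qed

lemma acyclic_after_breaking_minimal_cycle:
  assumes fin: "finite F" and deg: "\<And>v. degree F v \<le> 2" and C: "C \<subseteq> F" "two_regular C"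
    and minimal: "\<And>D. D \<subseteq> F \<Longrightarrow> two_regular D \<Longrightarrow> card C \<le> card D"
    and "e \<in> C" and acyclic: "acyclic_edges (F - C - R)"
  shows "acyclic_edges (F - insert e R)"
  unfolding acyclic_edges_def
proof (rule notI, elim exE conjE)
  fix D assume D: "D \<subseteq> F - insert e R" "two_regular D"
  have finC: "finite C" using fin C(1) finite_subset by blast
  have "D \<inter> C \<subset> C" using D(1) \<open>e \<in> C\<close> by blast
  then have "card (D \<inter> C) < card C" by (rule psubset_card_mono[OF finC])
  then have "\<not> two_regular (D \<inter> C)" using minimal[of "D \<inter> C"] C(1) by (meson inf.coboundedI2 not_le)
  moreover have "\<forall>v. degree (D \<inter> C) v = 0 \<or> degree (D \<inter> C) v = 2"
    using degree_Int_two_regular[OF fin deg C _ D(2)] D(1) by blast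
  ultimately have "D \<inter> C = {}" unfolding two_regular_def by metis
  then have "D \<subseteq> F - C - R" using D(1) by blast
  then show False using acyclic D(2) unfolding acyclic_edges_def by blast
qed

theorem break_cycles:
  fixes cost \<omega> :: "'a set \<Rightarrow> real"
  assumes "finite F" "\<And>v. degree F v \<le> 2" "B \<subseteq> F"
    and nonneg: "\<And>e. \<omega> e \<ge> 0"
    and "\<And>C. C \<subseteq> F \<Longrightarrow> two_regular C \<Longrightarrow> \<exists>e\<in>C \<inter> B. cost e \<le> sum \<omega> C"
  shows "\<exists>R\<subseteq>B. acyclic_edges (F - R) \<and> sum cost R \<le> sum \<omega> F"
  using assms(1,2,3,5)
proof (induction "card F" arbitrary: F B rule: less_induct)
  case less
  show ?case
  proof (cases "acyclic_edges F")
    case True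
    then have "acyclic_edges (F - {}) \<and> sum cost {} \<le> sum \<omega> F" using nonneg by (simp add: sum_nonneg)
    then show ?thesis by blast
  next
    case False
    then obtain C0 where "C0 \<subseteq> F \<and> two_regular C0" unfolding acyclic_edges_def by blast
    from ex_has_least_nat[of "\<lambda>C. C \<subseteq> F \<and> two_regular C", OF this, of card]
    obtain C where C: "C \<subseteq> F" "two_regular C" and minimal: "\<And>D. D \<subseteq> F \<Longrightarrow> two_regular D \<Longrightarrow> card C \<le> card D"
      by blast
    obtain e where e: "e \<in> C" "e \<in> B" "cost e \<le> sum \<omega> C" using less.prems(4)[OF C] by blast
    have "\<exists>R\<subseteq>B - C. acyclic_edges (F - C - R) \<and> sum cost R \<le> sum \<omega> (F - C)"
    proof (rule less.hyps)
      show "card (F - C) < card F"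
        by (rule psubset_card_mono[OF less.prems(1)]) (use C(1) e(1) in blast)
      show "finite (F - C)" using less.prems(1) by simp
      show "degree (F - C) v \<le> 2" for v
        using degree_mono[OF less.prems(1), of "F - C" v] less.prems(2)[of v] by auto
      show "B - C \<subseteq> F - C" using less.prems(3) by blast
      show "\<exists>e\<in>D \<inter> (B - C). cost e \<le> sum \<omega> D" if "D \<subseteq> F - C" "two_regular D" for D
        using less.prems(4)[of D] that by blast
    qed
    then obtain R where R: "R \<subseteq> B - C" "acyclic_edges (F - C - R)" "sum cost R \<le> sum \<omega> (F - C)" by blast
    have "acyclic_edges (F - insert e R)"
      using acyclic_after_breaking_minimal_cycle[OF less.prems(1,2) C minimal e(1) R(2)] .
    moreover have "sum cost (insert e R) \<le> sum \<omega> F"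
    proof -
      have "e \<notin> R" "finite R" using R(1) e(1) less.prems(3) finite_subset[OF _ less.prems(1)] by blast+
      then have "sum cost (insert e R) \<le> sum \<omega> C + sum \<omega> (F - C)" using e(3) R(3) by simp
      then show ?thesis using sum.subset_diff[OF C(1) less.prems(1), of \<omega>] by simp
    qed
    moreover have "insert e R \<subseteq> B" using e(2) R(1) by blast
    ultimately show ?thesis by blast
  qed
qed

lemma exists_bounded_fibres:
  assumes "finite S" "card S \<le> m * d"
  shows "\<exists>f. (\<forall>s\<in>S. f s < m) \<and> (\<forall>j. card {s\<in>S. f s = j} \<le> d)"
proof -
  obtain pos where pos: "bij_betw pos S {0..<card S}" using ex_bij_betw_finite_nat[OF assms(1)] by blast
  have less: "pos s < m * d" if "s \<in> S" for s using bij_betwE[OF pos] that assms(2) by force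
  have "card {s\<in>S. pos s div d = j} \<le> card {j * d..<j * d + d}" for j
  proof (rule card_inj_on_le[where f = pos])
    show "inj_on pos {s\<in>S. pos s div d = j}"
      using pos unfolding bij_betw_def by (blast intro: inj_on_subset)
    show "pos ` {s\<in>S. pos s div d = j} \<subseteq> {j * d..<j * d + d}"
    proof
      fix t assume "t \<in> pos ` {s\<in>S. pos s div d = j}"
      then have t: "t < m * d" "t div d = j" using less by auto
      then have "t mod d < d" by (cases d) auto
      moreover have "j * d + t mod d = t" using div_mult_mod_eq[of t d] unfolding t(2) .
      ultimately show "t \<in> {j * d..<j * d + d}" unfolding atLeastLessThan_iff by linarith
    qed
  qed simp
  then show ?thesis using less by (intro exI[of _ "\<lambda>s. pos s div d"]) (simp add: less_mult_imp_div_less)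
qed

definition split_edge :: "('a \<Rightarrow> 'a set \<Rightarrow> nat) \<Rightarrow> 'a set \<Rightarrow> ('a \<times> nat) set" where
  "split_edge copy e = (\<lambda>v. (v, copy v e)) ` e"

lemma mem_split_edge: "(v, j) \<in> split_edge copy e \<longleftrightarrow> v \<in> e \<and> copy v e = j"
  unfolding split_edge_def by auto

lemma inj_split_edge: "inj (split_edge copy)"
  by (rule inj_on_inverseI[where g = "\<lambda>X. fst ` X"]) (simp add: split_edge_def image_image)

lemma fin_graph_split_edge:
  assumes "fin_graph J"
  shows "fin_graph (split_edge copy ` J)"
proof -
  have "card (split_edge copy e) = card e" for e
    unfolding split_edge_def by (rule card_image) (auto simp: inj_on_def)
  then show ?thesis using assms unfolding fin_graph_def by auto
qed

lemma degree_split_edge: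
  "degree (split_edge copy ` J) (v, j) = card {e\<in>J. v \<in> e \<and> copy v e = j}"
proof -
  have "{X \<in> split_edge copy ` J. (v, j) \<in> X} = split_edge copy ` {e\<in>J. v \<in> e \<and> copy v e = j}"
    by (auto simp: mem_split_edge)
  then show ?thesis
    unfolding degree_def using card_image[OF inj_on_subset[OF inj_split_edge]] by simp
qed

text \<open>Split each vertex \<open>v\<close> into \<open>\<kappa> v\<close> copies of degree at most \<open>d\<close> and apply Vizing's theorem.\<close>

lemma vizing_multiplicity:
  assumes graph: "fin_graph J" and deg: "\<And>v. degree J v \<le> \<kappa> v * d"
  shows "\<exists>c. (\<forall>e\<in>J. c e < Suc d) \<and> (\<forall>i v. card {e\<in>J. v \<in> e \<and> c e = i} \<le> \<kappa> v)"
proof -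
  have "\<forall>v. \<exists>f. (\<forall>e\<in>{e\<in>J. v \<in> e}. f e < \<kappa> v) \<and> (\<forall>j. card {e\<in>{e\<in>J. v \<in> e}. f e = j} \<le> d)"
    using fin_graph_finite[OF graph] deg unfolding degree_def by (intro allI exists_bounded_fibres) auto
  then obtain copy where copy: "\<And>v e. e \<in> J \<Longrightarrow> v \<in> e \<Longrightarrow> copy v e < \<kappa> v"
      "\<And>v j. card {e\<in>{e\<in>J. v \<in> e}. copy v e = j} \<le> d"
    by (auto dest!: choice)
  have "degree (split_edge copy ` J) w < Suc d" for w
    using copy(2)[of "fst w" "snd w"] degree_split_edge[of copy J "fst w" "snd w"] by simp
  then obtain c where c: "proper_edge_coloring (split_edge copy ` J) c (Suc d)"
    using vizing[OF fin_graph_split_edge[OF graph]] unfolding colorable_def by blast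
  have "card {e\<in>J. v \<in> e \<and> c (split_edge copy e) = i} \<le> card {..<\<kappa> v}" for i v
  proof (rule card_inj_on_le[where f = "copy v"])
    show "inj_on (copy v) {e\<in>J. v \<in> e \<and> c (split_edge copy e) = i}"
    proof (rule inj_onI)
      fix e f assume ef: "e \<in> {e\<in>J. v \<in> e \<and> c (split_edge copy e) = i}"
        "f \<in> {e\<in>J. v \<in> e \<and> c (split_edge copy e) = i}" "copy v e = copy v f"
      then have "(v, copy v e) \<in> split_edge copy e" "(v, copy v e) \<in> split_edge copy f"
        by (auto simp: mem_split_edge)
      then have "split_edge copy e = split_edge copy f" using proper_eqD[OF c] ef by blast
      then show "e = f" using inj_split_edge by (metis injD)
    qed
  qed (use copy(1) in auto)
  moreover have "c (split_edge copy e) < Suc d" if "e \<in> J" for e using proper_less[OF c] that by blast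
  ultimately show ?thesis by (intro exI[of _ "\<lambda>e. c (split_edge copy e)"]) simp
qed

lemma exists_heavy_part:
  fixes w :: "'a \<Rightarrow> real"
  assumes "finite A" "\<And>a. a \<in> A \<Longrightarrow> f a < n" "n > 0"
  obtains i :: nat where "sum w A \<le> real n * sum w {a\<in>A. f a = i}"
proof -
  define part where "part i = sum w {a\<in>A. f a = i}" for i
  have total: "sum w A = (\<Sum>i<n. part i)"
    unfolding part_def by (rule sum.group[symmetric]) (use assms(1,2) in auto)
  have "\<exists>i<n. sum w A \<le> real n * part i"
  proof (rule ccontr)
    assume light: "\<not> ?thesis"
    have "(\<Sum>i<n. real n * part i) < (\<Sum>i<n. sum w A)"
      by (rule sum_strict_mono) (use light assms(3) in \<open>auto simp: not_le\<close>)
    then show False unfolding total by (simp add: sum_distrib_left[symmetric])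
  qed
  then show ?thesis using that unfolding part_def by blast
qed

theorem heavy_color_class:
  fixes w :: "'a set \<Rightarrow> real"
  assumes "fin_graph J" "\<And>v. degree J v \<le> \<kappa> v * d"
  obtains F where "F \<subseteq> J" "\<And>v. degree F v \<le> \<kappa> v" "sum w J \<le> real (Suc d) * sum w F"
proof -
  obtain c where c: "\<And>e. e \<in> J \<Longrightarrow> c e < Suc d" "\<And>i v. card {e\<in>J. v \<in> e \<and> c e = i} \<le> \<kappa> v"
    using vizing_multiplicity[OF assms] by blast
  obtain i where i: "sum w J \<le> real (Suc d) * sum w {e\<in>J. c e = i}"
    using exists_heavy_part[of J c "Suc d" w] fin_graph_finite[OF assms(1)] c(1) by blast
  have "{e \<in> {e\<in>J. c e = i}. v \<in> e} = {e\<in>J. v \<in> e \<and> c e = i}" for v by blast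
  then have "degree {e\<in>J. c e = i} v \<le> \<kappa> v" for v using c(2)[of v i] unfolding degree_def by simp
  then show ?thesis using that[of "{e\<in>J. c e = i}"] i by blast
qed

section \<open>Linking edges\<close>

definition linking :: "'a set set \<Rightarrow> 'a set \<Rightarrow> 'a set \<Rightarrow> 'a set set \<Rightarrow> bool" where
  "linking E Q W F \<longleftrightarrow> F \<subseteq> E \<and> (\<forall>e\<in>F. e \<subseteq> Q \<or> (\<exists>x\<in>Q. \<exists>w\<in>W. e = {x, w}))"

definition link_weight :: "'a set \<Rightarrow> real \<Rightarrow> real \<Rightarrow> 'a set \<Rightarrow> real" where
  "link_weight Q a b e = (if e \<subseteq> Q then a else b)"

lemma linking_subset: "linking E Q W F \<Longrightarrow> F \<subseteq> E"
  unfolding linking_def by blast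

lemma linking_mono: "linking E Q W F \<Longrightarrow> D \<subseteq> F \<Longrightarrow> linking E Q W D"
  unfolding linking_def by blast

lemma linking_Union: "linking E Q W F \<Longrightarrow> \<Union>F \<subseteq> Q \<union> W"
  unfolding linking_def by blast

lemma linking_crossE:
  assumes "linking E Q W F" "e \<in> F" "\<not> e \<subseteq> Q"
  obtains x w where "x \<in> Q" "w \<in> W" "e = {x, w}"
  using assms unfolding linking_def by blast

lemma linking_degree_le:
  assumes graph: "fin_graph E" and link: "linking E Q W F"
  shows "degree F x \<le> card (nbrs E x \<inter> (Q \<union> W))"
proof -
  have "nbrs F x \<subseteq> nbrs E x \<inter> (Q \<union> W)"
    using linking_Union[OF link] linking_subset[OF link] unfolding nbrs_def by blast
  then show ?thesis
    unfolding degree_eq_card_nbrs[OF fin_graph_subset[OF graph linking_subset[OF link]]]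
    using finite_nbrs[OF graph] by (intro card_mono) auto
qed

lemma select_cross_edges:
  assumes graph: "fin_graph E" and W: "finite W" and QW: "Q \<inter> W = {}"
    and t: "\<And>w. t w \<le> card (nbrs E w \<inter> Q)"
  obtains B where "B \<subseteq> E" "\<And>e. e \<in> B \<Longrightarrow> \<exists>x\<in>Q. \<exists>w\<in>W. e = {x, w}"
    "\<And>w. w \<in> W \<Longrightarrow> degree B w = t w" "card B = (\<Sum>w\<in>W. t w)"
proof -
  obtain T where T: "\<And>w. T w \<subseteq> nbrs E w \<inter> Q" "\<And>w. card (T w) = t w"
  proof -
    have "\<forall>w. \<exists>T. T \<subseteq> nbrs E w \<inter> Q \<and> card T = t w" using obtain_subset_with_card_n[OF t] by metis
    then show ?thesis using that by metis
  qed
  define B where "B = {{x, w} | x w. w \<in> W \<and> x \<in> T w}"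
  have "{x, w} \<in> E" if "x \<in> T w" for x w using that T(1)[of w] by (auto simp: nbrs_iff insert_commute)
  then have BE: "B \<subseteq> E" unfolding B_def by blast
  have shape: "\<exists>x\<in>Q. \<exists>w\<in>W. e = {x, w}" if "e \<in> B" for e using that T(1) unfolding B_def by blast
  have B: "fin_graph B" using fin_graph_subset[OF graph BE] .
  have "nbrs B w = T w" if w: "w \<in> W" for w
  proof (intro equalityI subsetI)
    fix x assume "x \<in> nbrs B w"
    then obtain x' w' where xw: "{w, x} = {x', w'}" "w' \<in> W" "x' \<in> T w'"
      unfolding nbrs_iff B_def by blast
    then have "w \<noteq> x'" using w QW T(1) by blast
    then show "x \<in> T w" using xw by (metis doubleton_eq_iff)
  next
    fix x assume "x \<in> T w"
    then have "{x, w} \<in> B" unfolding B_def using w by blast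
    then show "x \<in> nbrs B w" by (simp add: nbrs_iff insert_commute)
  qed
  then have deg: "degree B w = t w" if "w \<in> W" for w using that degree_eq_card_nbrs[OF B] T(2) by simp
  have "card (e \<inter> W) = 1" if e: "e \<in> B" for e
  proof -
    obtain x w where xw: "x \<in> Q" "w \<in> W" "e = {x, w}" using shape[OF e] by blast
    then have "e \<inter> W = {w}" using QW by blast
    then show ?thesis by simp
  qed
  then have "card B = (\<Sum>w\<in>W. t w)"
    using sum_degree_eq_sum_card_Int[OF fin_graph_finite[OF B] W] deg by simp
  then show ?thesis using that BE shape deg by blast
qed

lemma twice_card_inner_edges:
  assumes "fin_graph E" "finite Q"
  shows "2 * card {e\<in>E. e \<subseteq> Q} = (\<Sum>x\<in>Q. card (nbrs E x \<inter> Q))"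
proof -
  have inner: "fin_graph {e\<in>E. e \<subseteq> Q}" by (rule fin_graph_subset[OF assms(1)]) simp
  have "nbrs {e\<in>E. e \<subseteq> Q} v = nbrs E v \<inter> Q" if "v \<in> Q" for v unfolding nbrs_def using that by auto
  then show ?thesis
    using sum_degree_eq_twice_card[OF inner assms(2)] degree_eq_card_nbrs[OF inner]
    by (simp add: Sup_le_iff cong: sum.cong)
qed

theorem heavy_linking:
  fixes a b :: real
  assumes graph: "fin_graph E" and fin: "finite Q" "finite W" and QW: "Q \<inter> W = {}"
    and deg_Q: "\<And>x. x \<in> Q \<Longrightarrow> card (nbrs E x \<inter> (Q \<union> W)) \<le> \<kappa> x * d"
  obtains F where "linking E Q W F" "\<And>v. degree F v \<le> \<kappa> v"
    "a * (\<Sum>x\<in>Q. real (card (nbrs E x \<inter> Q))) / 2 + b * (\<Sum>w\<in>W. real (min (card (nbrs E w \<inter> Q)) (\<kappa> w * d)))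
      \<le> real (Suc d) * sum (link_weight Q a b) F"
proof -
  let ?t = "\<lambda>w. min (card (nbrs E w \<inter> Q)) (\<kappa> w * d)"
  let ?inner = "{e\<in>E. e \<subseteq> Q}"
  obtain B where B: "B \<subseteq> E" "\<And>e. e \<in> B \<Longrightarrow> \<exists>x\<in>Q. \<exists>w\<in>W. e = {x, w}"
      "\<And>w. w \<in> W \<Longrightarrow> degree B w = ?t w" "card B = (\<Sum>w\<in>W. ?t w)"
    by (rule select_cross_edges[OF graph fin(2) QW, of ?t]) (simp, (rule that; assumption))
  define J where "J = ?inner \<union> B"
  have linkJ: "linking E Q W J" unfolding linking_def J_def using B(1,2) by blast
  have J: "fin_graph J" "finite J"
    using fin_graph_subset[OF graph linking_subset[OF linkJ]] fin_graph_finite by auto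
  have finB: "finite ?inner" "finite B" using J(2) unfolding J_def by auto
  have cross: "\<not> e \<subseteq> Q" if "e \<in> B" for e using B(2)[OF that] QW by blast
  have "degree J v \<le> \<kappa> v * d" for v
  proof -
    consider "v \<in> Q" | "v \<in> W" | "v \<notin> Q \<union> W" by blast
    then show ?thesis
    proof cases
      case 1
      then show ?thesis using linking_degree_le[OF graph linkJ, of v] deg_Q[of v] by simp
    next
      case 2
      then have "{e\<in>J. v \<in> e} = {e\<in>B. v \<in> e}" unfolding J_def using QW by blast
      then show ?thesis using B(3)[OF 2] unfolding degree_def by simp
    next
      case 3
      then have "degree J v = 0" using degree_eq_0_iff[OF J(2), of v] linking_Union[OF linkJ] by blast
      then show ?thesis by simp
    qed
  qed
  then obtain F where F: "F \<subseteq> J" "\<And>v. degree F v \<le> \<kappa> v"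
      "sum (link_weight Q a b) J \<le> real (Suc d) * sum (link_weight Q a b) F"
    by (rule heavy_color_class[OF J(1), where w = "link_weight Q a b"]) (rule that; assumption)
  have "sum (link_weight Q a b) J = sum (link_weight Q a b) ?inner + sum (link_weight Q a b) B"
    unfolding J_def using finB cross by (intro sum.union_disjoint) auto
  also have "\<dots> = a * real (card ?inner) + b * real (card B)"
    unfolding link_weight_def using cross by (simp add: mult.commute)
  also have "real (card ?inner) = (\<Sum>x\<in>Q. real (card (nbrs E x \<inter> Q))) / 2"
    using arg_cong[OF twice_card_inner_edges[OF graph fin(1)], of real] by simp
  finally show ?thesis using that[of F] linking_mono[OF linkJ F(1)] F(2,3) B(4) by simp
qed

section \<open>Dense critical graphs\<close>

lemma sum_nbrs_swap:
  fixes f :: "'a \<Rightarrow> real"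
  assumes "finite X" "finite Y"
  shows "(\<Sum>x\<in>X. real (card (nbrs E x \<inter> Y)) * f x) = (\<Sum>y\<in>Y. \<Sum>x\<in>nbrs E y \<inter> X. f x)"
proof -
  have "real (card (nbrs E x \<inter> Y)) * f x = (\<Sum>y | y \<in> Y \<and> x \<in> nbrs E y. f x)" for x
  proof -
    have "{y. y \<in> Y \<and> x \<in> nbrs E y} = nbrs E x \<inter> Y" using nbrs_sym[of x E] by blast
    then show ?thesis by simp
  qed
  then have "(\<Sum>x\<in>X. real (card (nbrs E x \<inter> Y)) * f x) = (\<Sum>x\<in>X. \<Sum>y | y \<in> Y \<and> x \<in> nbrs E y. f x)"
    by (simp only:)
  also have "\<dots> = (\<Sum>y\<in>Y. \<Sum>x | x \<in> X \<and> x \<in> nbrs E y. f x)" by (rule sum.swap_restrict[OF assms])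
  also have "\<dots> = (\<Sum>y\<in>Y. \<Sum>x\<in>nbrs E y \<inter> X. f x)"
    by (intro sum.cong refl) auto
  finally show ?thesis .
qed

lemma ratio_diff_le:
  fixes t m k :: real
  assumes "0 \<le> t" "t \<le> m" "0 < m" "m \<le> k"
  shows "t / m - (k + 1 - m) / k \<le> t / k"
proof -
  have "t * (k - m) \<le> m * (k + 1 - m)" using assms by (intro mult_mono) auto
  then have "t * (k - m) / (m * k) \<le> m * (k + 1 - m) / (m * k)"
    using assms by (intro divide_right_mono) simp_all
  moreover have "t * (k - m) / (m * k) = t / m - t / k"
    using assms diff_frac_eq[of m k t t] by (simp add: right_diff_distrib)
  moreover have "m * (k + 1 - m) / (m * k) = (k + 1 - m) / k" using assms by simp
  ultimately show ?thesis by linarith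
qed

locale dense_critical = critical_graph +
  fixes V :: "'a set" and E' :: "'a set set"
  assumes simple: "simple_graph V E"
    and degree_pos: "v \<in> V \<Longrightarrow> degree E v > 0"
    and dense: "2 * card V + 36 \<le> 3 * k"
    and subset_closure: "E \<subseteq> E'"
    and simple_closure: "simple_graph V E'"
    and closed: "u \<in> V \<Longrightarrow> v \<in> V \<Longrightarrow> u \<noteq> v \<Longrightarrow> card V \<le> degree E' u + degree E' v \<Longrightarrow> {u, v} \<in> E'"
begin

definition Low :: "'a set" where
  "Low = {v\<in>V. low v}"

definition High :: "'a set" where
  "High = {v\<in>V. \<not> low v}"

definition Hub :: "'a set" where
  "Hub = {v\<in>High. \<forall>w\<in>High. w \<noteq> v \<longrightarrow> {v, w} \<in> E'}"

definition Big :: "'a set" where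
  "Big = {v\<in>High - Hub. card V \<le> 2 * degree E' v}"

definition Small :: "'a set" where
  "Small = {v\<in>High - Hub. 2 * degree E' v < card V}"

definition hub_degree :: "'a \<Rightarrow> nat" where
  "hub_degree v = card (nbrs E v \<inter> Hub)"

definition nonhub_degree :: "'a \<Rightarrow> nat" where
  "nonhub_degree v = card (nbrs E v - Hub)"

definition hub_share :: "'a \<Rightarrow> real" where
  "hub_share v = real (hub_degree v) / real (degree E v)"

definition nonhub_share :: "'a \<Rightarrow> real" where
  "nonhub_share v = real (nonhub_degree v) / real (degree E v)"

definition recip_sum :: "'a set \<Rightarrow> 'a \<Rightarrow> real" where
  "recip_sum X y = (\<Sum>x\<in>nbrs E y \<inter> X. 1 / real (degree E x))"

lemma finite_V: "finite V"
  using simple unfolding simple_graph_def by blast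

lemma graph_closure: "fin_graph E'"
  using simple_graph_fin_graph[OF simple_closure] .

lemma nbrs_subset_V: "nbrs E v \<subseteq> V"
  using simple_graph_nbrs_subset[OF simple] .

lemma degree_le_closure: "degree E v \<le> degree E' v"
  using degree_mono[OF fin_graph_finite[OF graph_closure] subset_closure] .

lemma k_pos: "k > 0"
  using dense by simp

lemma parts: "V = Low \<union> High" "High = Hub \<union> Big \<union> Small"
  "Low \<inter> High = {}" "Hub \<inter> Big = {}" "Hub \<inter> Small = {}" "Big \<inter> Small = {}"
  unfolding Low_def High_def Hub_def Big_def Small_def by force+

lemma part_subsets: "Low \<subseteq> V" "High \<subseteq> V" "Hub \<subseteq> High" "Big \<subseteq> High" "Small \<subseteq> High"
  using parts by blast+

lemma finite_parts: "finite Low" "finite High" "finite Hub" "finite Big" "finite Small"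
  unfolding Low_def High_def Hub_def Big_def Small_def using finite_V by simp_all

lemma Low_not_High: "v \<in> Low \<Longrightarrow> v \<notin> High"
  using parts(3) by blast

lemma High_degree: "v \<in> High \<Longrightarrow> k \<le> 2 * degree E v"
  unfolding High_def low_def by auto

lemma Low_degree: "v \<in> Low \<Longrightarrow> 2 * degree E v < k"
  unfolding Low_def low_def by auto

lemma Small_degree: "v \<in> Small \<Longrightarrow> 2 * degree E v < card V"
  using degree_le_closure[of v] unfolding Small_def by auto

lemma Low_nbrs:
  assumes "v \<in> Low"
  shows "nbrs E v \<subseteq> High"
proof
  fix w assume w: "w \<in> nbrs E v"
  then have "\<not> low w" using low_independent[of v w] assms unfolding Low_def nbrs_iff by simp
  then show "w \<in> High" using w nbrs_subset_V unfolding High_def by blast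
qed

lemma max_degree_in_Hub:
  assumes "v \<in> V" "degree E v = k"
  shows "v \<in> Hub"
proof -
  have "v \<in> High" unfolding High_def low_def using assms k_pos by simp
  moreover have "{v, w} \<in> E'" if w: "w \<in> High" "w \<noteq> v" for w
  proof (rule closed)
    show "v \<in> V" "w \<in> V" "v \<noteq> w" using assms(1) w unfolding High_def by auto
    have "degree E v + degree E w \<le> degree E' v + degree E' w"
      using degree_le_closure by (simp add: add_mono)
    then show "card V \<le> degree E' v + degree E' w" using High_degree[OF w(1)] dense assms(2) by linarith
  qed
  ultimately show ?thesis unfolding Hub_def by blast
qed

lemma Hub_adj:
  assumes "u \<in> Hub" "w \<in> High" "u \<noteq> w"
  shows "{u, w} \<in> E'"
  using assms unfolding Hub_def by auto

lemma Hub_Big_clique: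
  assumes uv: "u \<in> Hub \<union> Big" "v \<in> Hub \<union> Big" "u \<noteq> v"
  shows "{u, v} \<in> E'"
proof -
  have High: "u \<in> High" "v \<in> High" using uv(1,2) part_subsets(3,4) by auto
  show ?thesis
  proof (cases "u \<in> Hub \<or> v \<in> Hub")
    case True
    then show ?thesis using Hub_adj[of u v] Hub_adj[of v u] High uv(3) by (metis insert_commute)
  next
    case False
    then have "card V \<le> degree E' u + degree E' v" using uv(1,2) unfolding Big_def by simp
    then show ?thesis using closed[of u v] High uv(3) unfolding High_def by simp
  qed
qed

lemma degree_eq_hub_nonhub: "degree E v = hub_degree v + nonhub_degree v"
  unfolding degree_eq_card_nbrs[OF graph] hub_degree_def nonhub_degree_def
  by (rule card_Int_Diff[OF finite_nbrs[OF graph]])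

lemma hub_share_nonhub_share:
  assumes "v \<in> V"
  shows "hub_share v + nonhub_share v = 1"
  unfolding hub_share_def nonhub_share_def add_divide_distrib[symmetric] of_nat_add[symmetric]
    degree_eq_hub_nonhub[symmetric]
  using degree_pos[OF assms] by simp

lemma hub_degree_le: "hub_degree v \<le> card Hub"
  unfolding hub_degree_def using finite_parts by (intro card_mono) auto

lemma card_nbrs_le_nonhub_degree:
  assumes "X \<inter> Hub = {}"
  shows "card (nbrs E v \<inter> X) \<le> nonhub_degree v"
  unfolding nonhub_degree_def using finite_nbrs[OF graph] assms by (intro card_mono) auto

lemma nonhub_degree_le_closure:
  assumes "v \<in> High - Hub"
  shows "nonhub_degree v + card Hub \<le> degree E' v"
proof -
  have "Hub \<subseteq> nbrs E' v"
  proof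
    fix u assume "u \<in> Hub"
    then have "{u, v} \<in> E'" using Hub_adj assms by blast
    then show "u \<in> nbrs E' v" by (simp add: nbrs_iff insert_commute)
  qed
  then have "(nbrs E v - Hub) \<union> Hub \<subseteq> nbrs E' v" using nbrs_mono[OF subset_closure] by blast
  then have "card ((nbrs E v - Hub) \<union> Hub) \<le> degree E' v"
    unfolding degree_eq_card_nbrs[OF graph_closure]
    by (rule card_mono[OF finite_nbrs[OF graph_closure]])
  moreover have "card ((nbrs E v - Hub) \<union> Hub) = nonhub_degree v + card Hub"
    unfolding nonhub_degree_def using finite_nbrs[OF graph] finite_parts
    by (intro card_Un_disjoint) auto
  ultimately show ?thesis by simp
qed

lemma Small_nonhub_degree: "v \<in> Small \<Longrightarrow> 2 * nonhub_degree v + 2 * card Hub < card V"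
  using nonhub_degree_le_closure[of v] unfolding Small_def by auto

lemma nonHub_degree:
  assumes v: "v \<in> High - Hub"
  shows "degree E v + card Hub < card V"
proof -
  obtain w where w: "w \<in> High" "w \<noteq> v" "{v, w} \<notin> E'" using v unfolding Hub_def by blast
  have "w \<notin> Hub" using Hub_adj[of w v] v w by (metis DiffD1 insert_commute)
  then have "card Hub \<le> degree E' w" using nonhub_degree_le_closure[of w] w(1) by simp
  moreover have "degree E' v + degree E' w < card V"
    using closed[of v w] v w part_subsets(2) by (metis DiffD1 not_le subsetD)
  ultimately show ?thesis using degree_le_closure[of v] by simp
qed

lemma hub_degree_ge:
  assumes "x \<in> nbrs E y"
  shows "k + 1 \<le> degree E x + hub_degree y"
proof -
  have "{v \<in> nbrs E y. v \<noteq> x \<and> degree E v = k} \<subseteq> nbrs E y \<inter> Hub"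
    using max_degree_in_Hub nbrs_subset_V[of y] by blast
  then have "card {v \<in> nbrs E y. v \<noteq> x \<and> degree E v = k} \<le> hub_degree y"
    unfolding hub_degree_def using finite_nbrs[OF graph] by (intro card_mono) auto
  moreover have "{x, y} \<in> E" using assms by (simp add: nbrs_iff insert_commute)
  ultimately show ?thesis using vizing_adjacency by fastforce
qed

lemma nonhub_degree_le:
  assumes "x \<in> nbrs E y"
  shows "nonhub_degree y + k + 1 \<le> degree E x + degree E y"
  using hub_degree_ge[OF assms] degree_eq_hub_nonhub[of y] by simp

lemma card_Hub_ge:
  assumes "x \<in> V"
  shows "k + 1 \<le> degree E x + card Hub"
proof -
  have "nbrs E x \<noteq> {}" using degree_pos[OF assms] degree_eq_card_nbrs[OF graph, of x] by auto
  then obtain y where "x \<in> nbrs E y" using nbrs_sym by fast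
  then show ?thesis using hub_degree_ge[of x y] hub_degree_le[of y] by linarith
qed

lemma V_nonempty: "V \<noteq> {}"
proof
  assume "V = {}"
  then have "E = {}" using simple unfolding simple_graph_def by fastforce
  then show False using not_colorable unfolding colorable_def proper_edge_coloring_def by simp
qed

lemma Hub_nonempty: "Hub \<noteq> {}"
proof -
  obtain x where "x \<in> V" using V_nonempty by blast
  then have "card Hub > 0" using card_Hub_ge[of x] degree_le[of x] by linarith
  then show ?thesis by auto
qed

lemma degree_less_card_V:
  assumes "v \<in> V"
  shows "degree E v < card V"
proof -
  have "nbrs E v \<subset> V" using nbrs_subset_V[of v] nbrs_irrefl[OF graph, of v] assms by blast
  then show ?thesis unfolding degree_eq_card_nbrs[OF graph] by (rule psubset_card_mono[OF finite_V])
qed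

lemma k_less_card_V: "k < card V"
proof -
  obtain x where x: "x \<in> V" using V_nonempty by blast
  then have "nbrs E x \<noteq> {}" using degree_pos degree_eq_card_nbrs[OF graph, of x] by fastforce
  then obtain y where y: "{x, y} \<in> E" unfolding nbrs_def by blast
  then have "card {v \<in> nbrs E y. v \<noteq> x \<and> degree E v = k} \<noteq> 0"
    using vizing_adjacency[OF y] degree_le[of x] by linarith
  then have "{v \<in> nbrs E y. v \<noteq> x \<and> degree E v = k} \<noteq> {}" by (metis card.empty)
  then obtain v where v: "v \<in> nbrs E y" "degree E v = k" by blast
  then show ?thesis using degree_less_card_V[of v] nbrs_subset_V by blast
qed

lemma k_ge: "k \<ge> 38"
  using dense k_less_card_V by linarith

lemma recip_sum_le:
  assumes "m > 0" "\<And>x. x \<in> nbrs E y \<inter> X \<Longrightarrow> m \<le> degree E x"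
  shows "recip_sum X y \<le> real (card (nbrs E y \<inter> X)) / real m"
proof -
  have "recip_sum X y \<le> (\<Sum>x\<in>nbrs E y \<inter> X. 1 / real m)"
    unfolding recip_sum_def using assms by (intro sum_mono frac_le) auto
  then show ?thesis by simp
qed

lemma recip_sum_le_nonhub:
  assumes "m > 0" "\<And>x. x \<in> nbrs E y \<inter> X \<Longrightarrow> m \<le> degree E x" "X \<inter> Hub = {}"
  shows "recip_sum X y \<le> real (nonhub_degree y) / real m"
proof -
  have "real (card (nbrs E y \<inter> X)) / real m \<le> real (nonhub_degree y) / real m"
    using card_nbrs_le_nonhub_degree[OF assms(3)] by (intro divide_right_mono) simp_all
  moreover have "recip_sum X y \<le> real (card (nbrs E y \<inter> X)) / real m"
    by (rule recip_sum_le[OF assms(1,2)])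
  ultimately show ?thesis by linarith
qed

lemma recip_sum_Un:
  assumes "X \<inter> Y = {}"
  shows "recip_sum (X \<union> Y) v = recip_sum X v + recip_sum Y v"
proof -
  have "nbrs E v \<inter> (X \<union> Y) = nbrs E v \<inter> X \<union> nbrs E v \<inter> Y" by blast
  then show ?thesis
    unfolding recip_sum_def using finite_nbrs[OF graph, of v] assms by (auto intro: sum.union_disjoint)
qed

lemma sum_recip_sum_swap:
  assumes "finite X" "finite Y"
  shows "(\<Sum>y\<in>Y. recip_sum X y) = (\<Sum>x\<in>X. real (card (nbrs E x \<inter> Y)) / real (degree E x))"
  unfolding recip_sum_def using sum_nbrs_swap[OF assms, of E "\<lambda>x. 1 / real (degree E x)"] by simp

lemma sum_hub_share_less: "(\<Sum>x\<in>V - Hub. hub_share x) < real (card Hub)"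
proof -
  have "(\<Sum>x\<in>V - Hub. hub_share x) = (\<Sum>y\<in>Hub. recip_sum (V - Hub) y)"
    unfolding hub_share_def hub_degree_def using sum_recip_sum_swap finite_V finite_parts(3) by simp
  also have "\<dots> < (\<Sum>y\<in>Hub. 1)"
  proof (rule sum_strict_mono[OF finite_parts(3) Hub_nonempty])
    fix y
    have "recip_sum (V - Hub) y \<le> real (nonhub_degree y) / real (nonhub_degree y + 1)"
    proof (rule recip_sum_le_nonhub)
      fix x assume "x \<in> nbrs E y \<inter> (V - Hub)"
      then show "nonhub_degree y + 1 \<le> degree E x"
        using nonhub_degree_le[of x y] degree_le[of y] by simp
    qed auto
    also have "\<dots> < 1" by simp
    finally show "recip_sum (V - Hub) y < 1" .
  qed
  finally show ?thesis by simp
qed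

lemma recip_sum_diff_hub_share_le:
  assumes "X \<inter> Hub = {}"
  shows "recip_sum X w - hub_share w \<le> real (card (nbrs E w \<inter> X)) / real k"
proof (cases "nbrs E w \<inter> X = {}")
  case True
  then show ?thesis unfolding recip_sum_def hub_share_def by simp
next
  case False
  define t where "t = card (nbrs E w \<inter> X)"
  define m where "m = Min (degree E ` (nbrs E w \<inter> X))"
  have fin: "finite (degree E ` (nbrs E w \<inter> X))" using finite_nbrs[OF graph] by simp
  have "m \<in> degree E ` (nbrs E w \<inter> X)" unfolding m_def using Min_in[OF fin] False by simp
  then obtain x where x: "x \<in> nbrs E w \<inter> X" "degree E x = m" by blast
  have t_less: "t < m"
    using nonhub_degree_le[of x w] card_nbrs_le_nonhub_degree[OF assms, of w] x degree_le[of w]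
    unfolding t_def by auto
  have m_le: "m \<le> k" using x(2) degree_le by blast
  have hub: "k + 1 \<le> m + hub_degree w" using hub_degree_ge[of x w] x by simp
  have "degree E w > 0" using hub m_le degree_eq_hub_nonhub[of w] by linarith
  then have "real (k + 1 - m) / real k \<le> hub_share w"
    unfolding hub_share_def using hub degree_le[of w] by (intro frac_le) auto
  moreover have "recip_sum X w \<le> real t / real m"
    unfolding t_def by (rule recip_sum_le) (use t_less fin in \<open>auto simp: m_def\<close>)
  moreover have "real t / real m - real (k + 1 - m) / real k \<le> real t / real k"
    using ratio_diff_le[of "real t" "real m" "real k"] t_less m_le
    by (simp add: of_nat_diff add.commute)
  ultimately show ?thesis unfolding t_def by linarith
qed

end

section \<open>The counting inequality\<close>

text \<open>
\<open>owner y = Some x\<close> says that \<open>y\<close> is a private neighbour of the low vertex \<open>x\<close>. The set \<open>A\<close> consists of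
the low vertices reachable by exchanges from those with a private neighbour in \<open>Hub\<close>; by maximality
of the assignment on \<open>Small \<union> Big\<close> all neighbours of \<open>A\<close> in \<open>Small \<union> Big\<close> are owned by \<open>A\<close>.
\<close>

locale cherries = dense_critical +
  fixes owner :: "'a \<rightharpoonup> 'a" and A :: "'a set"
  assumes ownerD: "owner y = Some x \<Longrightarrow> x \<in> Low \<and> y \<in> nbrs E x"
    and card_owned: "x \<in> Low \<Longrightarrow> card (owned owner x) = 2"
    and A_subset_Low: "A \<subseteq> Low"
    and A_closed: "x \<in> A \<Longrightarrow> y \<in> nbrs E x \<Longrightarrow> y \<in> Small \<union> Big \<Longrightarrow> \<exists>x'\<in>A. owner y = Some x'"
    and owned_outside_A: "x \<in> Low - A \<Longrightarrow> owned owner x \<subseteq> Small \<union> Big"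
begin

definition Taken :: "'a set" where
  "Taken = {y \<in> Small \<union> Big. nbrs E y \<inter> A \<noteq> {}}"

definition Free_Small :: "'a set" where
  "Free_Small = Small - Taken"

definition Free_Big :: "'a set" where
  "Free_Big = Big - Taken"

definition free_degree :: "'a \<Rightarrow> nat" where
  "free_degree v = card (nbrs E v \<inter> Free_Small)"

definition demand :: real where
  "demand = 2 * (\<Sum>x\<in>Free_Small. real (free_degree x) / real (degree E x))
    + 2 * (\<Sum>w\<in>Free_Big. real (free_degree w) / real k)"

lemma finite_free: "finite A" "finite Taken" "finite Free_Small" "finite Free_Big"
  using finite_subset[OF A_subset_Low finite_parts(1)] finite_parts
  unfolding Taken_def Free_Small_def Free_Big_def by simp_all

lemma free_disjoint:
  "A \<inter> Hub = {}" "Free_Small \<inter> Hub = {}" "A \<inter> Free_Small = {}"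
  "(A \<union> Free_Small) \<inter> Hub = {}"
  using A_subset_Low parts part_subsets unfolding Free_Small_def by blast+

lemma Free_subset: "Free_Small \<subseteq> Small" "Free_Big \<subseteq> Big" "Free_Small \<union> Free_Big \<subseteq> High"
    "Free_Small \<inter> Free_Big = {}" "(Free_Small \<union> Free_Big) \<inter> Hub = {}"
  using part_subsets(4,5) parts(4-6) unfolding Free_Small_def Free_Big_def by auto

lemma free_degree_le: "free_degree v \<le> nonhub_degree v"
  unfolding free_degree_def by (rule card_nbrs_le_nonhub_degree[OF free_disjoint(2)])

lemma Taken_Small_le_1:
  assumes y: "y \<in> Taken \<inter> Small"
  shows "recip_sum A y + nonhub_share y + recip_sum Free_Small y \<le> 1"
proof -
  obtain x0 where x0: "x0 \<in> nbrs E y" "x0 \<in> A" using y unfolding Taken_def by blast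
  then have x0_nonhub: "nonhub_degree y + k + 1 \<le> degree E x0 + degree E y"
    using nonhub_degree_le by blast
  have x0_low: "2 * degree E x0 < k" using Low_degree A_subset_Low x0(2) by blast
  have y_small: "2 * degree E y < card V" using Small_degree y by blast
  have y_le: "degree E y \<le> k" by (rule degree_le)
  define gap where "gap = k + 1 - degree E y"
  have gap: "gap > 0" "nonhub_degree y \<le> gap"
    using x0_nonhub x0_low y_small dense y_le unfolding gap_def by linarith+
  have "recip_sum (A \<union> Free_Small) y \<le> real (nonhub_degree y) / real (nonhub_degree y + gap)"
  proof (rule recip_sum_le_nonhub)
    show "nonhub_degree y + gap \<le> degree E x" if "x \<in> nbrs E y \<inter> (A \<union> Free_Small)" for x
      using nonhub_degree_le[of x y] that y_le unfolding gap_def by simp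
  qed (use gap free_disjoint in auto)
  also have "\<dots> \<le> 1 / 2" using gap by (simp add: divide_le_eq)
  finally have "recip_sum A y + recip_sum Free_Small y \<le> 1 / 2"
    unfolding recip_sum_Un[OF free_disjoint(3)] .
  moreover have "2 * nonhub_degree y \<le> degree E y" using x0_nonhub x0_low y_le by linarith
  then have "nonhub_share y \<le> 1 / 2"
    unfolding nonhub_share_def by (cases "degree E y = 0") (simp_all add: divide_le_eq)
  ultimately show ?thesis by linarith
qed

lemma Low_recip_sum_le:
  assumes x: "x \<in> Low - A"
  shows "recip_sum Free_Small x \<le> hub_share x"
proof (cases "nbrs E x \<inter> Free_Small = {}")
  case True
  then show ?thesis unfolding recip_sum_def hub_share_def by simp
next
  case False
  then obtain y where y: "y \<in> nbrs E x" "y \<in> Small" using Free_subset(1) by blast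
  have x_low: "2 * degree E x < k" using Low_degree x by blast
  have x_pos: "degree E x > 0" using degree_pos x part_subsets(1) by blast
  have "recip_sum Free_Small x \<le> real (nonhub_degree x) / real (degree E x)"
  proof (rule recip_sum_le_nonhub[OF x_pos _ free_disjoint(2)])
    fix z assume "z \<in> nbrs E x \<inter> Free_Small"
    then have "z \<in> High" using Free_subset(3) by blast
    then show "degree E x \<le> degree E z" using High_degree[of z] x_low by linarith
  qed
  moreover have "nonhub_degree x \<le> hub_degree x"
    using hub_degree_ge[OF y(1)] x_low Small_degree[OF y(2)] dense degree_eq_hub_nonhub[of x]
    by linarith
  then have "real (nonhub_degree x) / real (degree E x) \<le> hub_share x"
    unfolding hub_share_def by (intro divide_right_mono) simp_all
  ultimately show ?thesis by linarith
qed

lemma Taken_Big_le_1: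
  assumes w: "w \<in> Taken \<inter> Big"
  shows "2 * recip_sum A w + 2 * recip_sum Free_Small w - 2 * hub_share w \<le> 1"
proof -
  obtain x0 where x0: "x0 \<in> nbrs E w" "x0 \<in> A" using w unfolding Taken_def by blast
  then have "nonhub_degree w + k + 1 \<le> degree E x0 + degree E w" using nonhub_degree_le by blast
  moreover have "2 * degree E x0 < k" using Low_degree A_subset_Low x0(2) by blast
  ultimately have "2 * nonhub_degree w \<le> k" using degree_le[of w] by linarith
  then have "2 * card (nbrs E w \<inter> (A \<union> Free_Small)) \<le> k"
    using card_nbrs_le_nonhub_degree[OF free_disjoint(4), of w] by linarith
  then have "real (card (nbrs E w \<inter> (A \<union> Free_Small))) / real k \<le> 1 / 2"
    using k_pos by (simp add: divide_le_eq)
  then have "recip_sum (A \<union> Free_Small) w - hub_share w \<le> 1 / 2"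
    using recip_sum_diff_hub_share_le[OF free_disjoint(4), of w] by linarith
  then show ?thesis unfolding recip_sum_Un[OF free_disjoint(3)] by linarith
qed

lemma card_A_eq: "real (card A) = sum hub_share A + sum (recip_sum A) Taken"
proof -
  have "nonhub_share x = real (card (nbrs E x \<inter> Taken)) / real (degree E x)" if x: "x \<in> A" for x
  proof -
    have "nbrs E x - Hub = nbrs E x \<inter> Taken"
    proof (intro equalityI subsetI)
      fix y assume y: "y \<in> nbrs E x - Hub"
      then have "y \<in> Small \<union> Big" using Low_nbrs[of x] x A_subset_Low parts(2) by blast
      moreover have "x \<in> nbrs E y" using y nbrs_sym by fast
      ultimately show "y \<in> nbrs E x \<inter> Taken" using y x unfolding Taken_def by blast
    qed (use parts in \<open>auto simp: Taken_def\<close>)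
    then show ?thesis unfolding nonhub_share_def nonhub_degree_def by simp
  qed
  then have "sum nonhub_share A = sum (recip_sum A) Taken"
    unfolding sum_recip_sum_swap[OF finite_free(1,2)] by simp
  moreover have "(\<Sum>x\<in>A. hub_share x + nonhub_share x) = (\<Sum>x\<in>A. 1)"
    by (rule sum.cong[OF refl]) (use hub_share_nonhub_share A_subset_Low part_subsets(1) in blast)
  ultimately show ?thesis by (simp add: sum.distrib)
qed

lemma Free_Small_nonhub_degree:
  assumes y: "y \<in> Free_Small"
  shows "nonhub_degree y = free_degree y + card (nbrs E y \<inter> (Taken \<inter> Small)) + card (nbrs E y \<inter> Big)
    + card (nbrs E y \<inter> (Low - A))"
proof -
  let ?N = "nbrs E y"
  have "?N \<inter> A = {}" using y unfolding Free_Small_def Taken_def by blast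
  then have "?N - Hub = ((?N \<inter> Free_Small \<union> ?N \<inter> (Taken \<inter> Small)) \<union> ?N \<inter> Big) \<union> ?N \<inter> (Low - A)"
    using nbrs_subset_V[of y] parts A_subset_Low unfolding Free_Small_def by blast
  moreover have "?N \<inter> Free_Small \<inter> (?N \<inter> (Taken \<inter> Small)) = {}"
    "(?N \<inter> Free_Small \<union> ?N \<inter> (Taken \<inter> Small)) \<inter> (?N \<inter> Big) = {}"
    "((?N \<inter> Free_Small \<union> ?N \<inter> (Taken \<inter> Small)) \<union> ?N \<inter> Big) \<inter> (?N \<inter> (Low - A)) = {}"
    using parts part_subsets unfolding Free_Small_def by blast+
  ultimately show ?thesis
    unfolding nonhub_degree_def free_degree_def using finite_nbrs[OF graph, of y]
    by (simp add: card_Un_disjoint)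
qed

lemma card_Small_eq:
  "real (card Small) = sum hub_share Small + sum nonhub_share (Taken \<inter> Small)
    + (\<Sum>y\<in>Free_Small. real (free_degree y) / real (degree E y))
    + sum (recip_sum Free_Small) (Taken \<inter> Small) + sum (recip_sum Free_Small) Big
    + sum (recip_sum Free_Small) (Low - A)"
proof -
  have split: "Small = (Taken \<inter> Small) \<union> Free_Small" "(Taken \<inter> Small) \<inter> Free_Small = {}"
    unfolding Free_Small_def by blast+
  have "nonhub_share y = real (free_degree y) / real (degree E y)
      + real (card (nbrs E y \<inter> (Taken \<inter> Small))) / real (degree E y)
      + real (card (nbrs E y \<inter> Big)) / real (degree E y)
      + real (card (nbrs E y \<inter> (Low - A))) / real (degree E y)" if "y \<in> Free_Small" for y
    unfolding nonhub_share_def Free_Small_nonhub_degree[OF that] by (simp add: add_divide_distrib)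
  then have "sum nonhub_share Free_Small = (\<Sum>y\<in>Free_Small. real (free_degree y) / real (degree E y))
      + sum (recip_sum Free_Small) (Taken \<inter> Small) + sum (recip_sum Free_Small) Big
      + sum (recip_sum Free_Small) (Low - A)"
    using finite_free finite_parts by (simp add: sum_recip_sum_swap sum.distrib)
  moreover have "sum nonhub_share Small = sum nonhub_share (Taken \<inter> Small)
    + sum nonhub_share Free_Small"
    using sum.union_disjoint[OF _ finite_free(3) split(2), of nonhub_share] finite_free(2) split(1)
    by simp
  moreover have "(\<Sum>y\<in>Small. hub_share y + nonhub_share y) = (\<Sum>y\<in>Small. 1)"
    by (rule sum.cong[OF refl]) (use hub_share_nonhub_share part_subsets in blast)
  ultimately show ?thesis by (simp add: sum.distrib)
qed

lemma sum_Taken: "sum f Taken = sum f (Taken \<inter> Small) + sum f (Taken \<inter> Big)"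
proof -
  have "Taken = (Taken \<inter> Small) \<union> (Taken \<inter> Big)" unfolding Taken_def by blast
  moreover have "(Taken \<inter> Small) \<inter> (Taken \<inter> Big) = {}" using parts(6) by blast
  ultimately show ?thesis using sum.union_disjoint[of "Taken \<inter> Small" "Taken \<inter> Big" f] finite_free(2)
    by simp
qed

lemma sum_Big: "sum f Big = sum f (Taken \<inter> Big) + sum f Free_Big"
proof -
  have "Big = (Taken \<inter> Big) \<union> Free_Big" "(Taken \<inter> Big) \<inter> Free_Big = {}" unfolding Free_Big_def by blast+
  then show ?thesis using sum.union_disjoint[of "Taken \<inter> Big" Free_Big f] finite_free by simp
qed

lemma sum_nonHub: "sum f (V - Hub) = sum f A + sum f (Low - A) + sum f Small + sum f Big"
proof -
  have "V - Hub = (Low \<union> Small) \<union> Big" using parts(1-5) part_subsets(3) by auto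
  moreover have "Low \<inter> Small = {}" "(Low \<union> Small) \<inter> Big = {}" using parts(3,6) part_subsets(4,5) by auto
  moreover have "sum f Low = sum f (Low - A) + sum f A"
    by (rule sum.subset_diff[OF A_subset_Low finite_parts(1)])
  ultimately show ?thesis using finite_parts by (simp add: sum.union_disjoint add.commute)
qed

theorem counting_inequality:
  "2 * real (card Small) + 2 * real (card A)
    \<le> 2 * sum hub_share (V - Hub) + demand + 2 * real (card (Taken \<inter> Small))
      + real (card (Taken \<inter> Big))"
proof -
  have "(\<Sum>y\<in>Taken \<inter> Small. recip_sum A y + nonhub_share y + recip_sum Free_Small y)
    \<le> (\<Sum>y\<in>Taken \<inter> Small. 1)"
    by (rule sum_mono) (rule Taken_Small_le_1)
  then have Taken_Small: "sum (recip_sum A) (Taken \<inter> Small) + sum nonhub_share (Taken \<inter> Small)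
      + sum (recip_sum Free_Small) (Taken \<inter> Small) \<le> real (card (Taken \<inter> Small))"
    by (simp add: sum.distrib)
  have "(\<Sum>w\<in>Taken \<inter> Big. 2 * recip_sum A w + 2 * recip_sum Free_Small w - 2 * hub_share w)
    \<le> (\<Sum>w\<in>Taken \<inter> Big. 1)"
    by (rule sum_mono) (rule Taken_Big_le_1)
  then have Taken_Big: "2 * sum (recip_sum A) (Taken \<inter> Big)
    + 2 * sum (recip_sum Free_Small) (Taken \<inter> Big)
      - 2 * sum hub_share (Taken \<inter> Big) \<le> real (card (Taken \<inter> Big))"
    by (simp add: sum.distrib sum_subtractf sum_distrib_left)
  have "(\<Sum>w\<in>Free_Big. recip_sum Free_Small w - hub_share w)
    \<le> (\<Sum>w\<in>Free_Big. real (free_degree w) / real k)"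
    unfolding free_degree_def by (rule sum_mono) (rule recip_sum_diff_hub_share_le[OF free_disjoint(2)])
  then have Free_Big: "sum (recip_sum Free_Small) Free_Big - sum hub_share Free_Big
      \<le> (\<Sum>w\<in>Free_Big. real (free_degree w) / real k)"
    by (simp add: sum_subtractf)
  have Low: "sum (recip_sum Free_Small) (Low - A) \<le> sum hub_share (Low - A)"
    by (rule sum_mono) (rule Low_recip_sum_le)
  define inner where "inner = (\<Sum>y\<in>Free_Small. real (free_degree y) / real (degree E y))"
  define cross where "cross = (\<Sum>w\<in>Free_Big. real (free_degree w) / real k)"
  have "demand = 2 * inner + 2 * cross" unfolding demand_def inner_def cross_def ..
  then show ?thesis
    using Taken_Small Taken_Big Free_Big[folded cross_def] Low card_A_eq card_Small_eq[folded inner_def]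
    unfolding sum_nonHub sum_Taken[of "recip_sum A"] sum_Big[of hub_share]
      sum_Big[of "recip_sum Free_Small"]
    by argo
qed

end

section \<open>From linking edges to Hamilton cycles\<close>

context cherries
begin

definition cherry_edges :: "'a set set" where
  "cherry_edges = {{x, y} | x y. owner y = Some x}"

lemma cherry_edgesE:
  assumes "e \<in> cherry_edges"
  obtains x y where "e = {x, y}" "owner y = Some x" "x \<in> Low" "y \<in> High"
proof -
  obtain x y where xy: "e = {x, y}" "owner y = Some x" using assms unfolding cherry_edges_def by blast
  then have "x \<in> Low" "y \<in> nbrs E x" using ownerD by blast+
  then show ?thesis using that[OF xy] Low_nbrs by blast
qed

lemma cherry_edges_iff: "{y, x} \<in> cherry_edges \<longleftrightarrow> owner y = Some x \<or> owner x = Some y"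
  unfolding cherry_edges_def by (auto simp: doubleton_eq_iff)

lemma cherry_edges_subset: "cherry_edges \<subseteq> E"
  unfolding cherry_edges_def using ownerD by (auto simp: nbrs_iff)

lemma cherry_graph: "fin_graph cherry_edges"
  by (rule fin_graph_subset[OF graph cherry_edges_subset])

lemma cherry_edge_High_unique: "e \<in> cherry_edges \<Longrightarrow> u \<in> e \<inter> High \<Longrightarrow> v \<in> e \<inter> High \<Longrightarrow> u = v"
  by (elim cherry_edgesE) (use Low_not_High in auto)

lemma degree_cherry_High:
  assumes y: "y \<in> High"
  shows "degree cherry_edges y = of_bool (y \<in> dom owner)"
proof -
  have "nbrs cherry_edges y = set_option (owner y)"
    unfolding nbrs_def cherry_edges_iff using ownerD[of _ y] y Low_not_High by (auto simp: set_eq_iff)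
  then show ?thesis unfolding degree_eq_card_nbrs[OF cherry_graph] by (cases "owner y") auto
qed

lemma degree_cherry_Low:
  assumes x: "x \<in> Low"
  shows "degree cherry_edges x = 2"
proof -
  have "owner x \<noteq> Some y" for y using ownerD[of x y] Low_nbrs[of y] x Low_not_High by blast
  then have "nbrs cherry_edges x = owned owner x"
    unfolding nbrs_def cherry_edges_iff owned_def by simp
  then show ?thesis unfolding degree_eq_card_nbrs[OF cherry_graph] using card_owned[OF x] by simp
qed

lemma degree_cherry_outside:
  assumes "v \<notin> V"
  shows "degree cherry_edges v = 0"
proof -
  have "\<Union>E \<subseteq> V" using simple unfolding simple_graph_def by blast
  then have "v \<notin> \<Union>cherry_edges" using cherry_edges_subset assms by blast
  then show ?thesis using degree_eq_0_iff[OF fin_graph_finite[OF cherry_graph]] by simp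
qed

lemma sum_degree_cherry_High:
  assumes "X \<subseteq> High"
  shows "(\<Sum>v\<in>X. degree cherry_edges v) = card (X \<inter> dom owner)"
proof -
  have "finite X" using finite_subset[OF assms finite_parts(2)] .
  moreover have "(\<Sum>v\<in>X. degree cherry_edges v) = (\<Sum>v\<in>X. of_bool (v \<in> dom owner))"
    by (rule sum.cong[OF refl]) (use degree_cherry_High assms in blast)
  ultimately show ?thesis by (simp add: Int_def)
qed

lemma Taken_owned_by_A:
  assumes "y \<in> Taken"
  obtains x where "x \<in> A" "owner y = Some x"
proof -
  obtain x where "x \<in> nbrs E y" "x \<in> A" "y \<in> Small \<union> Big" using assms unfolding Taken_def by blast
  then show ?thesis using A_closed[of x y] that by (auto simp: nbrs_iff insert_commute)
qed

lemma owned_by_A_eq: "(\<Union>x\<in>A. owned owner x) = (Hub \<inter> dom owner) \<union> Taken"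
proof (intro equalityI subsetI)
  fix y assume "y \<in> (\<Union>x\<in>A. owned owner x)"
  then obtain x where x: "x \<in> A" "owner y = Some x" unfolding owned_def by blast
  then have "x \<in> Low" "x \<in> nbrs E y" "y \<in> nbrs E x" using ownerD nbrs_sym by fast+
  then have "y \<in> Hub \<or> y \<in> Small \<union> Big" using Low_nbrs parts(2) by blast
  then show "y \<in> (Hub \<inter> dom owner) \<union> Taken"
    using x \<open>x \<in> nbrs E y\<close> unfolding Taken_def by blast
next
  fix y assume "y \<in> (Hub \<inter> dom owner) \<union> Taken"
  then consider x where "y \<in> Hub" "owner y = Some x" | "y \<in> Taken" by blast
  then show "y \<in> (\<Union>x\<in>A. owned owner x)"
  proof cases
    case (1 x)
    then have "x \<in> A" using owned_outside_A[of x] ownerD[of y x] parts(4,5) unfolding owned_def by blast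
    then show ?thesis using 1 unfolding owned_def by blast
  next
    case 2
    then show ?thesis by (elim Taken_owned_by_A) (auto simp: owned_def)
  qed
qed

lemma card_Hub_owned: "card (Hub \<inter> dom owner) + card Taken = 2 * card A"
proof -
  have "finite (owned owner x)" if "x \<in> A" for x
    using card_owned[of x] that A_subset_Low by (metis card.infinite subsetD zero_neq_numeral)
  then have "card (\<Union>x\<in>A. owned owner x) = (\<Sum>x\<in>A. card (owned owner x))"
    by (intro card_UN_disjoint) (use finite_free in \<open>auto simp: owned_def\<close>)
  also have "\<dots> = (\<Sum>x\<in>A. 2)" by (rule sum.cong[OF refl]) (use card_owned A_subset_Low in blast)
  finally have "card ((Hub \<inter> dom owner) \<union> Taken) = 2 * card A" unfolding owned_by_A_eq by simp
  moreover have "(Hub \<inter> dom owner) \<inter> Taken = {}" using parts(4,5) unfolding Taken_def by blast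
  ultimately show ?thesis using finite_parts finite_free by (simp add: card_Un_disjoint)
qed

abbreviation free_linking :: "'a set set \<Rightarrow> bool" where
  "free_linking \<equiv> linking E Free_Small Free_Big"

lemma linking_finite: "free_linking F \<Longrightarrow> finite F"
  by (rule finite_subset[OF linking_subset fin_graph_finite[OF graph]])

lemma linking_degree_0:
  assumes "free_linking F" "v \<notin> Free_Small \<union> Free_Big"
  shows "degree F v = 0"
  using degree_eq_0_iff[OF linking_finite[OF assms(1)]] linking_Union[OF assms(1)] assms(2) by blast

lemma cherry_linking_disjoint:
  assumes "free_linking F"
  shows "cherry_edges \<inter> F = {}"
proof -
  have "e \<notin> F" if "e \<in> cherry_edges" for e
    using that
  proof (rule cherry_edgesE)
    fix x y assume "e = {x, y}" "x \<in> Low"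
    then show "e \<notin> F" using linking_Union[OF assms] Free_subset(3) Low_not_High by blast
  qed
  then show ?thesis by blast
qed

lemma degree_cherry_Un:
  assumes "free_linking F"
  shows "degree (cherry_edges \<union> F) v = degree cherry_edges v + degree F v"
  by (rule degree_union_disjoint[OF fin_graph_finite[OF cherry_graph] linking_finite[OF assms]
        cherry_linking_disjoint[OF assms]])

lemma degree_cherry_Un_le:
  assumes link: "free_linking F" and deg: "\<And>v. v \<in> High \<Longrightarrow> degree F v + of_bool (v \<in> dom owner) \<le> 2"
  shows "degree (cherry_edges \<union> F) v \<le> 2"
proof -
  consider "v \<in> Low" | "v \<in> High" | "v \<notin> V" using parts(1) by blast
  then show ?thesis
  proof cases
    case 1
    then have "degree F v = 0" using linking_degree_0[OF link] Free_subset(3) Low_not_High by blast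
    then show ?thesis using degree_cherry_Un[OF link] degree_cherry_Low[OF 1] by simp
  next
    case 2
    then show ?thesis using degree_cherry_Un[OF link] degree_cherry_High[OF 2] deg[OF 2] by simp
  next
    case 3
    then have "degree F v = 0" using linking_degree_0[OF link] Free_subset(3) part_subsets(2) by blast
    then show ?thesis using degree_cherry_Un[OF link] degree_cherry_outside[OF 3] by simp
  qed
qed

lemma card_Int_Small_eq_link_weight:
  assumes link: "free_linking F" and e: "e \<in> F"
  shows "real (card (e \<inter> Small)) = link_weight Free_Small 2 1 e" "e \<inter> Small \<subseteq> Free_Small"
proof -
  have "real (card (e \<inter> Small)) = link_weight Free_Small 2 1 e \<and> e \<inter> Small \<subseteq> Free_Small"
  proof (cases "e \<subseteq> Free_Small")
    case True
    then have "e \<inter> Small = e" using Free_subset(1) by blast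
    moreover have "card e = 2" using fin_graph_card_edge[OF graph] linking_subset[OF link] e by blast
    ultimately show ?thesis using True by (simp add: link_weight_def)
  next
    case False
    obtain x w where xw: "x \<in> Free_Small" "w \<in> Free_Big" "e = {x, w}"
      using linking_crossE[OF link e False] .
    then have "e \<inter> Small = {x}" using Free_subset(1,2) parts(6) by blast
    then show ?thesis using False xw(1) by (simp add: link_weight_def)
  qed
  then show "real (card (e \<inter> Small)) = link_weight Free_Small 2 1 e" "e \<inter> Small \<subseteq> Free_Small" by blast+
qed

lemma sum_degree_Small_eq_link_weight:
  assumes "free_linking F"
  shows "real (\<Sum>v\<in>Small. degree F v) = sum (link_weight Free_Small 2 1) F"
  unfolding sum_degree_eq_sum_card_Int[OF linking_finite[OF assms] finite_parts(5)]
  using card_Int_Small_eq_link_weight(1)[OF assms] by simp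

lemma card_Small_owned:
  "card (Small \<inter> dom owner) = card (Taken \<inter> Small) + card (Free_Small \<inter> dom owner)"
proof -
  have "Taken \<subseteq> dom owner" by (auto elim: Taken_owned_by_A)
  then have "Small \<inter> dom owner = (Taken \<inter> Small) \<union> (Free_Small \<inter> dom owner)"
    unfolding Free_Small_def by blast
  moreover have "(Taken \<inter> Small) \<inter> (Free_Small \<inter> dom owner) = {}" unfolding Free_Small_def by blast
  ultimately show ?thesis using finite_free by (simp add: card_Un_disjoint)
qed

lemma ends_Low_eq_0:
  assumes link: "free_linking F" and comp: "components_of E' V (cherry_edges \<union> F) Ps"
  shows "ends Low Ps = 0"
proof -
  have "degree (cherry_edges \<union> F) v = 2" if v: "v \<in> Low" for v
  proof -
    have "v \<notin> Free_Small \<union> Free_Big" using Free_subset(3) Low_not_High[OF v] by blast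
    then show ?thesis using degree_cherry_Un[OF link] linking_degree_0[OF link] degree_cherry_Low[OF v]
      by simp
  qed
  then show ?thesis using components_of_ends_sum[OF comp part_subsets(1) finite_parts(1)] by simp
qed

lemma ends_High_part:
  assumes link: "free_linking F" and comp: "components_of E' V (cherry_edges \<union> F) Ps" and X: "X \<subseteq> High"
  shows "ends X Ps + card (X \<inter> dom owner) + (\<Sum>v\<in>X. degree F v) = 2 * card X"
proof -
  have "X \<subseteq> V" "finite X" using X part_subsets(2) finite_subset[OF X finite_parts(2)] by auto
  from components_of_ends_sum[OF comp this] show ?thesis
    unfolding degree_cherry_Un[OF link] by (simp add: sum.distrib sum_degree_cherry_High[OF X])
qed

lemma ends_Small_less_ends_Hub:
  assumes link: "free_linking F" and comp: "components_of E' V (cherry_edges \<union> F) Ps"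
    and sufficient: "demand \<le> real (card (Free_Small \<inter> dom owner)) + sum (link_weight Free_Small 2 1) F"
  shows "ends Small Ps < ends Hub Ps"
proof -
  have Small: "real (ends Small Ps) + real (card (Taken \<inter> Small)) + real (card (Free_Small \<inter> dom owner))
      + sum (link_weight Free_Small 2 1) F = 2 * real (card Small)"
    using arg_cong[OF ends_High_part[OF link comp part_subsets(5)], of real]
    unfolding sum_degree_Small_eq_link_weight[OF link, symmetric] card_Small_owned by simp
  have "degree F v = 0" if "v \<in> Hub" for v using linking_degree_0[OF link] that Free_subset(5) by blast
  then have Hub: "ends Hub Ps + card (Hub \<inter> dom owner) = 2 * card Hub"
    using ends_High_part[OF link comp part_subsets(3)] by simp
  have "card Taken = card (Taken \<inter> Small) + card (Taken \<inter> Big)"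
    using sum_Taken[of "\<lambda>_. 1::nat"] by simp
  then have "real (ends Small Ps) < real (ends Hub Ps)"
    using Small Hub card_Hub_owned counting_inequality sum_hub_share_less sufficient by linarith
  then show ?thesis by simp
qed

theorem hamiltonian_if_linking:
  assumes link: "free_linking F" and deg: "\<And>v. degree (cherry_edges \<union> F) v \<le> 2"
    and acyclic: "acyclic_edges (cherry_edges \<union> F)"
    and sufficient: "demand \<le> real (card (Free_Small \<inter> dom owner)) + sum (link_weight Free_Small 2 1) F"
  shows "hamiltonian V E'"
proof -
  have "cherry_edges \<union> F \<subseteq> E'" using cherry_edges_subset linking_subset[OF link] subset_closure by blast
  moreover have "finite (cherry_edges \<union> F)"
    using linking_finite[OF link] fin_graph_finite[OF cherry_graph] by simp
  ultimately obtain Ps where comp: "components_of E' V (cherry_edges \<union> F) Ps"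
    using linear_forest_components[OF simple_closure _ _ acyclic deg] by blast
  interpret clique_with_hubs E' V "Hub \<union> Big" Hub Small
  proof
    show "card V \<ge> 3" using k_less_card_V k_ge by linarith
    show "{u, v} \<in> E'" if "u \<in> Hub" "v \<in> Small" for u v
      using Hub_adj[OF that(1)] that parts(5) part_subsets(5) by blast
  qed (use simple_closure Hub_Big_clique parts(5,6) in auto)
  have system: "path_system E' V Ps" using comp unfolding components_of_def by blast
  have "- (Small \<union> (Hub \<union> Big)) \<inter> V = Low \<inter> V" using parts(1-3) by auto
  then have "ends (- (Small \<union> (Hub \<union> Big))) Ps = 0"
    using ends_cong_on[OF system] ends_Low_eq_0[OF link comp] by metis
  then have "joinable Ps"
    unfolding joinable_def using system ends_Small_less_ends_Hub[OF link comp sufficient] by blast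
  then show ?thesis by (rule hamiltonian_if_joinable)
qed

theorem hamiltonian_if_breakable:
  assumes link: "free_linking F" and deg: "\<And>v. degree (cherry_edges \<union> F) v \<le> 2"
    and heavy: "demand \<le> sum (link_weight Free_Small a b) F"
    and nonneg: "\<And>e. \<omega> e \<ge> 0"
    and breakable: "\<And>D. D \<subseteq> cherry_edges \<union> F \<Longrightarrow> two_regular D \<Longrightarrow>
      \<exists>e\<in>D \<inter> F. link_weight Free_Small 2 1 e \<le> sum \<omega> D"
    and loss: "sum \<omega> (cherry_edges \<union> F) + sum (link_weight Free_Small a b) F
      \<le> real (card (Free_Small \<inter> dom owner)) + sum (link_weight Free_Small 2 1) F"
  shows "hamiltonian V E'"
proof -
  have fin: "finite (cherry_edges \<union> F)" "finite F"
    using linking_finite[OF link] fin_graph_finite[OF cherry_graph] by auto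
  obtain R where R: "R \<subseteq> F" "acyclic_edges (cherry_edges \<union> F - R)"
      "sum (link_weight Free_Small 2 1) R \<le> sum \<omega> (cherry_edges \<union> F)"
    using break_cycles[OF fin(1) deg _ nonneg breakable] by blast
  have link': "free_linking (F - R)" by (rule linking_mono[OF link]) blast
  have eq: "cherry_edges \<union> (F - R) = cherry_edges \<union> F - R"
    using R(1) cherry_linking_disjoint[OF link] by blast
  show ?thesis
  proof (rule hamiltonian_if_linking[OF link'])
    show "degree (cherry_edges \<union> (F - R)) v \<le> 2" for v
      using degree_mono[OF fin(1), of "cherry_edges \<union> (F - R)" v] deg[of v] unfolding eq by auto
    show "acyclic_edges (cherry_edges \<union> (F - R))" unfolding eq by (rule R(2))
    show "demand \<le> real (card (Free_Small \<inter> dom owner)) + sum (link_weight Free_Small 2 1) (F - R)"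
      using heavy loss R(3) sum.subset_diff[OF R(1) fin(2), of "link_weight Free_Small 2 1"] by linarith
  qed
qed

lemma demand_le:
  fixes a b S :: real
  assumes heavy: "a * (\<Sum>x\<in>Free_Small. real (free_degree x)) / 2
      + b * (\<Sum>w\<in>Free_Big. real (min (free_degree w) (\<kappa> w * d))) \<le> real (Suc d) * S"
    and inner: "\<And>x. x \<in> Free_Small \<Longrightarrow> 4 * real (Suc d) \<le> a * real (degree E x)"
    and cross: "\<And>w. w \<in> Free_Big \<Longrightarrow>
      2 * real (Suc d) * real (free_degree w) \<le> b * real k * real (min (free_degree w) (\<kappa> w * d))"
  shows "demand \<le> S"
proof -
  define C where "C = real (Suc d)"
  have "C * (2 * (real (free_degree x) / real (degree E x))) \<le> a / 2 * real (free_degree x)"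
    if x: "x \<in> Free_Small" for x
  proof -
    have "x \<in> V" using x Free_subset(3) part_subsets(2) by blast
    then have pos: "real (degree E x) > 0" using degree_pos by simp
    have "2 * C \<le> a / 2 * real (degree E x)" using inner[OF x] unfolding C_def by linarith
    then have "2 * C * real (free_degree x) \<le> a / 2 * real (degree E x) * real (free_degree x)"
      by (rule mult_right_mono) simp
    then show ?thesis using pos by (simp add: divide_le_eq mult_ac)
  qed
  then have "(\<Sum>x\<in>Free_Small. C * (2 * (real (free_degree x) / real (degree E x))))
    \<le> (\<Sum>x\<in>Free_Small. a / 2 * real (free_degree x))"
    by (rule sum_mono)
  then have inner_sum: "C * (2 * (\<Sum>x\<in>Free_Small. real (free_degree x) / real (degree E x)))
      \<le> a * (\<Sum>x\<in>Free_Small. real (free_degree x)) / 2"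
    by (simp add: sum_distrib_left sum_divide_distrib)
  have "C * (2 * (real (free_degree w) / real k)) \<le> b * real (min (free_degree w) (\<kappa> w * d))"
    if "w \<in> Free_Big" for w
    using cross[OF that, folded C_def] k_pos by (simp add: divide_le_eq mult_ac)
  then have "(\<Sum>w\<in>Free_Big. C * (2 * (real (free_degree w) / real k)))
      \<le> (\<Sum>w\<in>Free_Big. b * real (min (free_degree w) (\<kappa> w * d)))"
    by (rule sum_mono)
  then have cross_sum: "C * (2 * (\<Sum>w\<in>Free_Big. real (free_degree w) / real k))
      \<le> b * (\<Sum>w\<in>Free_Big. real (min (free_degree w) (\<kappa> w * d)))"
    by (simp add: sum_distrib_left)
  have "C * demand \<le> C * S"
    unfolding demand_def distrib_left[of C] using inner_sum cross_sum heavy unfolding C_def by argo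
  then show ?thesis unfolding C_def by simp
qed

lemma exists_heavy_linking:
  assumes capacity: "\<And>x. x \<in> Free_Small \<Longrightarrow> nonhub_degree x \<le> \<kappa> x * d"
    and inner: "\<And>x. x \<in> Free_Small \<Longrightarrow> 4 * real (Suc d) \<le> a * real (degree E x)"
    and cross: "\<And>w. w \<in> Free_Big \<Longrightarrow>
      2 * real (Suc d) * real (free_degree w) \<le> b * real k * real (min (free_degree w) (\<kappa> w * d))"
  obtains F where "free_linking F" "\<And>v. degree F v \<le> \<kappa> v" "demand \<le> sum (link_weight Free_Small a b) F"
proof -
  have "card (nbrs E x \<inter> (Free_Small \<union> Free_Big)) \<le> \<kappa> x * d" if "x \<in> Free_Small" for x
    using card_nbrs_le_nonhub_degree[OF Free_subset(5), of x] capacity[OF that] by linarith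
  then obtain F where F: "free_linking F" "\<And>v. degree F v \<le> \<kappa> v"
      "a * (\<Sum>x\<in>Free_Small. real (free_degree x)) / 2
        + b * (\<Sum>w\<in>Free_Big. real (min (free_degree w) (\<kappa> w * d)))
        \<le> real (Suc d) * sum (link_weight Free_Small a b) F"
    by (rule heavy_linking[where a = a and b = b, OF graph finite_free(3,4) Free_subset(4),
          folded free_degree_def])
      (assumption, (rule that; assumption))
  show ?thesis by (rule that[OF F(1,2) demand_le[OF F(3) inner cross]])
qed

lemma free_degree_bound:
  assumes "free_degree w > 0"
  shows "4 * free_degree w + 42 \<le> 3 * k"
proof -
  have "nbrs E w \<inter> Free_Small \<noteq> {}" using assms unfolding free_degree_def by auto
  then obtain x where x: "x \<in> nbrs E w" "x \<in> Small" using Free_subset(1) by blast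
  then show ?thesis
    using nonhub_degree_le[OF x(1)] degree_le[of w] Small_degree[OF x(2)] free_degree_le[of w] dense
    by linarith
qed

section \<open>Graphs with low vertices\<close>

definition capacity :: "'a \<Rightarrow> nat" where
  "capacity v = (if v \<in> Free_Small \<or> nbrs E v \<inter> Low \<noteq> {} then 1 else 2)"

lemma capacity_owned: "capacity v + of_bool (v \<in> dom owner) \<le> 2"
proof (cases "v \<in> dom owner")
  case True
  then have "nbrs E v \<inter> Low \<noteq> {}" using ownerD nbrs_sym by fast
  then show ?thesis unfolding capacity_def by simp
qed (simp add: capacity_def)

lemma card_Hub_ge_if_Low:
  assumes "Low \<noteq> {}"
  shows "k + 3 \<le> 2 * card Hub"
proof -
  obtain x where x: "x \<in> Low" using assms by blast
  then show ?thesis using card_Hub_ge[of x] Low_degree[OF x] part_subsets(1) by fastforce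
qed

lemma capacity_cross_bound:
  assumes low: "Low \<noteq> {}" and w: "w \<in> Free_Big" and d: "4 * Suc d \<le> k" "k < 4 * Suc d + 4" "8 \<le> d"
  shows "2 * Suc d * free_degree w \<le> k * min (free_degree w) (capacity w * d)"
proof (cases "free_degree w \<le> capacity w * d")
  case True
  then have "min (free_degree w) (capacity w * d) = free_degree w" by simp
  moreover have "2 * Suc d * free_degree w \<le> k * free_degree w"
    using d(1) by (intro mult_le_mono1) linarith
  ultimately show ?thesis by simp
next
  case False
  then have min: "min (free_degree w) (capacity w * d) = capacity w * d" and pos: "free_degree w > 0"
    by auto
  have dk: "9 * k \<le> Suc d * k" using d(3) by (intro mult_le_mono1) simp
  show ?thesis
  proof (cases "nbrs E w \<inter> Low = {}")
    case True
    then have two: "capacity w = 2" using w Free_subset(4) unfolding capacity_def by auto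
    have "Suc d * (4 * free_degree w + 42) \<le> Suc d * (3 * k)"
      using free_degree_bound[OF pos] by (rule mult_le_mono2)
    then have "4 * (Suc d * free_degree w) + 42 * Suc d \<le> 3 * (Suc d * k)"
      by (simp only: distrib_left mult.left_commute mult.commute)
    moreover have "k * (2 * d) + 2 * k = 2 * (Suc d * k)" by simp
    ultimately have "2 * (Suc d * free_degree w) \<le> k * (2 * d)" using dk by linarith
    then show ?thesis unfolding min unfolding two by (simp only: mult.assoc)
  next
    case False
    then have one: "capacity w = 1" unfolding capacity_def by simp
    obtain x where x: "x \<in> nbrs E w" "x \<in> Low" using False by blast
    have "w \<in> High - Hub" using w Free_subset(3,5) by blast
    then have "2 * free_degree w + 44 \<le> k"
      using nonhub_degree_le[OF x(1)] Low_degree[OF x(2)] nonHub_degree card_Hub_ge_if_Low[OF low] dense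
        free_degree_le[of w]
      by fastforce
    then have "Suc d * (2 * free_degree w + 44) \<le> Suc d * k" by (rule mult_le_mono2)
    then have "2 * (Suc d * free_degree w) + 44 * Suc d \<le> Suc d * k"
      by (simp only: distrib_left mult.left_commute mult.commute)
    moreover have "k * d + k = Suc d * k" by simp
    moreover have "k \<le> 44 * Suc d" using d(2) by presburger
    ultimately have "2 * (Suc d * free_degree w) \<le> k * d" by linarith
    then show ?thesis unfolding min unfolding one by (simp only: mult.assoc mult_1)
  qed
qed

definition free_cherry :: "'a set \<Rightarrow> real" where
  "free_cherry e = of_bool (e \<in> cherry_edges \<and> e \<inter> Free_Small \<noteq> {})"

lemma sum_free_cherry:
  "finite D \<Longrightarrow> sum free_cherry D = real (card {e\<in>D. e \<in> cherry_edges \<and> e \<inter> Free_Small \<noteq> {}})"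
  unfolding free_cherry_def by (simp add: Int_def)

lemma sum_free_cherry_le:
  assumes "finite D"
  shows "sum free_cherry D \<le> real (card (Free_Small \<inter> dom owner))"
proof -
  have "{e\<in>D. e \<in> cherry_edges \<and> e \<inter> Free_Small \<noteq> {}}
    \<subseteq> (\<lambda>y. {the (owner y), y}) ` (Free_Small \<inter> dom owner)"
  proof
    fix e assume e: "e \<in> {e\<in>D. e \<in> cherry_edges \<and> e \<inter> Free_Small \<noteq> {}}"
    then have "e \<in> cherry_edges" by blast
    then obtain x y where xy: "e = {x, y}" "owner y = Some x" "x \<in> Low" "y \<in> High"
      by (rule cherry_edgesE)
    then have "y \<in> Free_Small" using e Free_subset(3) Low_not_High by blast
    then show "e \<in> (\<lambda>y. {the (owner y), y}) ` (Free_Small \<inter> dom owner)"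
      using xy by (intro image_eqI[of _ _ y]) auto
  qed
  then have "card {e\<in>D. e \<in> cherry_edges \<and> e \<inter> Free_Small \<noteq> {}} \<le> card (Free_Small \<inter> dom owner)"
    using finite_free(3) by (intro surj_card_le) auto
  then show ?thesis unfolding sum_free_cherry[OF assms] by simp
qed

lemma cycle_meets_linking:
  assumes D: "D \<subseteq> cherry_edges \<union> F" "two_regular D" "finite D"
  obtains e where "e \<in> D" "e \<in> F"
proof -
  obtain g where g: "g \<in> D" using D(2) unfolding two_regular_def by blast
  show ?thesis
  proof (cases "g \<in> F")
    case True
    then show ?thesis using that g by blast
  next
    case False
    then have "g \<in> cherry_edges" using g D(1) by blast
    then obtain y where y: "y \<in> g" "y \<in> High" by (rule cherry_edgesE) blast
    have "degree cherry_edges y \<le> 1" using degree_cherry_High[OF y(2)] by simp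
    then obtain f where "f \<in> D" "f \<notin> cherry_edges"
      using two_regular_other_edge[OF D(2,3) g y(1) fin_graph_finite[OF cherry_graph]] by blast
    then show ?thesis using that D(1) by blast
  qed
qed

lemma cycle_breakable_with_low:
  assumes link: "free_linking F" and deg: "\<And>v. degree F v \<le> capacity v"
    and D: "D \<subseteq> cherry_edges \<union> F" "two_regular D"
  shows "\<exists>e\<in>D \<inter> F. link_weight Free_Small 2 1 e \<le> sum free_cherry D"
proof -
  have fin: "finite F" "finite D"
    using linking_finite[OF link] D(1) fin_graph_finite[OF cherry_graph] finite_subset by blast+
  obtain e where e: "e \<in> D" "e \<in> F" using cycle_meets_linking[OF D fin(2)] .
  note e_Small = card_Int_Small_eq_link_weight[OF link e(2)]
  let ?cherries = "{g\<in>D. g \<in> cherry_edges \<and> g \<inter> Free_Small \<noteq> {}}"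
  have "e \<inter> Small \<subseteq> (\<lambda>g. the_elem (g \<inter> Free_Small)) ` ?cherries"
  proof
    fix v assume v: "v \<in> e \<inter> Small"
    then have vF: "v \<in> Free_Small" using e_Small(2) by blast
    then have "degree F v \<le> 1" using deg[of v] unfolding capacity_def by simp
    then obtain g where g: "g \<in> D" "v \<in> g" "g \<notin> F"
      using two_regular_other_edge[OF D(2) fin(2) e(1) _ fin(1)] v by blast
    then have cherry: "g \<in> cherry_edges" using D(1) by blast
    have "g \<inter> Free_Small = {v}" using cherry_edge_High_unique[OF cherry] g(2) vF Free_subset(3) by blast
    then show "v \<in> (\<lambda>g. the_elem (g \<inter> Free_Small)) ` ?cherries"
      using g(1) cherry by (intro image_eqI[of _ _ g]) auto
  qed
  then have "card (e \<inter> Small) \<le> card ?cherries" using fin(2) by (intro surj_card_le) auto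
  then have "link_weight Free_Small 2 1 e \<le> sum free_cherry D"
    unfolding e_Small(1)[symmetric] sum_free_cherry[OF fin(2)] by simp
  then show ?thesis using e by blast
qed

lemma hamiltonian_with_low:
  assumes low: "Low \<noteq> {}"
  shows "hamiltonian V E'"
proof -
  define d where "d = k div 4 - 1"
  have d: "4 * Suc d \<le> k" "k < 4 * Suc d + 4" "8 \<le> d" unfolding d_def using k_ge by presburger+
  obtain F where F: "free_linking F" "\<And>v. degree F v \<le> capacity v"
    "demand \<le> sum (link_weight Free_Small 2 1) F"
  proof (rule exists_heavy_linking[of capacity d 2 1])
    show "nonhub_degree x \<le> capacity x * d" if "x \<in> Free_Small" for x
      using that Small_nonhub_degree[of x] Free_subset(1) card_Hub_ge_if_Low[OF low] d(2) dense
      unfolding capacity_def by fastforce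
    show "4 * real (Suc d) \<le> 2 * real (degree E x)" if "x \<in> Free_Small" for x
      using High_degree[of x] that Free_subset(3) d(1) by fastforce
    show "2 * real (Suc d) * real (free_degree w)
      \<le> 1 * real k * real (min (free_degree w) (capacity w * d))"
      if "w \<in> Free_Big" for w
      using of_nat_mono[OF capacity_cross_bound[OF low that d], where 'a = real]
      by (simp add: algebra_simps)
  qed (rule that; assumption)
  have fin: "finite (cherry_edges \<union> F)"
    using linking_finite[OF F(1)] fin_graph_finite[OF cherry_graph] by simp
  show ?thesis
  proof (rule hamiltonian_if_breakable[OF F(1) _ F(3)])
    show "degree (cherry_edges \<union> F) v \<le> 2" for v
    proof (rule degree_cherry_Un_le[OF F(1)])
      show "degree F v + of_bool (v \<in> dom owner) \<le> 2" for v
        using F(2)[of v] capacity_owned[of v] by linarith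
    qed
    show "free_cherry e \<ge> 0" for e unfolding free_cherry_def by simp
    show "\<exists>e\<in>D \<inter> F. link_weight Free_Small 2 1 e \<le> sum free_cherry D"
      if "D \<subseteq> cherry_edges \<union> F" "two_regular D" for D
      by (rule cycle_breakable_with_low[OF F(1,2) that])
  qed (use sum_free_cherry_le[OF fin] in simp)
qed

section \<open>Graphs without low vertices\<close>

lemma no_low:
  assumes "Low = {}"
  shows "cherry_edges = {}" "dom owner = {}"
proof -
  have "owner y = None" for y using ownerD[of y] assms by (cases "owner y") auto
  then show "dom owner = {}" by (simp add: dom_def)
  then show "cherry_edges = {}" unfolding cherry_edges_def by auto
qed

lemma cycle_weight_cross:
  assumes link: "free_linking D" and D: "two_regular D" and e: "e \<in> D" "\<not> e \<subseteq> Free_Small"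
  shows "1 \<le> sum (link_weight Free_Small (2/3) (1/4)) D"
proof -
  let ?\<omega> = "link_weight Free_Small (2/3) (1/4)"
  have graph_D: "fin_graph D" by (rule fin_graph_subset[OF graph linking_subset[OF link]])
  have weight_ge: "?\<omega> f \<ge> 1/4" for f unfolding link_weight_def by simp
  have sum_ge: "sum ?\<omega> X \<le> sum ?\<omega> D" if "X \<subseteq> D" for X
    by (rule sum_mono2[OF fin_graph_finite[OF graph_D] that]) (simp add: link_weight_def)
  obtain x w where xw: "x \<in> Free_Small" "w \<in> Free_Big" "e = {x, w}" using linking_crossE[OF link e] .
  then have w_free: "w \<notin> Free_Small" using Free_subset(4) by blast
  obtain f e' where fe': "f \<in> D" "x \<in> f" "f \<noteq> e" "e' \<in> D" "w \<in> e'" "e' \<noteq> e" "f \<noteq> e'"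
    using two_regular_adjacent_edges[OF D graph_D, of x w] e(1) unfolding xw(3) by metis
  obtain x' w' where "x' \<in> Free_Small" "w' \<in> Free_Big" "e' = {x', w'}"
    by (rule linking_crossE[OF link fe'(4)]) (use fe'(5) w_free in auto)
  then have x': "x' \<in> Free_Small" "e' = {x', w}" using fe'(5) w_free by auto
  obtain f' where f': "f' \<in> D" "x' \<in> f'" "f' \<noteq> e'"
    using two_regular_adjacent_edges[OF D graph_D, of x' w] fe'(4) unfolding x'(2) by metis
  have neq: "x \<noteq> x'" "x' \<noteq> w" using fe'(6) xw x' w_free by auto
  then have "f' \<noteq> e" using f'(2) unfolding xw(3) by auto
  show ?thesis
  proof (cases "f = f'")
    case True
    obtain z where "f = {x, z}" using fin_graph_incident_edgeE[OF graph_D fe'(1,2)] by blast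
    then have "f = {x, x'}" using f'(2) True neq(1) by blast
    then have "?\<omega> f = 2/3" unfolding link_weight_def using xw(1) x'(1) by simp
    moreover have "sum ?\<omega> {e, e', f} = ?\<omega> e + ?\<omega> e' + ?\<omega> f" using fe'(3,6,7) by simp
    moreover have "sum ?\<omega> {e, e', f} \<le> sum ?\<omega> D" by (rule sum_ge) (use e(1) fe'(1,4) in simp)
    ultimately show ?thesis using weight_ge[of e] weight_ge[of e'] by linarith
  next
    case False
    have "sum ?\<omega> {e, e', f, f'} = ?\<omega> e + ?\<omega> e' + ?\<omega> f + ?\<omega> f'"
      using fe'(3,6,7) f'(3) \<open>f' \<noteq> e\<close> False by auto
    moreover have "sum ?\<omega> {e, e', f, f'} \<le> sum ?\<omega> D" by (rule sum_ge) (use e(1) fe'(1,4) f'(1) in simp)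
    ultimately show ?thesis using weight_ge[of e] weight_ge[of e'] weight_ge[of f] weight_ge[of f']
      by linarith
  qed
qed

lemma cycle_weight_inner:
  assumes link: "free_linking D" and D: "two_regular D" and inner: "\<And>f. f \<in> D \<Longrightarrow> f \<subseteq> Free_Small"
  shows "2 \<le> sum (link_weight Free_Small (2/3) (1/4)) D"
proof -
  have graph_D: "fin_graph D" by (rule fin_graph_subset[OF graph linking_subset[OF link]])
  obtain e where "e \<in> D" using D unfolding two_regular_def by blast
  then obtain x y where xy: "{x, y} \<in> D" using fin_graph_edgeE[OF graph_D] by metis
  obtain f h where fh: "f \<in> D" "f \<noteq> {x, y}" "h \<in> D" "h \<noteq> {x, y}" "f \<noteq> h"
    using two_regular_adjacent_edges[OF D graph_D xy] by metis
  have "sum (link_weight Free_Small (2/3) (1/4)) {{x, y}, f, h} = 2"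
    using fh(2,4,5) inner[OF xy] inner[OF fh(1)] inner[OF fh(3)] by (auto simp: link_weight_def)
  moreover have "sum (link_weight Free_Small (2/3) (1/4)) {{x, y}, f, h}
    \<le> sum (link_weight Free_Small (2/3) (1/4)) D"
    by (rule sum_mono2[OF fin_graph_finite[OF graph_D]]) (use xy fh in \<open>auto simp: link_weight_def\<close>)
  ultimately show ?thesis by linarith
qed

text \<open>
A cycle through \<open>Big\<close> has four edges or is a triangle with one edge inside \<open>Small\<close>; it is cut at a
cross edge, of weight 1. Any other cycle has at least three edges, each of weight 2.
\<close>

lemma cycle_breakable_without_low:
  assumes link: "free_linking F" and D: "D \<subseteq> F" "two_regular D"
  shows "\<exists>e\<in>D \<inter> F. link_weight Free_Small 2 1 e \<le> sum (link_weight Free_Small (2/3) (1/4)) D"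
proof -
  have link_D: "free_linking D" using linking_mono[OF link D(1)] .
  show ?thesis
  proof (cases "\<exists>e\<in>D. \<not> e \<subseteq> Free_Small")
    case True
    then obtain e where e: "e \<in> D" "\<not> e \<subseteq> Free_Small" by blast
    then have "link_weight Free_Small 2 1 e \<le> sum (link_weight Free_Small (2/3) (1/4)) D"
      using cycle_weight_cross[OF link_D D(2)] by (simp add: link_weight_def)
    then show ?thesis using e(1) D(1) by blast
  next
    case False
    obtain e where e: "e \<in> D" using D(2) unfolding two_regular_def by blast
    then have "link_weight Free_Small 2 1 e \<le> sum (link_weight Free_Small (2/3) (1/4)) D"
      using cycle_weight_inner[OF link_D D(2)] False by (simp add: link_weight_def)
    then show ?thesis using e D(1) by blast
  qed
qed

lemma cross_bound_without_low:
  assumes d: "3 * Suc d \<le> \<delta>" "\<delta> \<le> 3 * Suc d + 2" "k \<le> 2 * \<delta>" "2 * \<delta> < card V"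
  shows "8 * Suc d * free_degree w \<le> 3 * k * min (free_degree w) (2 * d)"
proof (cases "free_degree w \<le> 2 * d")
  case True
  have "8 * Suc d \<le> 3 * k" using d(1,4) dense by linarith
  then have "8 * Suc d * free_degree w \<le> 3 * k * free_degree w" by (rule mult_le_mono1)
  then show ?thesis using True by simp
next
  case False
  then have min: "min (free_degree w) (2 * d) = 2 * d" and "free_degree w > 0" by auto
  then have "Suc d * (4 * free_degree w + 42) \<le> Suc d * (3 * k)"
    using free_degree_bound by (intro mult_le_mono2) blast
  then have "4 * (Suc d * free_degree w) + 42 * Suc d \<le> 3 * (Suc d * k)"
    by (simp only: distrib_left mult.left_commute mult.commute)
  moreover have "k \<le> 14 * Suc d" using d(2,3) k_ge by linarith
  moreover have "k * d + k = Suc d * k" by simp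
  ultimately have "8 * (Suc d * free_degree w) \<le> 6 * (k * d)" by linarith
  then show ?thesis unfolding min by (simp add: algebra_simps)
qed

lemma exists_linking_without_low:
  assumes low: "Low = {}" and s: "s \<in> Small"
  obtains F where "free_linking F" "\<And>v. degree F v \<le> 2"
    "demand \<le> sum (link_weight Free_Small (4/3) (3/4)) F"
proof -
  define \<delta> where "\<delta> = Min (degree E ` V)"
  have min_le: "\<delta> \<le> degree E v" if "v \<in> V" for v unfolding \<delta>_def using finite_V that by simp
  have "\<delta> \<in> degree E ` V" unfolding \<delta>_def using finite_V V_nonempty by simp
  then obtain x where x: "x \<in> V" "degree E x = \<delta>" by auto
  have Hub: "k + 1 \<le> \<delta> + card Hub" using card_Hub_ge[OF x(1)] x(2) by simp
  have high: "k \<le> 2 * \<delta>" using High_degree[of x] x parts(1) low by blast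
  have Small_V: "Small \<subseteq> V" using part_subsets by blast
  have small: "2 * \<delta> < card V" using Small_degree[OF s] min_le[of s] s Small_V by fastforce
  define d where "d = \<delta> div 3 - 1"
  have "19 \<le> \<delta>" using high k_ge by linarith
  then have d: "3 * Suc d \<le> \<delta>" "\<delta> \<le> 3 * Suc d + 2" unfolding d_def by presburger+
  show ?thesis
  proof (rule exists_heavy_linking[of "\<lambda>_. 2" d "4/3" "3/4"])
    show "nonhub_degree y \<le> 2 * d" if "y \<in> Free_Small" for y
      using Small_nonhub_degree[of y] that Free_subset(1) Hub d dense small by fastforce
    show "4 * real (Suc d) \<le> 4/3 * real (degree E y)" if "y \<in> Free_Small" for y
      using min_le[of y] that Free_subset(1) Small_V d(1) by fastforce
    show "2 * real (Suc d) * real (free_degree w) \<le> 3/4 * real k * real (min (free_degree w) (2 * d))"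
      for w
      using of_nat_mono[OF cross_bound_without_low[OF d high small, of w], where 'a = real]
      by (simp add: algebra_simps)
  qed (rule that; assumption)
qed

lemma hamiltonian_without_low:
  assumes low: "Low = {}"
  shows "hamiltonian V E'"
proof (cases "Small = {}")
  case True
  then have "Free_Small = {}" using Free_subset(1) by blast
  then have "demand = 0" unfolding demand_def free_degree_def by simp
  moreover have "free_linking {}" unfolding linking_def by simp
  ultimately show ?thesis
    using hamiltonian_if_linking[of "{}"] no_low[OF low]
    by (simp add: degree_def acyclic_edges_def two_regular_def)
next
  case False
  then obtain s where "s \<in> Small" by blast
  then obtain F where F: "free_linking F" "\<And>v. degree F v \<le> 2"
    "demand \<le> sum (link_weight Free_Small (4/3) (3/4)) F"
    using exists_linking_without_low[OF low] by metis
  show ?thesis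
  proof (rule hamiltonian_if_breakable[OF F(1) _ F(3)])
    show "degree (cherry_edges \<union> F) v \<le> 2" for v using F(2) no_low[OF low] by simp
    show "link_weight Free_Small (2/3) (1/4) e \<ge> 0" for e unfolding link_weight_def by simp
    show "\<exists>e\<in>D \<inter> F. link_weight Free_Small 2 1 e \<le> sum (link_weight Free_Small (2/3) (1/4)) D"
      if "D \<subseteq> cherry_edges \<union> F" "two_regular D" for D
      using cycle_breakable_without_low[OF F(1)] that no_low[OF low] by simp
    have "link_weight Free_Small (2/3) (1/4) e + link_weight Free_Small (4/3) (3/4) e
      = link_weight Free_Small 2 1 e" for e
      unfolding link_weight_def by simp
    then show "sum (link_weight Free_Small (2/3) (1/4)) (cherry_edges \<union> F)
      + sum (link_weight Free_Small (4/3) (3/4)) F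
        \<le> real (card (Free_Small \<inter> dom owner)) + sum (link_weight Free_Small 2 1) F"
      using no_low[OF low] by (simp add: sum.distrib[symmetric])
  qed
qed

end

section \<open>Hamiltonicity of dense critical graphs\<close>

theorem (in dense_critical) hamiltonian_closure: "hamiltonian V E'"
proof -
  define Adj where "Adj x = (if x \<in> Low then nbrs E x else {})" for x
  interpret bipartite Low Adj
    by unfold_locales (use finite_parts finite_nbrs[OF graph] in \<open>auto simp: Adj_def\<close>)
  have "{x\<in>Low. y \<in> Adj x} = low_nbrs y" for y
    using nbrs_subset_V[of y] nbrs_sym[of y E] unfolding Adj_def low_nbrs_def Low_def by auto
  then have "real 2 \<le> (\<Sum>y\<in>Adj x. 1 / real (card {x'\<in>Low. y \<in> Adj x'}))" if "x \<in> Low" for x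
    using sum_inverse_low_nbrs_ge_2[of x] degree_pos[of x] that unfolding Adj_def Low_def by simp
  then have "2 * card A \<le> card (\<Union>x\<in>A. Adj x)" if "A \<subseteq> Low" for A
    using hall_condition_of_weights[of 2 A] that by simp
  then obtain m0 where "r_fold 2 m0" by (rule hall_r_fold)
  then obtain m A where m: "r_fold 2 m" "A \<subseteq> Low"
      "\<And>x y. x \<in> A \<Longrightarrow> y \<in> Adj x \<inter> (Small \<union> Big) \<Longrightarrow> \<exists>x'\<in>A. m y = Some x'"
      "\<And>x. x \<in> Low - A \<Longrightarrow> owned m x \<subseteq> Small \<union> Big"
    by (rule r_fold_saturating[where Y = "Small \<union> Big"]) (rule that; assumption)
  interpret cherries E k V E' m A
  proof
    show "x \<in> Low \<and> y \<in> nbrs E x" if "m y = Some x" for x y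
      using assignmentD[of m y x] m(1) that unfolding r_fold_def Adj_def by auto
    show "\<exists>x'\<in>A. m y = Some x'" if "x \<in> A" "y \<in> nbrs E x" "y \<in> Small \<union> Big" for x y
      using m(3)[of x y] that m(2) unfolding Adj_def by auto
  qed (use m in \<open>auto simp: r_fold_def\<close>)
  show ?thesis using hamiltonian_with_low hamiltonian_without_low by blast
qed

theorem (in critical_graph) dense_critical_hamiltonian:
  assumes "simple_graph V E" "\<And>v. v \<in> V \<Longrightarrow> degree E v > 0" "2 * card V + 36 \<le> 3 * k"
  shows "hamiltonian V E"
proof -
  obtain E' where E': "E \<subseteq> E'" "simple_graph V E'" "hamiltonian V E' \<Longrightarrow> hamiltonian V E"
    "\<And>u v. u \<in> V \<Longrightarrow> v \<in> V \<Longrightarrow> u \<noteq> v \<Longrightarrow> card V \<le> degree E' u + degree E' v \<Longrightarrow> {u, v} \<in> E'"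
    by (rule bondy_chvatal_closure[OF assms(1)]) (rule that; assumption)
  interpret dense_critical E k V E'
    by unfold_locales (use assms E'(1,2,4) in simp_all)
  show ?thesis using E'(3) hamiltonian_closure .
qed

lemma colorable_chromatic_index:
  assumes "fin_graph E"
  shows "colorable E (chromatic_index E)"
proof -
  have "degree E v < card E + 1" for v
    using card_mono[OF fin_graph_finite[OF assms], of "{e\<in>E. v \<in> e}"]
    unfolding degree_def by (simp add: less_Suc_eq_le)
  then have "\<exists>c. proper_edge_coloring E c (card E + 1)"
    using vizing[OF assms] unfolding colorable_def by blast
  then show ?thesis unfolding colorable_def chromatic_index_def by (rule LeastI)
qed

lemma chromatic_index_le: "colorable E k \<Longrightarrow> chromatic_index E \<le> k"
  unfolding colorable_def chromatic_index_def by (rule Least_le)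

lemma degree_le_max_degree:
  assumes "simple_graph V E"
  shows "degree E v \<le> max_degree V E"
proof (cases "v \<in> V")
  case True
  then show ?thesis using assms unfolding max_degree_def simple_graph_def by auto
next
  case False
  then have "v \<notin> \<Union>E" using assms unfolding simple_graph_def by blast
  then have "degree E v = 0"
    using degree_eq_0_iff[OF fin_graph_finite[OF simple_graph_fin_graph[OF assms]]] by blast
  then show ?thesis by simp
qed

lemma edge_critical_imp_critical_graph:
  assumes simple: "simple_graph V E" and crit: "edge_critical V E"
  shows "critical_graph E (max_degree V E)"
proof
  show graph: "fin_graph E" using simple_graph_fin_graph[OF simple] .
  show "degree E v \<le> max_degree V E" for v by (rule degree_le_max_degree[OF simple])
  show "\<not> colorable E (max_degree V E)"
    using chromatic_index_le[of E] crit unfolding edge_critical_def by fastforce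
  show "colorable (E - {e}) (max_degree V E)" if "e \<in> E" for e
  proof -
    have "subgraph V (E - {e}) V E" using simple unfolding subgraph_def simple_graph_def by blast
    moreover have "(V, E - {e}) \<noteq> (V, E)" using that by blast
    ultimately have "chromatic_index (E - {e}) \<le> max_degree V E"
      using crit unfolding edge_critical_def by blast
    moreover have "fin_graph (E - {e})" by (rule fin_graph_subset[OF graph]) blast
    ultimately show ?thesis using colorable_mono[OF colorable_chromatic_index] by blast
  qed
qed

lemma edge_critical_degree_pos:
  assumes simple: "simple_graph V E" and crit: "edge_critical V E" and v: "v \<in> V"
  shows "degree E v > 0"
proof (rule ccontr)
  assume "\<not> degree E v > 0"
  then have "v \<notin> \<Union>E" using degree_eq_0_iff[OF fin_graph_finite[OF simple_graph_fin_graph[OF simple]]]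
    by blast
  then have "subgraph (V - {v}) E V E" using simple unfolding subgraph_def simple_graph_def by blast
  moreover have "(V - {v}, E) \<noteq> (V, E)" using v by blast
  ultimately have "chromatic_index E \<le> max_degree V E" using crit unfolding edge_critical_def by blast
  then show False using crit unfolding edge_critical_def by simp
qed

theorem theorem1:
  fixes V :: "'a set" and E :: "'a set set"
  assumes "simple_graph V E"
    and "edge_critical V E"
    and "real (max_degree V E) \<ge> 2 * real (card V) / 3 + 12"
  shows "hamiltonian V E"
proof -
  interpret critical_graph E "max_degree V E"
    by (rule edge_critical_imp_critical_graph[OF assms(1,2)])
  have "2 * card V + 36 \<le> 3 * max_degree V E" using assms(3) by linarith
  with assms(1) edge_critical_degree_pos[OF assms(1,2)] show ?thesis
    by (rule dense_critical_hamiltonian)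
qed

end
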